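(* Let $\theta$ be a regular infinite cardinal, let $\tau$ be either $\tau_R$ for a ring $R$, or an arbitrary $\theta$-additive vocabulary, and let $\mathbf{K}$ be respectively the class of (left) $R$-modules, or the class of $\theta$-additive structures with vocabulary $\tau$. Let $\gamma^*$ be a limit ordinal, $\Lambda\subseteq\Lambda^{\mathrm{pe}}_{\gamma^*}(\tau)$, $M\in\mathbf{K}$, $A\subseteq M$, and let $\varepsilon,\xi,\zeta$ denote ordinals $<\theta$. (1) The set $\mathbf{S}^{\varepsilon}_{\Lambda}(A,M)$ has cardinality $\le(|A|^{<\theta})^{|\Lambda|}$. (2) For any cardinal $\kappa\ge4$ there are no $\langle\bar a_\alpha:\alpha<\kappa\rangle\subseteq{}^{\varepsilon}M$, $\langle\bar b_\alpha:\alpha<\kappa\rangle\subseteq{}^{\zeta}M$ and $\varphi(\bar x,\bar y)\in\Lambda^{\mathrm{pe}}_{\gamma^*,\varepsilon,\zeta}$ such that $M\models\varphi[\bar a_\alpha,\bar b_\beta]\wedge\neg\varphi[\bar a_\beta,\bar b_\alpha]$ for all $\alpha<\beta<\kappa$. (3) If $\varphi(\bar x,\bar y)$, with $\mathrm{lh}(\bar x)=\varepsilon$ and $\mathrm{lh}(\bar y)=\zeta$, is a formula from $\mathbb{L}_{\infty,\theta,\gamma^*}(\tau)$ (or just a possibly infinite Boolean combination of such formulas), and $\kappa\ge(\beth_{\gamma^*+2}(|\tau|^{<\theta}))^+$, then there are no $N\in\mathbf{K}$, $\langle\bar a_\alpha:\alpha<\kappa\rangle\subseteq{}^{\varepsilon}N$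 and $\langle\bar b_\alpha:\alpha<\kappa\rangle\subseteq{}^{\zeta}N$ such that $N\models\varphi[\bar a_\alpha,\bar b_\beta]\wedge\neg\varphi[\bar a_\beta,\bar b_\alpha]$ whenever $\alpha<\beta<\kappa$. (In fact $\kappa\ge(\beth_{\gamma^*+1}(|\tau|^{<\theta}))^+$ suffices.) (4) If $p\in\mathbf{S}^{\varepsilon}_{\Lambda}(A,M)$, $\varphi(\bar x,\bar y)\in\Lambda^{\mathrm{pe}}_{\gamma^*,\varepsilon,\xi}$ and $p\cap\{\varphi(\bar x,\bar b):\bar b\in{}^{\xi}A\}\neq\emptyset$, then for some $\bar a_\varphi\in{}^{\varepsilon}A$ and $\bar b\in{}^{\xi}A$ we have $\varphi(\bar x-\bar a_\varphi,\bar b)\in p$ and $\varphi(\bar x-\bar a_\varphi,\bar b)\vdash p\restriction\{\pm\varphi\}$.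
   Context: Sequences. $\mathrm{lh}(\bar x)$ is the length (an ordinal) of a sequence; ${}^{\varepsilon}M$ is the set of sequences of length $\varepsilon$ from $M$. Sums and differences of sequences of equal length are coordinatewise. $\bar a^\frown\bar b$ is concatenation; $\bar0_\xi$ is the zero sequence of length $\xi$. $|X|^{<\theta}$ is the cardinality of the set of sequences of length $<\theta$ from $X$. $\beth_0(\mu)=\mu$, $\beth_{\beta+1}(\mu)=2^{\beth_\beta(\mu)}$, suprema at limits. Vocabularies. A vocabulary consists of function symbols and predicates, each with an arity which may be an infinite ordinal; function symbols may be interpreted as partial functions (an atomic formula containing an undefined term is false). A vocabulary $\tau$ is $\theta$-additive if it contains binary function symbols $+,-$, an individual constant $0$, and all its other symbols have arity $<\theta$. A $\theta$-additive structure $M$ is a structure with $\theta$-additive vocabulary $\tau$ such that: $G_M=(|M|,+^M,-^M,0^M)$ is an Abelian group; for each $\varepsilon$-place predicate $P\in\tau$, $P^M$ is a subgroup of $(G_M)^\varepsilon$; for each $\varepsilon$-place function symbol $F\in\tau\setminus\{+,-,0\}$, $F^M$ is a partial $\varepsilon$-place function whose graph is a subgroup of $(G_M)^{\varepsilon+1}$. For a ring $R$, $\tau_R$ consists of $+,-,0$ and a unary function symbol $F_a$ (left multiplication by $a$) for each $a\in R$; an $R$-module is viewed as a $\tau_R$-structure. Logics. $\mathbb{L}_{\infty,\theta}(\tau)$ is the infinitary logic with conjunctions and disjunctions over arbitrary sets and quantification over blocks of fewer than $\theta$ variables, formulas having fewer than $\theta$ free variables. $\mathbb{L}_{\infty,\theta,\alpha}(\tau)$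 is the set of $\varphi(\bar x)\in\mathbb{L}_{\infty,\theta}(\tau)$ of quantifier depth $<1+\alpha$. The sets $\Lambda^{\mathrm{pe}}_{\alpha,\varepsilon}(\tau)$, for $\varepsilon<\theta$ and $\alpha$ an ordinal, consist of formulas $\varphi(\bar x)$ with $\mathrm{lh}(\bar x)=\varepsilon$ and are defined by induction on $\alpha$. For $\zeta<\theta$, $\Lambda^{\mathrm{pe}}_{\alpha,\varepsilon,\zeta}$ is the set of $\varphi(\bar x,\bar y)$ with $\mathrm{lh}(\bar x)=\varepsilon$, $\mathrm{lh}(\bar y)=\zeta$ and $\varphi\in\Lambda^{\mathrm{pe}}_{\alpha,\varepsilon+\zeta}$; and $\Lambda^{\mathrm{pe}}_{\alpha}=\bigcup_{\varepsilon<\theta}\Lambda^{\mathrm{pe}}_{\alpha,\varepsilon}$. - $\alpha=0$: for $R$-modules, $\Lambda^{\mathrm{pe}}_{0,\varepsilon}$ is the set of formulas $\sum_{\zeta<\varepsilon}a_\zeta x_\zeta=0$ with $a_\zeta\in R$, all but finitely many equal to $0$. For general $\tau$, it is the set of formulas $P(\bar\sigma(\bar x))$, where $P$ is equality or a predicate of $\tau$ and $\bar\sigma$ is a sequence of $\tau$-terms in the variables $\bar x$ of length the arity of $P$. - $\alpha$ limit: $\Lambda^{\mathrm{pe}}_{\alpha,\varepsilon}=\bigcup_{\beta<\alpha}\Lambda^{\mathrm{pe}}_{\beta,\varepsilon}$. - $\alpha=\beta+1$: $\Lambda^{\mathrm{pe}}_{\alpha,\varepsilon}$ is $\Lambda^{\mathrm{pe}}_{\beta,\varepsilon}$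 together with all formulas $(\exists\bar y)\bigwedge\{\varphi(\bar x,\bar y):\varphi\in\Phi\}$ where $\zeta<\theta$, $\mathrm{lh}(\bar y)=\zeta$ and $\Phi\subseteq\Lambda^{\mathrm{pe}}_{\beta,\varepsilon,\zeta}$. Types. For $\bar a\in{}^{\varepsilon}M$, $\mathrm{tp}_\Lambda(\bar a,A,M)$ is the set of all (formal) formulas $\varphi(\bar x^\frown\bar b-\bar c)$ with $\xi<\theta$, $\varphi(\bar x,\bar y)\in\Lambda^{\mathrm{pe}}_{\gamma^*,\varepsilon,\xi}\cap\Lambda$, $\bar b\in{}^{\xi}A$, $\bar c\in{}^{\varepsilon+\xi}A$ and $M\models\varphi[\bar a^\frown\bar b-\bar c]$. $\mathbf{S}^\varepsilon_\Lambda(A,M)=\{\mathrm{tp}_\Lambda(\bar a,A,M):\bar a\in{}^{\varepsilon}M\}$. In (4), $\varphi(\bar x,\bar b)$ is identified with $\varphi(\bar x^\frown\bar b-\bar0_{\varepsilon+\xi})$ and $\varphi(\bar x-\bar a_\varphi,\bar b)$ with $\varphi(\bar x^\frown\bar b-\bar a_\varphi{}^\frown\bar0_\xi)$; $p\restriction\{\pm\varphi\}$ is the set of all formulas $\varphi(\bar x^\frown\bar b'-\bar c')$ ($\bar b'\in{}^\xi A$, $\bar c'\in{}^{\varepsilon+\xi}A$) belonging to $p$ together with the negations of those not belonging to $p$; and $\vdash$ means that every $\bar a'\in{}^{\varepsilon}M$ satisfying the left-hand formula in $M$ satisfies in $M$ every formula on the right. A (possibly infinite) Boolean combination means a formula obtained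 using negation and conjunctions/disjunctions over arbitrary sets. *)

theory Defs
  imports Main "HOL-Library.FuncSet" "HOL-Algebra.Product_Groups" "HOL-Algebra.Ring"
begin

unbundle cardinal_syntax

section \<open>Ordinals as elements of well-ordered types\<close>

text \<open>
  An ordinal is represented by an element \<open>a\<close> of a type of class \<^class>\<open>wellorder\<close>, namely as the
  order type of \<open>{..<a}\<close>.  The cardinal \<open>\<theta>\<close> is given by a well-ordered type \<open>'o\<close> whose order type
  is \<open>\<theta>\<close>; the elements of \<open>'o\<close> are then exactly the ordinals below \<open>\<theta>\<close>.
\<close>

definition ozero :: "'a::wellorder" where
  "ozero = (LEAST x. True)"

definition suc_of :: "'a::wellorder \<Rightarrow> 'a \<Rightarrow> bool" where
  "suc_of b a \<longleftrightarrow> b < a \<and> (\<forall>c>b. a \<le> c)"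

definition is_limit :: "'a::wellorder \<Rightarrow> bool" where
  "is_limit a \<longleftrightarrow> a \<noteq> ozero \<and> (\<forall>b<a. \<exists>c. b < c \<and> c < a)"

definition oone :: "'a::wellorder" where
  "oone = (LEAST x. ozero < x)"

text \<open>
  Ordinal addition.  The least element exists whenever the type is long enough to contain the sum,
  in particular always when the order type of \<open>'a\<close> is an infinite cardinal.
\<close>
function oadd :: "'a::wellorder \<Rightarrow> 'a \<Rightarrow> 'a" where
  "oadd a b = (LEAST c. a \<le> c \<and> (\<forall>b'. b' < b \<longrightarrow> oadd a b' < c))"
  by auto
termination
  by (relation "inv_image {(x, y). x < y} snd") (auto intro: wf_inv_image wf)

declare oadd.simps [simp del]

section \<open>Sequences\<close>

abbreviation seqs :: "'o::wellorder \<Rightarrow> 'a set \<Rightarrow> ('o \<Rightarrow> 'a) set" where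
  "seqs \<epsilon> A \<equiv> {..<\<epsilon>} \<rightarrow>\<^sub>E A"

definition cat :: "'o::wellorder \<Rightarrow> ('o \<Rightarrow> 'a) \<Rightarrow> 'o \<Rightarrow> ('o \<Rightarrow> 'a) \<Rightarrow> 'o \<Rightarrow> 'a" where
  "cat \<epsilon> a \<zeta> b = (\<lambda>i\<in>{..<oadd \<epsilon> \<zeta>}. if i < \<epsilon> then a i else b (THE j. oadd \<epsilon> j = i))"

definition seq_diff :: "'o::wellorder \<Rightarrow> ('o \<Rightarrow> 'a::minus) \<Rightarrow> ('o \<Rightarrow> 'a) \<Rightarrow> 'o \<Rightarrow> 'a" where
  "seq_diff n a b = (\<lambda>i\<in>{..<n}. a i - b i)"

definition zero_seq :: "'o::wellorder \<Rightarrow> 'o \<Rightarrow> 'a::zero" where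
  "zero_seq n = (\<lambda>i\<in>{..<n}. 0)"

definition singl :: "'a \<Rightarrow> 'o::wellorder \<Rightarrow> 'a" where
  "singl x = (\<lambda>i\<in>{..<oone}. x)"

text \<open>
  Sequences of length \<open><\<theta>\<close>.  The length is stored explicitly, since it cannot be recovered from an
  extensional function.
\<close>
definition seqs_lt :: "'a set \<Rightarrow> ('o::wellorder \<times> ('o \<Rightarrow> 'a)) set" where
  "seqs_lt A = (SIGMA \<epsilon>:UNIV. seqs \<epsilon> A)"

section \<open>Vocabularies and structures\<close>

text \<open>
  A \<open>\<theta>\<close>-additive vocabulary is given by its symbols other than \<open>+\<close>, \<open>-\<close>, \<open>0\<close>, the latter three being
  always present.  Arities lie in \<open>'o\<close>, that is, they are ordinals below \<open>\<theta>\<close>.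
\<close>
record ('f, 'p, 'o) vocab =
  Funs :: "'f set"
  Rels :: "'p set"
  farity :: "'f \<Rightarrow> 'o"
  rarity :: "'p \<Rightarrow> 'o"

datatype ('f, 'p) symb = PlusSym | MinusSym | ZeroSym | FunSym 'f | RelSym 'p

definition symbols :: "('f, 'p, 'o) vocab \<Rightarrow> ('f, 'p) symb set" where
  "symbols \<tau> = {PlusSym, MinusSym, ZeroSym} \<union> FunSym ` Funs \<tau> \<union> RelSym ` Rels \<tau>"

text \<open>
  The universe of a structure is the type \<open>'m\<close>, and \<open>+\<close>, \<open>-\<close>, \<open>0\<close> are interpreted by the operations of
  the class \<^class>\<open>ab_group_add\<close>.  Function symbols are interpreted by partial functions.
\<close>
record ('f, 'p, 'o, 'm) struct =
  fint :: "'f \<Rightarrow> ('o \<Rightarrow> 'm) \<Rightarrow> 'm option"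
  rint :: "'p \<Rightarrow> ('o \<Rightarrow> 'm) set"

definition add_group :: "'m::ab_group_add monoid" where
  "add_group = \<lparr>carrier = UNIV, monoid.mult = (+), one = 0\<rparr>"

definition group_power :: "'o::wellorder \<Rightarrow> ('o \<Rightarrow> 'm::ab_group_add) monoid" where
  "group_power n = product_group {..<n} (\<lambda>_. add_group)"

definition fgraph :: "('f, 'p, 'o::wellorder) vocab \<Rightarrow> ('f, 'p, 'o, 'm) struct \<Rightarrow> 'f \<Rightarrow> ('o \<Rightarrow> 'm) set" where
  "fgraph \<tau> M f = {cat (farity \<tau> f) s oone (singl v) | s v. s \<in> seqs (farity \<tau> f) UNIV \<and> fint M f s = Some v}"

definition additive_structures ::
  "('f, 'p, 'o::wellorder) vocab \<Rightarrow> ('f, 'p, 'o, 'm::ab_group_add) struct set" where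
  "additive_structures \<tau> = {M.
     (\<forall>P\<in>Rels \<tau>. subgroup (rint M P) (group_power (rarity \<tau> P))) \<and>
     (\<forall>f\<in>Funs \<tau>. subgroup (fgraph \<tau> M f) (group_power (oadd (farity \<tau> f) oone)))}"

definition ring_vocab :: "('f, 'b) ring_scheme \<Rightarrow> ('f, 'p, 'o::wellorder) vocab" where
  "ring_vocab R = \<lparr>Funs = carrier R, Rels = {}, farity = (\<lambda>_. oone), rarity = (\<lambda>_. ozero)\<rparr>"

definition act :: "('f, 'p, 'o::wellorder, 'm) struct \<Rightarrow> 'f \<Rightarrow> 'm \<Rightarrow> 'm" where
  "act M a x = the (fint M a (singl x))"

definition left_modules ::
  "('f, 'b) ring_scheme \<Rightarrow> ('f, 'p, 'o::wellorder, 'm::ab_group_add) struct set" where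
  "left_modules R = {M.
     (\<forall>a\<in>carrier R. \<forall>x. fint M a (singl x) \<noteq> None) \<and>
     (\<forall>a\<in>carrier R. \<forall>x y. act M a (x + y) = act M a x + act M a y) \<and>
     (\<forall>a\<in>carrier R. \<forall>b\<in>carrier R. \<forall>x. act M (a \<oplus>\<^bsub>R\<^esub> b) x = act M a x + act M b x) \<and>
     (\<forall>a\<in>carrier R. \<forall>b\<in>carrier R. \<forall>x. act M (a \<otimes>\<^bsub>R\<^esub> b) x = act M a (act M b x)) \<and>
     (\<forall>x. act M \<one>\<^bsub>R\<^esub> x = x)}"

section \<open>Terms and formulas\<close>

text \<open>
  Formulas are formulas in a context: a formula \<open>\<phi>\<close> considered with \<open>lh x = n\<close> has its free variables
  among \<open>Var i\<close>, \<open>i < n\<close>, and in context \<open>n\<close> the quantifiers \<open>Ex \<zeta> \<phi>\<close> and \<open>All \<zeta> \<phi>\<close> bind the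
  variables \<open>Var i\<close> with \<open>n \<le> i < n + \<zeta>\<close> of the formula \<open>\<phi>\<close> in context \<open>n + \<zeta>\<close>.  As contexts are
  elements of \<open>'o\<close>, all formulas have fewer than \<open>\<theta>\<close> free variables.

  Conjunctions and disjunctions are over families indexed by arbitrary subsets of a type \<open>'i\<close>.  A
  theorem that is polymorphic in \<open>'i\<close> speaks about conjunctions of arbitrary sets of formulas.
\<close>

datatype ('f, 'o) trm =
    Var 'o
  | Zero
  | Plus "('f, 'o) trm" "('f, 'o) trm"
  | Minus "('f, 'o) trm" "('f, 'o) trm"
  | Fun 'f "'o \<Rightarrow> ('f, 'o) trm"

datatype ('f, 'p, 'o, 'i) fm =
    Eq "('f, 'o) trm" "('f, 'o) trm"
  | Rel 'p "'o \<Rightarrow> ('f, 'o) trm"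
  | Neg "('f, 'p, 'o, 'i) fm"
  | Conj "'i set" "'i \<Rightarrow> ('f, 'p, 'o, 'i) fm"
  | Disj "'i set" "'i \<Rightarrow> ('f, 'p, 'o, 'i) fm"
  | Ex 'o "('f, 'p, 'o, 'i) fm"
  | All 'o "('f, 'p, 'o, 'i) fm"

primrec wf_trm :: "('f, 'p, 'o::wellorder) vocab \<Rightarrow> 'o \<Rightarrow> ('f, 'o) trm \<Rightarrow> bool" where
  "wf_trm \<tau> n (Var i) \<longleftrightarrow> i < n"
| "wf_trm \<tau> n Zero \<longleftrightarrow> True"
| "wf_trm \<tau> n (Plus s t) \<longleftrightarrow> wf_trm \<tau> n s \<and> wf_trm \<tau> n t"
| "wf_trm \<tau> n (Minus s t) \<longleftrightarrow> wf_trm \<tau> n s \<and> wf_trm \<tau> n t"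
| "wf_trm \<tau> n (Fun f ts) \<longleftrightarrow>
     f \<in> Funs \<tau> \<and> ts \<in> extensional {..<farity \<tau> f} \<and> (\<forall>i<farity \<tau> f. wf_trm \<tau> n (ts i))"

primrec wf_fm :: "('f, 'p, 'o::wellorder) vocab \<Rightarrow> ('f, 'p, 'o, 'i) fm \<Rightarrow> 'o \<Rightarrow> bool" where
  "wf_fm \<tau> (Eq s t) n \<longleftrightarrow> wf_trm \<tau> n s \<and> wf_trm \<tau> n t"
| "wf_fm \<tau> (Rel P ts) n \<longleftrightarrow>
     P \<in> Rels \<tau> \<and> ts \<in> extensional {..<rarity \<tau> P} \<and> (\<forall>i<rarity \<tau> P. wf_trm \<tau> n (ts i))"
| "wf_fm \<tau> (Neg \<phi>) n \<longleftrightarrow> wf_fm \<tau> \<phi> n"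
| "wf_fm \<tau> (Conj I \<Phi>) n \<longleftrightarrow> (\<forall>i\<in>I. wf_fm \<tau> (\<Phi> i) n)"
| "wf_fm \<tau> (Disj I \<Phi>) n \<longleftrightarrow> (\<forall>i\<in>I. wf_fm \<tau> (\<Phi> i) n)"
| "wf_fm \<tau> (Ex \<zeta> \<phi>) n \<longleftrightarrow> wf_fm \<tau> \<phi> (oadd n \<zeta>)"
| "wf_fm \<tau> (All \<zeta> \<phi>) n \<longleftrightarrow> wf_fm \<tau> \<phi> (oadd n \<zeta>)"

text \<open>\<open>eval \<tau> M a t = None\<close> means that \<open>t\<close> is undefined; an atomic formula with an undefined term is false.\<close>

primrec eval ::
  "('f, 'p, 'o::wellorder) vocab \<Rightarrow> ('f, 'p, 'o, 'm::ab_group_add) struct \<Rightarrow> ('o \<Rightarrow> 'm) \<Rightarrow>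
   ('f, 'o) trm \<Rightarrow> 'm option" where
  "eval \<tau> M a (Var i) = Some (a i)"
| "eval \<tau> M a Zero = Some 0"
| "eval \<tau> M a (Plus s t) =
     (case (eval \<tau> M a s, eval \<tau> M a t) of (Some x, Some y) \<Rightarrow> Some (x + y) | _ \<Rightarrow> None)"
| "eval \<tau> M a (Minus s t) =
     (case (eval \<tau> M a s, eval \<tau> M a t) of (Some x, Some y) \<Rightarrow> Some (x - y) | _ \<Rightarrow> None)"
| "eval \<tau> M a (Fun f ts) =
     (if \<forall>i<farity \<tau> f. eval \<tau> M a (ts i) \<noteq> None
      then fint M f (\<lambda>i\<in>{..<farity \<tau> f}. the (eval \<tau> M a (ts i)))
      else None)"

primrec sat ::
  "('f, 'p, 'o::wellorder) vocab \<Rightarrow> ('f, 'p, 'o, 'm::ab_group_add) struct \<Rightarrow>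
   ('f, 'p, 'o, 'i) fm \<Rightarrow> 'o \<Rightarrow> ('o \<Rightarrow> 'm) \<Rightarrow> bool" where
  "sat \<tau> M (Eq s t) n a \<longleftrightarrow> (\<exists>v. eval \<tau> M a s = Some v \<and> eval \<tau> M a t = Some v)"
| "sat \<tau> M (Rel P ts) n a \<longleftrightarrow>
     (\<forall>i<rarity \<tau> P. eval \<tau> M a (ts i) \<noteq> None) \<and>
     (\<lambda>i\<in>{..<rarity \<tau> P}. the (eval \<tau> M a (ts i))) \<in> rint M P"
| "sat \<tau> M (Neg \<phi>) n a \<longleftrightarrow> \<not> sat \<tau> M \<phi> n a"
| "sat \<tau> M (Conj I \<Phi>) n a \<longleftrightarrow> (\<forall>i\<in>I. sat \<tau> M (\<Phi> i) n a)"
| "sat \<tau> M (Disj I \<Phi>) n a \<longleftrightarrow> (\<exists>i\<in>I. sat \<tau> M (\<Phi> i) n a)"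
| "sat \<tau> M (Ex \<zeta> \<phi>) n a \<longleftrightarrow> (\<exists>b\<in>seqs \<zeta> UNIV. sat \<tau> M \<phi> (oadd n \<zeta>) (cat n a \<zeta> b))"
| "sat \<tau> M (All \<zeta> \<phi>) n a \<longleftrightarrow> (\<forall>b\<in>seqs \<zeta> UNIV. sat \<tau> M \<phi> (oadd n \<zeta>) (cat n a \<zeta> b))"

text \<open>
  \<open>qd_le \<phi> \<beta>\<close>: the quantifier depth of \<open>\<phi>\<close> is at most \<open>\<beta>\<close>, where the depth of \<open>\<exists>y \<phi>\<close> is the depth
  of \<open>\<phi>\<close> plus 1 and the depth of a conjunction is the supremum of the depths of its members.
\<close>
primrec qd_le :: "('f, 'p, 'o, 'i) fm \<Rightarrow> 'g::wellorder \<Rightarrow> bool" where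
  "qd_le (Eq s t) \<beta> \<longleftrightarrow> True"
| "qd_le (Rel P ts) \<beta> \<longleftrightarrow> True"
| "qd_le (Neg \<phi>) \<beta> \<longleftrightarrow> qd_le \<phi> \<beta>"
| "qd_le (Conj I \<Phi>) \<beta> \<longleftrightarrow> (\<forall>i\<in>I. qd_le (\<Phi> i) \<beta>)"
| "qd_le (Disj I \<Phi>) \<beta> \<longleftrightarrow> (\<forall>i\<in>I. qd_le (\<Phi> i) \<beta>)"
| "qd_le (Ex \<zeta> \<phi>) \<beta> \<longleftrightarrow> (\<exists>\<beta>'<\<beta>. qd_le \<phi> \<beta>')"
| "qd_le (All \<zeta> \<phi>) \<beta> \<longleftrightarrow> (\<exists>\<beta>'<\<beta>. qd_le \<phi> \<beta>')"

text \<open>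
  The formulas of quantifier depth \<open>< 1 + \<alpha>\<close> in context \<open>n\<close>.  The ordinals below \<open>1 + \<alpha>\<close> are \<open>0\<close> and
  the ordinals \<open>1 + \<delta>\<close> for \<open>\<delta> < \<alpha>\<close>.
\<close>
definition L_inf ::
  "('f, 'p, 'o::wellorder) vocab \<Rightarrow> 'g::wellorder \<Rightarrow> 'o \<Rightarrow> ('f, 'p, 'o, 'i) fm set" where
  "L_inf \<tau> \<alpha> n = {\<phi>. wf_fm \<tau> \<phi> n \<and> (qd_le \<phi> (ozero :: 'g) \<or> (\<exists>\<delta><\<alpha>. qd_le \<phi> (oadd oone \<delta>)))}"

inductive_set bool_comb :: "('f, 'p, 'o, 'i) fm set \<Rightarrow> ('f, 'p, 'o, 'i) fm set"
  for S :: "('f, 'p, 'o, 'i) fm set" where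
  base: "\<phi> \<in> S \<Longrightarrow> \<phi> \<in> bool_comb S"
| neg: "\<phi> \<in> bool_comb S \<Longrightarrow> Neg \<phi> \<in> bool_comb S"
| conj: "(\<And>i. i \<in> I \<Longrightarrow> \<Phi> i \<in> bool_comb S) \<Longrightarrow> Conj I \<Phi> \<in> bool_comb S"
| disj: "(\<And>i. i \<in> I \<Longrightarrow> \<Phi> i \<in> bool_comb S) \<Longrightarrow> Disj I \<Phi> \<in> bool_comb S"

section \<open>Positive existential formulas\<close>

definition atomic_fms ::
  "('f, 'p, 'o::wellorder) vocab \<Rightarrow> 'o \<Rightarrow> ('f, 'p, 'o, 'i) fm set" where
  "atomic_fms \<tau> \<epsilon> = {Eq s t | s t. wf_fm \<tau> (Eq s t :: ('f, 'p, 'o, 'i) fm) \<epsilon>}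
                 \<union> {Rel P ts | P ts. wf_fm \<tau> (Rel P ts :: ('f, 'p, 'o, 'i) fm) \<epsilon>}"

text \<open>The term \<open>\<Sum>\<zeta><\<epsilon>. a\<^sub>\<zeta> x\<^sub>\<zeta>\<close>, the summation being over the finite set of \<open>\<zeta>\<close> with \<open>a\<^sub>\<zeta> \<noteq> 0\<close>.\<close>

definition lin_trm ::
  "('f, 'b) ring_scheme \<Rightarrow> 'o::wellorder \<Rightarrow> ('o \<Rightarrow> 'f) \<Rightarrow> ('f, 'o) trm" where
  "lin_trm R \<epsilon> a = foldr (\<lambda>\<zeta> t. Plus (Fun (a \<zeta>) (singl (Var \<zeta>))) t)
     (sorted_list_of_set {\<zeta>. \<zeta> < \<epsilon> \<and> a \<zeta> \<noteq> \<zero>\<^bsub>R\<^esub>}) Zero"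

definition linear_fms ::
  "('f, 'b) ring_scheme \<Rightarrow> 'o::wellorder \<Rightarrow> ('f, 'p, 'o, 'i) fm set" where
  "linear_fms R \<epsilon> = {Eq (lin_trm R \<epsilon> a) Zero | a.
     a \<in> seqs \<epsilon> (carrier R) \<and> finite {\<zeta>. \<zeta> < \<epsilon> \<and> a \<zeta> \<noteq> \<zero>\<^bsub>R\<^esub>}}"

text \<open>
  \<open>\<phi> \<in> Lam_pe B \<alpha> \<epsilon>\<close> is \<open>\<phi> \<in> \<Lambda>\<^sup>p\<^sup>e\<^sub>\<alpha>\<^sub>,\<^sub>\<epsilon>\<close>, where \<open>B \<epsilon>\<close> is \<open>\<Lambda>\<^sup>p\<^sup>e\<^sub>0\<^sub>,\<^sub>\<epsilon>\<close>: linear equations for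
  modules, atomic formulas for \<open>\<theta>\<close>-additive structures.
\<close>
inductive pe ::
  "('o::wellorder \<Rightarrow> ('f, 'p, 'o, 'i) fm set) \<Rightarrow> 'g::wellorder \<Rightarrow> 'o \<Rightarrow> ('f, 'p, 'o, 'i) fm \<Rightarrow> bool"
  for B :: "'o::wellorder \<Rightarrow> ('f, 'p, 'o, 'i) fm set" where
  pe_zero: "\<phi> \<in> B \<epsilon> \<Longrightarrow> pe B ozero \<epsilon> \<phi>"
| pe_limit: "is_limit \<alpha> \<Longrightarrow> \<beta> < \<alpha> \<Longrightarrow> pe B \<beta> \<epsilon> \<phi> \<Longrightarrow> pe B \<alpha> \<epsilon> \<phi>"
| pe_suc: "suc_of \<beta> \<alpha> \<Longrightarrow> pe B \<beta> \<epsilon> \<phi> \<Longrightarrow> pe B \<alpha> \<epsilon> \<phi>"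
| pe_suc_ex: "suc_of \<beta> \<alpha> \<Longrightarrow> (\<And>i. i \<in> I \<Longrightarrow> pe B \<beta> (oadd \<epsilon> \<zeta>) (\<Phi> i)) \<Longrightarrow>
     pe B \<alpha> \<epsilon> (Ex \<zeta> (Conj I \<Phi>))"

definition Lam_pe ::
  "('o::wellorder \<Rightarrow> ('f, 'p, 'o, 'i) fm set) \<Rightarrow> 'g::wellorder \<Rightarrow> 'o \<Rightarrow> ('f, 'p, 'o, 'i) fm set" where
  "Lam_pe B \<alpha> \<epsilon> = {\<phi>. pe B \<alpha> \<epsilon> \<phi>}"

text \<open>The union over \<open>\<epsilon>\<close>; a formula \<open>\<phi>(x)\<close> carries the length of \<open>x\<close>.\<close>

definition Lam_pe_all ::
  "('o::wellorder \<Rightarrow> ('f, 'p, 'o, 'i) fm set) \<Rightarrow> 'g::wellorder \<Rightarrow> ('o \<times> ('f, 'p, 'o, 'i) fm) set" where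
  "Lam_pe_all B \<alpha> = (SIGMA \<epsilon>:UNIV. Lam_pe B \<alpha> \<epsilon>)"

section \<open>Types\<close>

text \<open>The formal formula \<open>\<phi>(x\<^sup>\<frown>b - c)\<close> with \<open>lh b = \<xi>\<close> is the tuple \<open>(\<xi>, \<phi>, b, c)\<close>.\<close>

type_synonym ('f, 'p, 'o, 'i, 'm) formal =
  "'o \<times> ('f, 'p, 'o, 'i) fm \<times> ('o \<Rightarrow> 'm) \<times> ('o \<Rightarrow> 'm)"

fun sat_formal ::
  "('f, 'p, 'o::wellorder) vocab \<Rightarrow> ('f, 'p, 'o, 'm::ab_group_add) struct \<Rightarrow> 'o \<Rightarrow> ('o \<Rightarrow> 'm) \<Rightarrow>
   ('f, 'p, 'o, 'i, 'm) formal \<Rightarrow> bool" where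
  "sat_formal \<tau> M \<epsilon> a (\<xi>, \<phi>, b, c) \<longleftrightarrow>
     sat \<tau> M \<phi> (oadd \<epsilon> \<xi>) (seq_diff (oadd \<epsilon> \<xi>) (cat \<epsilon> a \<xi> b) c)"

definition tp ::
  "('f, 'p, 'o::wellorder) vocab \<Rightarrow> ('o \<Rightarrow> ('f, 'p, 'o, 'i) fm set) \<Rightarrow> 'g::wellorder \<Rightarrow>
   ('o \<times> ('f, 'p, 'o, 'i) fm) set \<Rightarrow> 'o \<Rightarrow> ('o \<Rightarrow> 'm::ab_group_add) \<Rightarrow> 'm set \<Rightarrow>
   ('f, 'p, 'o, 'm) struct \<Rightarrow> ('f, 'p, 'o, 'i, 'm) formal set" where
  "tp \<tau> B \<gamma> \<Lambda> \<epsilon> a A M = {(\<xi>, \<phi>, b, c).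
     \<phi> \<in> Lam_pe B \<gamma> (oadd \<epsilon> \<xi>) \<and> (oadd \<epsilon> \<xi>, \<phi>) \<in> \<Lambda> \<and>
     b \<in> seqs \<xi> A \<and> c \<in> seqs (oadd \<epsilon> \<xi>) A \<and> sat_formal \<tau> M \<epsilon> a (\<xi>, \<phi>, b, c)}"

definition Stp ::
  "('f, 'p, 'o::wellorder) vocab \<Rightarrow> ('o \<Rightarrow> ('f, 'p, 'o, 'i) fm set) \<Rightarrow> 'g::wellorder \<Rightarrow>
   ('o \<times> ('f, 'p, 'o, 'i) fm) set \<Rightarrow> 'o \<Rightarrow> 'm set \<Rightarrow>
   ('f, 'p, 'o, 'm::ab_group_add) struct \<Rightarrow> ('f, 'p, 'o, 'i, 'm) formal set set" where
  "Stp \<tau> B \<gamma> \<Lambda> \<epsilon> A M = {tp \<tau> B \<gamma> \<Lambda> \<epsilon> a A M | a. a \<in> seqs \<epsilon> UNIV}"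

text \<open>\<open>p \<restriction> {\<plusminus>\<phi>}\<close> as a set of signed formal formulas; \<open>(False, \<psi>)\<close> stands for \<open>\<not>\<psi>\<close>.\<close>

definition restr_pm ::
  "('f, 'p, 'o::wellorder, 'i, 'm) formal set \<Rightarrow> 'o \<Rightarrow> 'm set \<Rightarrow> 'o \<Rightarrow> ('f, 'p, 'o, 'i) fm \<Rightarrow>
   (bool \<times> ('f, 'p, 'o, 'i, 'm) formal) set" where
  "restr_pm p \<epsilon> A \<xi> \<phi> =
     {((\<xi>, \<phi>, b, c) \<in> p, (\<xi>, \<phi>, b, c)) | b c. b \<in> seqs \<xi> A \<and> c \<in> seqs (oadd \<epsilon> \<xi>) A}"

definition entails ::
  "('f, 'p, 'o::wellorder) vocab \<Rightarrow> ('f, 'p, 'o, 'm::ab_group_add) struct \<Rightarrow> 'o \<Rightarrow>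
   ('f, 'p, 'o, 'i, 'm) formal \<Rightarrow> (bool \<times> ('f, 'p, 'o, 'i, 'm) formal) set \<Rightarrow> bool" where
  "entails \<tau> M \<epsilon> \<psi> \<Gamma> \<longleftrightarrow>
     (\<forall>a\<in>seqs \<epsilon> UNIV. sat_formal \<tau> M \<epsilon> a \<psi> \<longrightarrow> (\<forall>(s, \<chi>)\<in>\<Gamma>. sat_formal \<tau> M \<epsilon> a \<chi> = s))"

section \<open>Order property and beth numbers\<close>

text \<open>The ordinals below a cardinal \<open>\<kappa>\<close> are the elements of \<^term>\<open>Field \<kappa>\<close>.\<close>

definition ordered_by ::
  "('f, 'p, 'o::wellorder) vocab \<Rightarrow> ('f, 'p, 'o, 'm::ab_group_add) struct \<Rightarrow>
   ('f, 'p, 'o, 'i) fm \<Rightarrow> 'o \<Rightarrow> 'o \<Rightarrow> 'k rel \<Rightarrow> ('k \<Rightarrow> 'o \<Rightarrow> 'm) \<Rightarrow> ('k \<Rightarrow> 'o \<Rightarrow> 'm) \<Rightarrow> bool" where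
  "ordered_by \<tau> M \<phi> \<epsilon> \<zeta> \<kappa> a b \<longleftrightarrow>
     (\<forall>\<alpha>\<in>Field \<kappa>. a \<alpha> \<in> seqs \<epsilon> UNIV \<and> b \<alpha> \<in> seqs \<zeta> UNIV) \<and>
     (\<forall>\<alpha> \<beta>. (\<alpha>, \<beta>) \<in> \<kappa> \<and> \<alpha> \<noteq> \<beta> \<longrightarrow>
        sat \<tau> M \<phi> (oadd \<epsilon> \<zeta>) (cat \<epsilon> (a \<alpha>) \<zeta> (b \<beta>)) \<and>
        \<not> sat \<tau> M \<phi> (oadd \<epsilon> \<zeta>) (cat \<epsilon> (a \<beta>) \<zeta> (b \<alpha>)))"

text \<open>
  \<open>is_beth \<mu> \<gamma> b\<close>: for all \<open>\<alpha> \<le> \<gamma>\<close>, the cardinal \<open>b \<alpha>\<close> is \<open>\<beth>\<^sub>\<alpha>(\<mu>)\<close>.  Since no fixed HOL type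
  contains all these cardinals, they are taken on a given type \<open>'k\<close>; if some cardinal
  \<open>\<kappa> :: 'k rel\<close> is at least \<open>\<beth>\<^sub>\<gamma>(\<mu>)\<close>, such a \<open>b\<close> exists, and it is unique up to \<open>=o\<close>.
\<close>
definition is_beth :: "'c rel \<Rightarrow> 'g::wellorder \<Rightarrow> ('g \<Rightarrow> 'k rel) \<Rightarrow> bool" where
  "is_beth \<mu> \<gamma> b \<longleftrightarrow> (\<forall>\<alpha>\<le>\<gamma>. Card_order (b \<alpha>)) \<and> b ozero =o \<mu> \<and>
     (\<forall>\<alpha>\<le>\<gamma>. \<forall>\<beta>. suc_of \<beta> \<alpha> \<longrightarrow> b \<alpha> =o ctwo ^c b \<beta>) \<and>
     (\<forall>\<alpha>\<le>\<gamma>. is_limit \<alpha> \<longrightarrow>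
        (\<forall>\<beta><\<alpha>. b \<beta> \<le>o b \<alpha>) \<and>
        (\<forall>r::'k rel. Card_order r \<and> (\<forall>\<beta><\<alpha>. b \<beta> \<le>o r) \<longrightarrow> b \<alpha> \<le>o r))"

end

theory Submission
  imports Defs "HOL-Library.Function_Algebras"
begin

text \<open>
  Every formula \<open>\<phi> \<in> \<Lambda>\<^sup>p\<^sup>e\<close> defines a subgroup of a power of \<open>M\<close>, which gives (1), (2) and (4): the trace of
  \<open>\<phi>\<close> on a type is a coset, and \<open>a\<^sub>2b\<^sub>1 = a\<^sub>2b\<^sub>3 - a\<^sub>0b\<^sub>3 + a\<^sub>0b\<^sub>1\<close> rules out an order of length 4.

  For (3) no quantifier elimination is available: elements with the same \<open>\<Lambda>\<^sup>p\<^sup>e\<close>-type may differ in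
  their \<open>L\<^sub>\<infinity>\<^sub>,\<^sub>\<theta>\<close>-type.  Instead of elements one compares filters that are complete for
  \<open>\<chi> = 2\<^sup>\<mu>\<close> many sets, \<open>\<mu> = \<beth>\<^sub>\<gamma>\<close>, and that decide all cosets of the at most \<open>\<mu>\<close> many subgroups
  of each power that are invariant under back-and-forth equivalence of some rank below \<open>\<gamma>\<close>.  If two
  such filters agree on these cosets, then an extension of the points of one filter by further coordinates can be copied to the
  other filter with agreement at the lower ranks; hence the filters agree on all sets invariant
  under back-and-forth equivalence.  A sequence of length \<open>\<chi>\<^sup>+\<close> yields a filter \<open>F\<close> on its index set,
  and the distributions of \<open>(a\<^sub>\<alpha>, b\<^sub>\<beta>)\<close> and \<open>(a\<^sub>\<beta>, b\<^sub>\<alpha>)\<close> for \<open>F\<close>-almost all \<open>\<alpha>\<close> and then \<open>F\<close>-almost all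
  \<open>\<beta>\<close> agree on all cosets, because \<open>(a\<^sub>\<alpha>, b\<^sub>\<beta>) = (a\<^sub>\<alpha>, 0) + (0, b\<^sub>\<beta>)\<close>.
\<close>

section \<open>Complete filters\<close>

text \<open>A nonprincipal ultrafilter complete for \<chi> many sets would decide every coset, but
  its existence would require a large cardinal. Only \<mu> many groups matter, and each group
  partitions the points into cosets. A filter can be refined so as to decide \<mu> many partitions
  and stay complete, because \<chi> = 2^\<mu> satisfies \<chi>^\<mu> = \<chi> and \<mu>^+ \<le>
  \<chi>. Deciding must admit the outcome that every coset is avoided, since a group of index above
  \<chi> may have no coset that carries the filter. A single point always lies in some coset and
  cannot represent this outcome.

  The bound \<mu> on the number of groups comes from \<gamma> being a limit: a rank costs one
  exponential for its classes and one more for unions of classes, and finitely many exponentials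
  above a rank below \<gamma> stay within beth_\<gamma>. The classes of rank \<gamma> itself are
  bounded only by \<chi>, which still suffices for the pigeonhole principle. This yields the bound
  with beth_{\<gamma>+1}; the one with beth_{\<gamma>+2} follows by monotonicity.\<close>

definition complete_filter :: "'c rel \<Rightarrow> 'a filter \<Rightarrow> bool" where
  "complete_filter \<chi> F \<longleftrightarrow> F \<noteq> bot \<and>
     (\<forall>\<P>. |\<P>| \<le>o \<chi> \<longrightarrow> (\<forall>P\<in>\<P>. eventually P F) \<longrightarrow> eventually (\<lambda>x. \<forall>P\<in>\<P>. P x) F)"

lemma complete_filter_proper: "complete_filter \<chi> F \<Longrightarrow> \<not> eventually (\<lambda>x. False) F"
  by (simp add: complete_filter_def trivial_limit_def)

lemma complete_filter_ex: "complete_filter \<chi> F \<Longrightarrow> eventually P F \<Longrightarrow> \<exists>x. P x"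
  using eventually_happens unfolding complete_filter_def by blast

lemma complete_filter_ball:
  assumes "complete_filter \<chi> F" "|I| \<le>o \<chi>" "\<And>i. i \<in> I \<Longrightarrow> eventually (P i) F"
  shows "eventually (\<lambda>x. \<forall>i\<in>I. P i x) F"
proof -
  have "|P ` I| \<le>o \<chi>"
    by (rule ordLeq_transitive[OF card_of_image assms(2)])
  then have "eventually (\<lambda>x. \<forall>Q\<in>P ` I. Q x) F"
    using assms(1,3) unfolding complete_filter_def by blast
  then show ?thesis by simp
qed

lemma complete_filterI:
  assumes "\<not> eventually (\<lambda>x. False) F"
    and "\<And>\<P>. |\<P>| \<le>o \<chi> \<Longrightarrow> (\<And>P. P \<in> \<P> \<Longrightarrow> eventually P F) \<Longrightarrow> eventually (\<lambda>x. \<forall>P\<in>\<P>. P x) F"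
  shows "complete_filter \<chi> F"
  using assms by (auto simp: complete_filter_def trivial_limit_def)

lemma complete_filter_filtermap:
  assumes "complete_filter \<chi> F"
  shows "complete_filter \<chi> (filtermap h F)"
proof (rule complete_filterI)
  show "\<not> eventually (\<lambda>x. False) (filtermap h F)"
    using complete_filter_proper[OF assms] by (simp add: eventually_filtermap)
next
  fix \<P>
  assume "|\<P>| \<le>o \<chi>" "\<And>P. P \<in> \<P> \<Longrightarrow> eventually P (filtermap h F)"
  then show "eventually (\<lambda>x. \<forall>P\<in>\<P>. P x) (filtermap h F)"
    unfolding eventually_filtermap by (intro complete_filter_ball[OF assms])
qed

lemma complete_filter_restrict:
  assumes "complete_filter \<chi> F" "\<not> eventually (\<lambda>x. x \<notin> S) F"
  shows "complete_filter \<chi> (inf F (principal S))"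
proof (rule complete_filterI)
  show "\<not> eventually (\<lambda>x. False) (inf F (principal S))"
    using assms(2) by (simp add: eventually_inf_principal)
next
  fix \<P>
  assume "|\<P>| \<le>o \<chi>" "\<And>P. P \<in> \<P> \<Longrightarrow> eventually P (inf F (principal S))"
  then have "eventually (\<lambda>x. \<forall>P\<in>\<P>. x \<in> S \<longrightarrow> P x) F"
    unfolding eventually_inf_principal by (intro complete_filter_ball[OF assms(1)])
  then show "eventually (\<lambda>x. \<forall>P\<in>\<P>. P x) (inf F (principal S))"
    unfolding eventually_inf_principal by (rule eventually_mono) auto
qed

text \<open>The union of \<chi> many null sets is null, so not all of \<chi> many fibres can be
  null.\<close>

lemma complete_filter_pigeonhole:
  assumes "complete_filter \<chi> F" "|C| \<le>o \<chi>" "eventually (\<lambda>x. f x \<in> C) F"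
  obtains c where "c \<in> C" "\<not> eventually (\<lambda>x. f x \<noteq> c) F"
proof -
  have "\<exists>c\<in>C. \<not> eventually (\<lambda>x. f x \<noteq> c) F"
  proof (rule ccontr)
    assume "\<not> ?thesis"
    then have "eventually (\<lambda>x. \<forall>c\<in>C. f x \<noteq> c) F"
      by (intro complete_filter_ball[OF assms(1,2)]) auto
    with assms(3) have "eventually (\<lambda>x. False) F"
      by eventually_elim auto
    with complete_filter_proper[OF assms(1)] show False ..
  qed
  with that show ?thesis by blast
qed

text \<open>The image under \<open>h\<close> of the Fubini product of \<open>F\<close> and
  \<open>G\<close>. The product is not symmetric: the point of \<open>F\<close> is fixed before that
  of \<open>G\<close>.\<close>

definition filter_bind :: "('a \<Rightarrow> 'b \<Rightarrow> 'c) \<Rightarrow> 'a filter \<Rightarrow> 'b filter \<Rightarrow> 'c filter" where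
  "filter_bind h F G = Abs_filter (\<lambda>P. eventually (\<lambda>x. eventually (\<lambda>y. P (h x y)) G) F)"

lemma eventually_filter_bind:
  "eventually P (filter_bind h F G) \<longleftrightarrow> eventually (\<lambda>x. eventually (\<lambda>y. P (h x y)) G) F"
  unfolding filter_bind_def
proof (rule eventually_Abs_filter, rule is_filter.intro)
  show "\<forall>\<^sub>F x in F. \<forall>\<^sub>F y in G. True" by simp
next
  fix P Q assume "\<forall>\<^sub>F x in F. \<forall>\<^sub>F y in G. P (h x y)" "\<forall>\<^sub>F x in F. \<forall>\<^sub>F y in G. Q (h x y)"
  then show "\<forall>\<^sub>F x in F. \<forall>\<^sub>F y in G. P (h x y) \<and> Q (h x y)"
    by eventually_elim (simp add: eventually_conj_iff)
next
  fix P Q assume "\<forall>x. P x \<longrightarrow> Q x" "\<forall>\<^sub>F x in F. \<forall>\<^sub>F y in G. P (h x y)"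
  then show "\<forall>\<^sub>F x in F. \<forall>\<^sub>F y in G. Q (h x y)"
    by (auto elim!: eventually_mono)
qed

lemma complete_filter_bind:
  assumes "complete_filter \<chi> F" "complete_filter \<chi> G"
  shows "complete_filter \<chi> (filter_bind h F G)"
proof (rule complete_filterI)
  show "\<not> eventually (\<lambda>x. False) (filter_bind h F G)"
    using complete_filter_proper[OF assms(1)] complete_filter_proper[OF assms(2)]
    by (simp add: eventually_filter_bind)
next
  fix \<P>
  assume P: "|\<P>| \<le>o \<chi>" "\<And>P. P \<in> \<P> \<Longrightarrow> eventually P (filter_bind h F G)"
  then have "eventually (\<lambda>x. \<forall>P\<in>\<P>. eventually (\<lambda>y. P (h x y)) G) F"
    unfolding eventually_filter_bind by (intro complete_filter_ball[OF assms(1)])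
  then show "eventually (\<lambda>x. \<forall>P\<in>\<P>. P x) (filter_bind h F G)"
    unfolding eventually_filter_bind
    by (rule eventually_mono) (intro complete_filter_ball[OF assms(2) P(1)], auto)
qed

section \<open>Cardinal bounds for function spaces and sets closed under an operation on small
  subsets\<close>

lemma card_of_Func_le_cexp:
  assumes "|A| \<le>o \<chi>" "|I| \<le>o \<mu>" "I \<noteq> {}"
  shows "|Func I A| \<le>o \<chi> ^c \<mu>"
proof -
  have "|A| ^c |I| \<le>o \<chi> ^c \<mu>"
    by (rule cexp_mono'[OF assms(1,2)]) (simp add: assms(3) Field_card_of)
  then show ?thesis by (simp add: cexp_def Field_card_of)
qed

lemma card_of_singleton_le_Cinfinite: "Cinfinite \<chi> \<Longrightarrow> |{x}| \<le>o \<chi>"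
  by (intro Card_order_singl_ordLeq) (auto simp: cinfinite_def)

lemma card_of_Func_le:
  assumes "|A| \<le>o \<chi>" "|I| \<le>o \<mu>" "Cinfinite \<chi>" "\<chi> ^c \<mu> \<le>o \<chi>"
  shows "|Func I A| \<le>o \<chi>"
proof (cases "I = {}")
  case True
  then show ?thesis using card_of_singleton_le_Cinfinite[OF assms(3)] by (simp add: Func_empty)
next
  case False
  then show ?thesis using ordLeq_transitive[OF card_of_Func_le_cexp[OF assms(1,2)] assms(4)] by simp
qed

text \<open>A nonempty small subset is the range of a function on \<open>Field \<mu>\<close>, and
  there are at most \<chi>^\<mu> \<le> \<chi> of these; the empty set is added by hand.\<close>

lemma card_of_small_subsets:
  fixes V :: "'a set"
  assumes inf: "Cinfinite \<mu>" "Cinfinite \<chi>" and exp: "\<chi> ^c \<mu> \<le>o \<chi>" and V: "|V| \<le>o \<chi>"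
  shows "|{a. a \<subseteq> V \<and> |a| \<le>o \<mu>}| \<le>o \<chi>"
proof -
  let ?D = "{a. a \<subseteq> V \<and> |a| \<le>o \<mu>}"
  have "?D \<subseteq> insert {} ((\<lambda>f. f ` Field \<mu>) ` Func (Field \<mu>) V)"
  proof
    fix a assume a: "a \<in> ?D"
    show "a \<in> insert {} ((\<lambda>f. f ` Field \<mu>) ` Func (Field \<mu>) V)"
    proof (cases "a = {}")
      case False
      have "|a| \<le>o |Field \<mu>|"
        using a inf(1) card_of_mono2[of "|a|" \<mu>] by (simp add: Field_card_of)
      then obtain f where f: "f ` Field \<mu> = a"
        using False card_of_ordLeq2 by metis
      let ?f = "\<lambda>x. if x \<in> Field \<mu> then f x else undefined"
      have "?f \<in> Func (Field \<mu>) V" "?f ` Field \<mu> = a"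
        using f a by (auto simp: Func_def)
      then show ?thesis by blast
    qed simp
  qed
  moreover have "|insert {} ((\<lambda>f. f ` Field \<mu>) ` Func (Field \<mu>) V)| \<le>o \<chi>"
  proof -
    have "|Func (Field \<mu>) V| \<le>o \<chi>"
      by (intro card_of_Func_le[OF V _ inf(2) exp] ordIso_imp_ordLeq card_of_Field_ordIso)
        (simp add: inf(1))
    then have "|(\<lambda>f. f ` Field \<mu>) ` Func (Field \<mu>) V| \<le>o \<chi>"
      by (rule ordLeq_transitive[OF card_of_image])
    moreover have "|{{}::'a set}| \<le>o \<chi>"
      by (rule card_of_singleton_le_Cinfinite[OF inf(2)])
    ultimately show ?thesis
      by (subst insert_is_Un) (rule Un_Cinfinite_bound[OF _ _ inf(2)], assumption)
  qed
  ultimately show ?thesis by (rule ordLeq_transitive[OF card_of_mono1])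
qed

text \<open>The set is built in \<open>\<mu>\<^sup>+\<close> steps, so that each \<open>\<mu>\<close>-small subset appears at some step.\<close>

lemma small_closed_set:
  fixes R :: "'a set \<Rightarrow> 'a set"
  assumes inf: "Cinfinite \<mu>" "Cinfinite \<chi>" and exp: "\<chi> ^c \<mu> \<le>o \<chi>" and le: "cardSuc \<mu> \<le>o \<chi>"
    and R: "\<And>a. |a| \<le>o \<mu> \<Longrightarrow> |R a| \<le>o \<chi>"
  obtains V where "|V| \<le>o \<chi>" "\<And>a. a \<subseteq> V \<Longrightarrow> |a| \<le>o \<mu> \<Longrightarrow> R a \<subseteq> V"
proof -
  let ?s = "cardSuc \<mu>"
  have wo: "Well_order ?s" and co: "Card_order ?s" and infs: "\<not> finite (Field ?s)"
    using Cinfinite_cardSuc[OF inf(1)] cardSuc_Well_order[of \<mu>] inf(1) by (simp_all add: cinfinite_def)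
  define step where "step V = \<Union>(R ` {a. a \<subseteq> V \<and> |a| \<le>o \<mu>})" for V
  have step_mono: "step V \<subseteq> step W" if "V \<subseteq> W" for V W
    using that by (auto simp: step_def)
  \<comment> \<open>Each stage collects one \<open>step\<close> from every earlier stage, so a
    single clause serves successors and limits.\<close>
  define As where "As = wfrec (?s - Id) (\<lambda>f i. \<Union>j\<in>underS ?s i. step (f j))"
  have wf: "wf (?s - Id)" using wo by (simp add: well_order_on_def)
  have As: "As i = (\<Union>j\<in>underS ?s i. step (As j))" for i
  proof -
    have "As i = (\<Union>j\<in>underS ?s i. step (cut As (?s - Id) i j))"
      unfolding As_def by (subst wfrec[OF wf]) simp
    also have "\<dots> = (\<Union>j\<in>underS ?s i. step (As j))"
      by (intro SUP_cong) (auto simp: underS_def cut_apply)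
    finally show ?thesis .
  qed
  have small: "|As i| \<le>o \<chi>" for i
  proof (induction i rule: wf_induct_rule[OF wf])
    case (1 i)
    have "|underS ?s i| \<le>o \<chi>"
    proof (cases "i \<in> Field ?s")
      case True
      then show ?thesis
        by (rule ordLess_imp_ordLeq[OF ordLess_ordLeq_trans[OF card_of_underS[OF co] le]])
    next
      case False
      then have "underS ?s i = {}" by (auto simp: underS_def Field_def)
      then show ?thesis using inf(2) by (simp add: card_of_empty1)
    qed
    moreover have "|step (As j)| \<le>o \<chi>" if j: "j \<in> underS ?s i" for j
    proof -
      have V: "|As j| \<le>o \<chi>" using 1 j by (auto simp: underS_def)
      let ?D = "{a. a \<subseteq> As j \<and> |a| \<le>o \<mu>}"
      have "|?D| \<le>o \<chi>"
        by (rule card_of_small_subsets[OF inf exp V])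
      then have "|\<Union>a\<in>?D. R a| \<le>o \<chi>"
        using R by (intro UNION_Cinfinite_bound[OF _ _ inf(2)]) auto
      then show ?thesis by (simp add: step_def)
    qed
    ultimately have "|\<Union>j\<in>underS ?s i. step (As j)| \<le>o \<chi>"
      by (intro UNION_Cinfinite_bound[OF _ _ inf(2)]) auto
    then show ?case using As[of i] by simp
  qed
  have tr: "trans ?s" and anti: "antisym ?s"
    using wo by (auto simp: order_on_defs)
  have chain: "relChain ?s As"
    unfolding relChain_def
  proof (intro allI impI)
    fix i j assume ij: "(i, j) \<in> ?s"
    have "underS ?s i \<subseteq> underS ?s j"
      using ij tr anti by (auto simp: underS_def dest: transD antisymD)
    then show "As i \<subseteq> As j" using As[of i] As[of j] by blast
  qed
  define V where "V = (\<Union>i\<in>Field ?s. As i)"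
  show thesis
  proof (rule that[of V])
    have "|Field ?s| \<le>o \<chi>"
      by (rule ordIso_ordLeq_trans[OF card_of_Field_ordIso[OF co] le])
    then show "|V| \<le>o \<chi>" unfolding V_def
      using small by (intro UNION_Cinfinite_bound[OF _ _ inf(2)]) auto
  next
    fix a assume a: "a \<subseteq> V" "|a| \<le>o \<mu>"
    \<comment> \<open>Successor cardinals are regular, so the small set \<open>a\<close> lies in one
      stage \<open>i\<close>. Then \<open>R a\<close> is contained in every later stage, and one
      exists since \<open>cardSuc \<mu>\<close> has no last element.\<close>
    obtain i where i: "i \<in> Field ?s" "a \<subseteq> As i"
      using cardSuc_UNION[OF _ _ chain a(1)[unfolded V_def] a(2)] inf(1) by (auto simp: cinfinite_def)
    obtain j where j: "j \<in> Field ?s" "i \<noteq> j" "(i, j) \<in> ?s"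
      using infinite_Card_order_limit[OF co infs i(1)] by auto
    have "R a \<subseteq> step (As i)" using i a by (auto simp: step_def)
    also have "\<dots> \<subseteq> As j" using j As[of j] by (auto simp: underS_def)
    finally show "R a \<subseteq> V" using j(1) by (auto simp: V_def)
  qed
qed

section \<open>Refining a complete filter so that it decides a small family of partitions\<close>

text \<open>
  Were every small \<open>a\<close> coverable, a set \<open>V\<close> of labels containing with \<open>a\<close> also the labels covering
  \<open>a\<close> would contradict itself at the labels in \<open>V\<close> of a single generic point.
\<close>

lemma complete_filter_decide:
  fixes q :: "'p \<Rightarrow> 'a \<Rightarrow> 'b"
  assumes F: "complete_filter \<chi> F" and inf: "Cinfinite \<mu>" "Cinfinite \<chi>"
    and exp: "\<chi> ^c \<mu> \<le>o \<chi>" and le: "cardSuc \<mu> \<le>o \<chi>" and \<Psi>: "|\<Psi>| \<le>o \<mu>"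
  obtains F' where "F' \<le> F" "complete_filter \<chi> F'"
    "\<And>p. p \<in> \<Psi> \<Longrightarrow> (\<exists>c. eventually (\<lambda>x. q p x = c) F') \<or> (\<forall>c. eventually (\<lambda>x. q p x \<noteq> c) F')"
proof -
  define B where "B a = {x. \<forall>(p, c)\<in>a. q p x = c}" for a
  \<comment> \<open>A label \<open>(p, c)\<close> records \<open>q p x = c\<close>. Coverings of
    \<open>B a\<close> may use only labels at indices that \<open>a\<close> leaves open; this clause
    is what the contradiction below hits.\<close>
  define ok where "ok a R \<longleftrightarrow> |R| \<le>o \<chi> \<and> R \<subseteq> \<Psi> \<times> UNIV \<and> fst ` R \<inter> fst ` a = {}" for a R :: "('p \<times> 'b) set"
  define cov where "cov a R \<longleftrightarrow> ok a R \<and> eventually (\<lambda>x. x \<in> B a \<longrightarrow> (\<exists>(p, c)\<in>R. q p x = c)) F" for a R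
  have empty: "ok a {}" for a using inf(2) by (simp add: ok_def card_of_empty1)
  have "\<exists>a. a \<subseteq> \<Psi> \<times> UNIV \<and> |a| \<le>o \<mu> \<and> (\<forall>R. \<not> cov a R)"
  proof (rule ccontr)
    assume "\<not> ?thesis"
    then have thin: "\<exists>R. cov a R" if "a \<subseteq> \<Psi> \<times> UNIV" "|a| \<le>o \<mu>" for a using that by blast
    define R where "R a = (if \<exists>R. cov a R then SOME R. cov a R else {})" for a
    have R: "cov a (R a)" if "a \<subseteq> \<Psi> \<times> UNIV" "|a| \<le>o \<mu>" for a
      using thin[OF that] by (auto simp: R_def intro: someI)
    have "|R a| \<le>o \<chi>" for a
    proof (cases "\<exists>R. cov a R")
      case True
      then have "cov a (R a)" by (auto simp: R_def intro: someI)
      then show ?thesis by (simp add: cov_def ok_def)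
    next
      case False
      then have "R a = {}" by (simp add: R_def)
      then show ?thesis using inf(2) by (simp add: card_of_empty1)
    qed
    then obtain V where V: "|V| \<le>o \<chi>" "\<And>a. a \<subseteq> V \<Longrightarrow> |a| \<le>o \<mu> \<Longrightarrow> R a \<subseteq> V"
      using small_closed_set[OF inf exp le, of R] by metis
    \<comment> \<open>There are at most \<chi> such subsets, so completeness provides one point
      \<open>x\<close> that obeys all their covering conditions.\<close>
    let ?D = "{a. a \<subseteq> V \<inter> \<Psi> \<times> UNIV \<and> |a| \<le>o \<mu>}"
    have "|?D| \<le>o \<chi>"
      by (rule card_of_small_subsets[OF inf exp ordLeq_transitive[OF card_of_mono1 V(1)]]) blast
    then have "eventually (\<lambda>x. \<forall>a\<in>?D. x \<in> B a \<longrightarrow> (\<exists>(p, c)\<in>R a. q p x = c)) F"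
      by (rule complete_filter_ball[OF F]) (use R in \<open>auto simp: cov_def\<close>)
    from complete_filter_ex[OF F this]
    obtain x where x: "\<forall>a\<in>?D. x \<in> B a \<longrightarrow> (\<exists>(p, c)\<in>R a. q p x = c)" ..
    define a where "a = V \<inter> (\<lambda>p. (p, q p x)) ` \<Psi>"
    have "|a| \<le>o \<mu>" unfolding a_def
      by (rule ordLeq_transitive[OF card_of_mono1 ordLeq_transitive[OF card_of_image \<Psi>]]) blast
    then have a: "a \<in> ?D" "x \<in> B a" by (auto simp: a_def B_def)
    then obtain p c where pc: "(p, c) \<in> R a" "q p x = c" using x by blast
    \<comment> \<open>The covering label lies in \<open>V\<close> and is true at \<open>x\<close>,
      hence it belongs to \<open>a\<close>, although its index should be one left open by
      \<open>a\<close>.\<close>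
    have "(p, c) \<in> V" using V(2)[of a] a(1) pc(1) by auto
    moreover have "p \<in> \<Psi>" "p \<notin> fst ` a"
      using R[of a] a(1) imageI[OF pc(1), of fst] pc(1) by (auto simp: cov_def ok_def)
    ultimately show False using pc(2) by (force simp: a_def)
  qed
  then obtain a where a: "a \<subseteq> \<Psi> \<times> UNIV" "|a| \<le>o \<mu>" and thick: "\<And>R. \<not> cov a R" by blast
  define good where "good R x \<longleftrightarrow> x \<in> B a \<and> (\<forall>(p, c)\<in>R. q p x \<noteq> c)" for R x
  \<comment> \<open>\<open>F'\<close> is generated by \<open>F\<close>, the set \<open>B a\<close>
    and the removal of at most \<chi> labels at open indices. It is proper because \<open>a\<close>
    is not coverable. At an index of \<open>a\<close> the value is constant on \<open>B a\<close>;
    at any other index in \<Psi> each single value is removed by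
    \<open>R = {(p, c)}\<close>.\<close>
  define F' where "F' = Abs_filter (\<lambda>P. \<exists>R. ok a R \<and> eventually (\<lambda>x. good R x \<longrightarrow> P x) F)"
  have ok_Un: "ok a (\<Union>(R ` I))" if "|I| \<le>o \<chi>" "\<And>i. i \<in> I \<Longrightarrow> ok a (R i)"
    for I :: "('a \<Rightarrow> bool) set" and R
  proof -
    have 1: "\<forall>i\<in>I. |R i| \<le>o \<chi>" and 2: "R i \<subseteq> \<Psi> \<times> UNIV" and 3: "fst ` R i \<inter> fst ` a = {}"
      if "i \<in> I" for i using \<open>\<And>i. i \<in> I \<Longrightarrow> ok a (R i)\<close> that by (auto simp: ok_def)
    have "|\<Union>(R ` I)| \<le>o \<chi>"
      using UNION_Cinfinite_bound[OF that(1) _ inf(2), of R] 1 by blast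
    moreover have "\<Union>(R ` I) \<subseteq> \<Psi> \<times> UNIV" using 2 by blast
    moreover have "fst ` \<Union>(R ` I) \<inter> fst ` a = {}" using 3 by blast
    ultimately show ?thesis by (simp add: ok_def)
  qed
  have ok_Un2: "ok a (R \<union> S)" if "ok a R" "ok a S" for R S
    using that Un_Cinfinite_bound[OF _ _ inf(2), of R S]
    by (simp add: ok_def image_Un Int_Un_distrib2)
  have ev: "eventually P F' \<longleftrightarrow> (\<exists>R. ok a R \<and> eventually (\<lambda>x. good R x \<longrightarrow> P x) F)" for P
    unfolding F'_def
  proof (rule eventually_Abs_filter, rule is_filter.intro)
    show "\<exists>R. ok a R \<and> (\<forall>\<^sub>F x in F. good R x \<longrightarrow> True)" using empty by auto
  next
    fix P Q assume "\<exists>R. ok a R \<and> (\<forall>\<^sub>F x in F. good R x \<longrightarrow> P x)"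
      "\<exists>R. ok a R \<and> (\<forall>\<^sub>F x in F. good R x \<longrightarrow> Q x)"
    then obtain R S where RS: "ok a R" "ok a S" "\<forall>\<^sub>F x in F. good R x \<longrightarrow> P x"
      "\<forall>\<^sub>F x in F. good S x \<longrightarrow> Q x" by blast
    from RS(3,4) have "\<forall>\<^sub>F x in F. good (R \<union> S) x \<longrightarrow> P x \<and> Q x"
      by eventually_elim (auto simp: good_def)
    with ok_Un2[OF RS(1,2)] show "\<exists>R. ok a R \<and> (\<forall>\<^sub>F x in F. good R x \<longrightarrow> P x \<and> Q x)" by blast
  next
    fix P Q assume "\<forall>x. P x \<longrightarrow> Q x" "\<exists>R. ok a R \<and> (\<forall>\<^sub>F x in F. good R x \<longrightarrow> P x)"
    then show "\<exists>R. ok a R \<and> (\<forall>\<^sub>F x in F. good R x \<longrightarrow> Q x)"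
      by (auto elim!: eventually_mono)
  qed
  show thesis
  proof (rule that[of F'])
    show "F' \<le> F"
      using empty by (auto simp: le_filter_def ev elim: eventually_mono intro!: exI[of _ "{}"])
    show "complete_filter \<chi> F'"
    proof (rule complete_filterI)
      show "\<not> eventually (\<lambda>x. False) F'"
      proof
        assume "eventually (\<lambda>x. False) F'"
        then obtain R where "ok a R" "eventually (\<lambda>x. \<not> good R x) F" by (auto simp: ev)
        then have "cov a R" by (auto simp: cov_def good_def elim!: eventually_mono)
        with thick show False by blast
      qed
    next
      fix \<P> assume P: "|\<P>| \<le>o \<chi>" "\<And>P. P \<in> \<P> \<Longrightarrow> eventually P F'"
      then have "\<forall>P\<in>\<P>. \<exists>R. ok a R \<and> eventually (\<lambda>x. good R x \<longrightarrow> P x) F" by (simp add: ev)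
      then obtain R where R: "\<And>P. P \<in> \<P> \<Longrightarrow> ok a (R P)"
        "\<And>P. P \<in> \<P> \<Longrightarrow> eventually (\<lambda>x. good (R P) x \<longrightarrow> P x) F" by metis
      have "eventually (\<lambda>x. \<forall>P\<in>\<P>. good (R P) x \<longrightarrow> P x) F"
        by (rule complete_filter_ball[OF F P(1) R(2)])
      then have "eventually (\<lambda>x. good (\<Union>(R ` \<P>)) x \<longrightarrow> (\<forall>P\<in>\<P>. P x)) F"
        by eventually_elim (auto simp: good_def)
      moreover have "ok a (\<Union>(R ` \<P>))" by (rule ok_Un[OF P(1) R(1)])
      ultimately show "eventually (\<lambda>x. \<forall>P\<in>\<P>. P x) F'" unfolding ev by blast
    qed
  next
    fix p assume p: "p \<in> \<Psi>"
    show "(\<exists>c. eventually (\<lambda>x. q p x = c) F') \<or> (\<forall>c. eventually (\<lambda>x. q p x \<noteq> c) F')"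
    proof (cases "p \<in> fst ` a")
      case True
      then obtain c where "(p, c) \<in> a" by auto
      then have "eventually (\<lambda>x. q p x = c) F'"
        using empty by (auto simp: ev good_def B_def intro!: always_eventually exI[of _ "{}"])
      then show ?thesis by blast
    next
      case False
      have "eventually (\<lambda>x. q p x \<noteq> c) F'" for c
      proof -
        have "ok a {(p, c)}"
          using p False card_of_singleton_le_Cinfinite[OF inf(2)] by (auto simp: ok_def)
        then show ?thesis
          by (auto simp: ev good_def intro!: always_eventually exI[of _ "{(p, c)}"])
      qed
      then show ?thesis by blast
    qed
  qed
qed

section \<open>Back-and-forth equivalence and invariant subgroups\<close>

definition subgrp :: "'v::ab_group_add set \<Rightarrow> bool" where
  "subgrp H \<longleftrightarrow> 0 \<in> H \<and> (\<forall>x\<in>H. \<forall>y\<in>H. x - y \<in> H)"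

lemma subgrp_zero: "subgrp H \<Longrightarrow> 0 \<in> H"
  and subgrp_diff: "subgrp H \<Longrightarrow> x \<in> H \<Longrightarrow> y \<in> H \<Longrightarrow> x - y \<in> H"
  by (auto simp: subgrp_def)

lemma subgrp_uminus: "subgrp H \<Longrightarrow> x \<in> H \<Longrightarrow> - x \<in> H"
  using subgrp_diff[of H 0 x] subgrp_zero[of H] by simp

lemma subgrp_add: "subgrp H \<Longrightarrow> x \<in> H \<Longrightarrow> y \<in> H \<Longrightarrow> x + y \<in> H"
  using subgrp_diff[of H x "- y"] subgrp_uminus[of H y] by simp

lemma subgrp_diff_cancel:
  assumes "subgrp H" "x - y \<in> H"
  shows "x \<in> H \<longleftrightarrow> y \<in> H"
  using subgrp_diff[OF assms(1) _ assms(2), of x] subgrp_add[OF assms, of y] by auto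

lemma subgrp_Inter: "(\<And>H. H \<in> J \<Longrightarrow> subgrp H) \<Longrightarrow> subgrp (\<Inter>J)"
  by (auto simp: subgrp_def)

text \<open>The second alternative may hold for every \<open>c\<close>. For a filter complete for
  \<chi> many sets this happens only if \<open>H\<close> has more than \<chi> cosets.\<close>

definition decides :: "'v::ab_group_add filter \<Rightarrow> 'v set \<Rightarrow> bool" where
  "decides F H \<longleftrightarrow> (\<forall>c. eventually (\<lambda>z. z - c \<in> H) F \<or> eventually (\<lambda>z. z - c \<notin> H) F)"

text \<open>\<open>complete_filter_decide\<close> is applied to the quotient maps:
  \<open>q H x\<close> is the coset \<open>Y x + H\<close>, and a map that is almost constant or
  avoids each of its values decides every coset.\<close>

lemma refine_decides:
  fixes Y :: "'a \<Rightarrow> 'v::ab_group_add"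
  assumes F: "complete_filter \<chi> F" and inf: "Cinfinite \<mu>" "Cinfinite \<chi>"
    and exp: "\<chi> ^c \<mu> \<le>o \<chi>" and le: "cardSuc \<mu> \<le>o \<chi>" and \<Psi>: "|\<Psi>| \<le>o \<mu>"
    and sub: "\<And>H. H \<in> \<Psi> \<Longrightarrow> subgrp H"
  obtains F' where "F' \<le> F" "complete_filter \<chi> F'" "\<And>H. H \<in> \<Psi> \<Longrightarrow> decides (filtermap Y F') H"
proof -
  define q where "q H x = {g. g - Y x \<in> H}" for H x
  obtain F' where F': "F' \<le> F" "complete_filter \<chi> F'"
    "\<And>H. H \<in> \<Psi> \<Longrightarrow> (\<exists>C. eventually (\<lambda>x. q H x = C) F') \<or> (\<forall>C. eventually (\<lambda>x. q H x \<noteq> C) F')"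
    using complete_filter_decide[OF F inf exp le \<Psi>, of q] by metis
  have "decides (filtermap Y F') H" if H: "H \<in> \<Psi>" for H
  proof -
    note H' = sub[OF H]
    have mem: "c \<in> q H x \<longleftrightarrow> Y x - c \<in> H" for c x
      using subgrp_uminus[OF H', of "Y x - c"] subgrp_uminus[OF H', of "c - Y x"] by (auto simp: q_def)
    have "eventually (\<lambda>x. Y x - c \<in> H) F' \<or> eventually (\<lambda>x. Y x - c \<notin> H) F'" for c
      using F'(3)[OF H]
    proof
      assume "\<exists>C. eventually (\<lambda>x. q H x = C) F'"
      then obtain C where C: "eventually (\<lambda>x. q H x = C) F'" ..
      show ?thesis
      proof (cases "c \<in> C")
        case True
        from C have "eventually (\<lambda>x. Y x - c \<in> H) F'"
          by eventually_elim (use True mem in blast)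
        then show ?thesis ..
      next
        case False
        from C have "eventually (\<lambda>x. Y x - c \<notin> H) F'"
          by eventually_elim (use False mem in blast)
        then show ?thesis ..
      qed
    next
      assume C: "\<forall>C. eventually (\<lambda>x. q H x \<noteq> C) F'"
      have eq: "q H x = {g. g - c \<in> H}" if "Y x - c \<in> H" for x
      proof -
        have "g - Y x \<in> H \<longleftrightarrow> g - c \<in> H" for g
          by (rule subgrp_diff_cancel[OF H']) (use subgrp_uminus[OF H' that] in simp)
        then show ?thesis by (simp add: q_def)
      qed
      from C have "eventually (\<lambda>x. q H x \<noteq> {g. g - c \<in> H}) F'" ..
      then have "eventually (\<lambda>x. Y x - c \<notin> H) F'"
        by eventually_elim (use eq in blast)
      then show ?thesis ..
    qed
    then show ?thesis by (simp add: decides_def eventually_filtermap)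
  qed
  with F'(1,2) that show thesis by blast
qed

text \<open>Each group in \<open>J\<close> has a coset that almost contains the filter. By
  completeness these cosets have a common point \<open>k\<close>, which represents all of
  them.\<close>

lemma minimal_coset:
  assumes F: "complete_filter \<chi> F" and \<Psi>: "|\<Psi>| \<le>o \<chi>"
    and sub: "\<And>H. H \<in> \<Psi> \<Longrightarrow> subgrp H" and dec: "\<And>H. H \<in> \<Psi> \<Longrightarrow> decides F H"
  obtains J k where "J \<subseteq> \<Psi>" "eventually (\<lambda>z. z - k \<in> \<Inter>J) F"
    "\<And>H. H \<in> \<Psi> \<Longrightarrow> H \<in> J \<or> (\<forall>c. eventually (\<lambda>z. z - c \<notin> H) F)"
proof -
  define J where "J = {H \<in> \<Psi>. \<exists>c. eventually (\<lambda>z. z - c \<in> H) F}"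
  have "\<forall>H\<in>J. \<exists>c. eventually (\<lambda>z. z - c \<in> H) F" by (auto simp: J_def)
  then obtain c where c: "\<And>H. H \<in> J \<Longrightarrow> eventually (\<lambda>z. z - c H \<in> H) F" by metis
  have "|J| \<le>o \<chi>"
    by (rule ordLeq_transitive[OF card_of_mono1 \<Psi>]) (auto simp: J_def)
  then have ev: "eventually (\<lambda>z. \<forall>H\<in>J. z - c H \<in> H) F"
    by (rule complete_filter_ball[OF F _ c])
  from complete_filter_ex[OF F this] obtain k where k: "\<forall>H\<in>J. k - c H \<in> H" ..
  show thesis
  proof (rule that[of J k])
    show "J \<subseteq> \<Psi>" by (auto simp: J_def)
    from ev show "eventually (\<lambda>z. z - k \<in> \<Inter>J) F"
    proof eventually_elim
      case (elim z)
      have "z - k \<in> H" if "H \<in> J" for H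
      proof -
        have "(z - c H) - (k - c H) \<in> H"
          by (rule subgrp_diff) (use that elim k sub[of H] \<open>J \<subseteq> \<Psi>\<close> in auto)
        then show ?thesis by simp
      qed
      then show ?case by blast
    qed
  next
    fix H assume "H \<in> \<Psi>"
    then show "H \<in> J \<or> (\<forall>c. eventually (\<lambda>z. z - c \<notin> H) F)"
      using dec[of H] by (auto simp: J_def decides_def)
  qed
qed

section \<open>Back-and-forth equivalence of bounded rank and its invariant groups\<close>

text \<open>
  From here on assignments are total functions on \<open>'o\<close>, which form a group; in context \<open>n\<close> only the
  values at \<open>i < n\<close> matter, and an extension of \<open>z\<close> to a larger context is any \<open>z1\<close> with \<open>agree n z1 z\<close>.
\<close>

abbreviation agree :: "'o::wellorder \<Rightarrow> ('o \<Rightarrow> 'm) \<Rightarrow> ('o \<Rightarrow> 'm) \<Rightarrow> bool" where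
  "agree n z z' \<equiv> \<forall>i<n. z i = z' i"

text \<open>This is the Karp (Ehrenfeucht-Fraisse) equivalence of rank \<beta>, with an arbitrary
  family \<open>\<A> n\<close> in place of the atomic formulas. A move passes from context
  \<open>n\<close> to any larger \<open>n'\<close>, thus adding a block of coordinates.\<close>

function eqv :: "('o::wellorder \<Rightarrow> ('o \<Rightarrow> 'm) set set) \<Rightarrow> 'g::wellorder \<Rightarrow> 'o \<Rightarrow> ('o \<Rightarrow> 'm) \<Rightarrow> ('o \<Rightarrow> 'm) \<Rightarrow> bool" where
  "eqv \<A> \<beta> n z z' \<longleftrightarrow> (\<forall>S\<in>\<A> n. z \<in> S \<longleftrightarrow> z' \<in> S) \<and>
     (\<forall>\<delta>. \<delta> < \<beta> \<longrightarrow> (\<forall>n'\<ge>n.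
        (\<forall>z1. agree n z1 z \<longrightarrow> (\<exists>z1'. agree n z1' z' \<and> eqv \<A> \<delta> n' z1 z1')) \<and>
        (\<forall>z1'. agree n z1' z' \<longrightarrow> (\<exists>z1. agree n z1 z \<and> eqv \<A> \<delta> n' z1 z1'))))"
  by auto
termination
  by (relation "inv_image {(x, y). x < y} (\<lambda>(\<A>, \<beta>, n, z, z'). \<beta>)")
    (rule wf_inv_image[OF wf], simp_all only: in_inv_image prod.case mem_Collect_eq)

declare eqv.simps [simp del]

text \<open>One half of a move; with the halves separate, symmetry exchanges them and transitivity
  composes each on its own.\<close>

definition ext_sim :: "'o::wellorder \<Rightarrow> (('o \<Rightarrow> 'm) \<Rightarrow> ('o \<Rightarrow> 'm) \<Rightarrow> bool) \<Rightarrow> ('o \<Rightarrow> 'm) \<Rightarrow> ('o \<Rightarrow> 'm) \<Rightarrow> bool" where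
  "ext_sim n R z z' \<longleftrightarrow> (\<forall>z1. agree n z1 z \<longrightarrow> (\<exists>z1'. agree n z1' z' \<and> R z1 z1'))"

lemma eqv_iff: "eqv \<A> \<beta> n z z' \<longleftrightarrow> (\<forall>S\<in>\<A> n. z \<in> S \<longleftrightarrow> z' \<in> S) \<and>
     (\<forall>\<delta><\<beta>. \<forall>n'\<ge>n. ext_sim n (eqv \<A> \<delta> n') z z' \<and> ext_sim n (\<lambda>x y. eqv \<A> \<delta> n' y x) z' z)"
  unfolding ext_sim_def by (subst eqv.simps) (rule refl)

lemma ext_sim_refl: "(\<And>z. R z z) \<Longrightarrow> ext_sim n R z z"
  by (auto simp: ext_sim_def)

lemma ext_sim_mono: "ext_sim n R z z' \<Longrightarrow> (\<And>x y. R x y \<Longrightarrow> R' x y) \<Longrightarrow> ext_sim n R' z z'"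
  unfolding ext_sim_def by blast

lemma ext_sim_trans: "ext_sim n R z z' \<Longrightarrow> ext_sim n R z' z'' \<Longrightarrow> (\<And>x y w. R x y \<Longrightarrow> R y w \<Longrightarrow> R x w) \<Longrightarrow>
    ext_sim n R z z''"
  unfolding ext_sim_def by meson

lemma eqv_refl: "eqv \<A> \<beta> n z z"
proof (induction \<beta> arbitrary: n z rule: less_induct)
  case (less \<beta>)
  then show ?case by (subst eqv_iff) (auto intro: ext_sim_refl)
qed

lemma eqv_sym: "eqv \<A> \<beta> n z z' \<Longrightarrow> eqv \<A> \<beta> n z' z"
proof (induction \<beta> arbitrary: n z z' rule: less_induct)
  case (less \<beta>)
  note p = less.prems[unfolded eqv_iff[of \<A> \<beta>]]
  have "ext_sim n (eqv \<A> \<delta> n') z' z" "ext_sim n (\<lambda>x y. eqv \<A> \<delta> n' y x) z z'"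
    if d: "\<delta> < \<beta>" "n \<le> n'" for \<delta> n'
  proof -
    show "ext_sim n (eqv \<A> \<delta> n') z' z"
      by (rule ext_sim_mono[of n "\<lambda>x y. eqv \<A> \<delta> n' y x"]) (use p d less.IH[OF d(1)] in simp_all)
    show "ext_sim n (\<lambda>x y. eqv \<A> \<delta> n' y x) z z'"
      by (rule ext_sim_mono[of n "eqv \<A> \<delta> n'"]) (use p d less.IH[OF d(1)] in simp_all)
  qed
  with p show ?case by (subst eqv_iff) simp
qed

lemma eqv_trans: "eqv \<A> \<beta> n z z' \<Longrightarrow> eqv \<A> \<beta> n z' z'' \<Longrightarrow> eqv \<A> \<beta> n z z''"
proof (induction \<beta> arbitrary: n z z' z'' rule: less_induct)
  case (less \<beta>)
  note p = less.prems[unfolded eqv_iff[of \<A> \<beta>]]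
  have "ext_sim n (eqv \<A> \<delta> n') z z''" "ext_sim n (\<lambda>x y. eqv \<A> \<delta> n' y x) z'' z"
    if d: "\<delta> < \<beta>" "n \<le> n'" for \<delta> n'
  proof -
    show "ext_sim n (eqv \<A> \<delta> n') z z''"
      by (rule ext_sim_trans[of _ _ z z']) (use p d in simp, use p d in simp, rule less.IH[OF d(1)])
    show "ext_sim n (\<lambda>x y. eqv \<A> \<delta> n' y x) z'' z"
      by (rule ext_sim_trans[of _ _ z'' z']) (use p d in simp, use p d in simp, rule less.IH[OF d(1)])
  qed
  with p show ?case by (subst eqv_iff) simp
qed

lemma eqv_mono: "eqv \<A> \<beta> n z z' \<Longrightarrow> \<delta> \<le> \<beta> \<Longrightarrow> eqv \<A> \<delta> n z z'"
  unfolding eqv_iff[of \<A> \<beta>] eqv_iff[of \<A> \<delta>] by auto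

lemma eqv_forth:
  assumes "eqv \<A> \<beta> n z z'" "\<delta> < \<beta>" "n \<le> n'" "agree n z1 z"
  obtains z1' where "agree n z1' z'" "eqv \<A> \<delta> n' z1 z1'"
proof -
  have "ext_sim n (eqv \<A> \<delta> n') z z'"
    using assms(1)[unfolded eqv_iff[of \<A> \<beta>]] assms(2,3) by simp
  with assms(4) that show thesis unfolding ext_sim_def by blast
qed

definition eqv_closed :: "('o::wellorder \<Rightarrow> ('o \<Rightarrow> 'm) set set) \<Rightarrow> 'g::wellorder \<Rightarrow> 'o \<Rightarrow> ('o \<Rightarrow> 'm) set \<Rightarrow> bool" where
  "eqv_closed \<A> \<beta> n S \<longleftrightarrow> (\<forall>z z'. eqv \<A> \<beta> n z z' \<longrightarrow> z \<in> S \<longrightarrow> z' \<in> S)"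

text \<open>These groups take over the role of those defined by positive existential formulas. They
  are closed under intersections and, at the price of a higher rank, under projections, which is all
  that the comparison of filters uses of the syntax.\<close>

definition eqv_grps :: "('o::wellorder \<Rightarrow> ('o \<Rightarrow> 'm::ab_group_add) set set) \<Rightarrow> 'g::wellorder \<Rightarrow> 'o \<Rightarrow> ('o \<Rightarrow> 'm) set set" where
  "eqv_grps \<A> \<beta> n = {H. subgrp H \<and> eqv_closed \<A> \<beta> n H}"

definition eqv_class :: "('o::wellorder \<Rightarrow> ('o \<Rightarrow> 'm) set set) \<Rightarrow> 'g::wellorder \<Rightarrow> 'o \<Rightarrow> ('o \<Rightarrow> 'm) \<Rightarrow> ('o \<Rightarrow> 'm) set" where
  "eqv_class \<A> \<beta> n z = {z'. eqv \<A> \<beta> n z z'}"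

lemma eqv_class_eq: "eqv_class \<A> \<beta> n z = eqv_class \<A> \<beta> n z' \<longleftrightarrow> eqv \<A> \<beta> n z z'"
  unfolding eqv_class_def using eqv_refl eqv_sym eqv_trans by blast

lemma eqv_closed_class: "eqv_closed \<A> \<beta> n (eqv_class \<A> \<beta> n z)"
  unfolding eqv_closed_def eqv_class_def using eqv_trans by blast

definition proj :: "'o::wellorder \<Rightarrow> ('o \<Rightarrow> 'm) set \<Rightarrow> ('o \<Rightarrow> 'm) set" where
  "proj n H = {z. \<exists>z1\<in>H. agree n z1 z}"

text \<open>The semantic form of an existential quantifier: the forth clause at rank \<beta> carries
  the witness over with agreement at the lower rank \<delta>.\<close>

lemma eqv_grps_proj:
  assumes "H \<in> eqv_grps \<A> \<delta> n'" "\<delta> < \<beta>" "n \<le> n'"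
  shows "proj n H \<in> eqv_grps \<A> \<beta> n"
proof -
  have H: "subgrp H" "eqv_closed \<A> \<delta> n' H" using assms(1) by (auto simp: eqv_grps_def)
  have "x - y \<in> proj n H" if xy: "x \<in> proj n H" "y \<in> proj n H" for x y
  proof -
    obtain x1 y1 where "x1 \<in> H" "y1 \<in> H" "agree n x1 x" "agree n y1 y"
      using xy by (auto simp: proj_def)
    then have "x1 - y1 \<in> H" "agree n (x1 - y1) (x - y)"
      using subgrp_diff[OF H(1), of x1 y1] by simp_all
    then show ?thesis unfolding proj_def by blast
  qed
  moreover have "0 \<in> proj n H" using subgrp_zero[OF H(1)] by (auto simp: proj_def intro!: bexI[of _ 0])
  moreover have "z' \<in> proj n H" if z: "eqv \<A> \<beta> n z z'" "z \<in> proj n H" for z z'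
  proof -
    obtain z1 where z1: "z1 \<in> H" "agree n z1 z" using z(2) by (auto simp: proj_def)
    obtain z1' where "agree n z1' z'" "eqv \<A> \<delta> n' z1 z1'"
      using eqv_forth[OF z(1) assms(2,3) z1(2)] .
    then show ?thesis using H(2) z1(1) unfolding eqv_closed_def proj_def by blast
  qed
  ultimately show ?thesis by (auto simp: eqv_grps_def subgrp_def eqv_closed_def)
qed

lemma eqv_grps_Inter:
  assumes "J \<subseteq> eqv_grps \<A> \<beta> n"
  shows "\<Inter>J \<in> eqv_grps \<A> \<beta> n"
proof -
  have "subgrp (\<Inter>J)" using assms by (intro subgrp_Inter) (auto simp: eqv_grps_def)
  moreover have "eqv_closed \<A> \<beta> n (\<Inter>J)"
    using assms unfolding eqv_grps_def eqv_closed_def by blast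
  ultimately show ?thesis by (simp add: eqv_grps_def)
qed

text \<open>Agreement includes that both filters decide every coset. Hence it survives any
  refinement of the two filters.\<close>

definition same_type :: "('o::wellorder \<Rightarrow> ('o \<Rightarrow> 'm::ab_group_add) set set) \<Rightarrow> 'g::wellorder \<Rightarrow> 'o \<Rightarrow>
    ('o \<Rightarrow> 'm) filter \<Rightarrow> ('o \<Rightarrow> 'm) filter \<Rightarrow> bool" where
  "same_type \<A> \<beta> n F F' \<longleftrightarrow> (\<forall>H\<in>eqv_grps \<A> \<beta> n. \<forall>c.
     (eventually (\<lambda>z. z - c \<in> H) F \<and> eventually (\<lambda>z. z - c \<in> H) F') \<or>
     (eventually (\<lambda>z. z - c \<notin> H) F \<and> eventually (\<lambda>z. z - c \<notin> H) F'))"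

lemma same_type_sym: "same_type \<A> \<beta> n F F' \<Longrightarrow> same_type \<A> \<beta> n F' F"
  by (auto simp: same_type_def)

lemma same_type_mono: "same_type \<A> \<beta> n F F' \<Longrightarrow> G \<le> F \<Longrightarrow> G' \<le> F' \<Longrightarrow> same_type \<A> \<beta> n G G'"
  unfolding same_type_def by (meson filter_leD)

section \<open>Comparing filters\<close>

lemma eqv_base: "eqv \<A> \<beta> n z z' \<Longrightarrow> S \<in> \<A> n \<Longrightarrow> z \<in> S \<longleftrightarrow> z' \<in> S"
  by (subst (asm) eqv_iff) blast

lemma ex_agree_iff_proj:
  fixes z k :: "'o::wellorder \<Rightarrow> 'm::ab_group_add"
  shows "(\<exists>v. agree n v z \<and> v - k \<in> C) \<longleftrightarrow> z - k \<in> proj n C"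
proof
  assume "\<exists>v. agree n v z \<and> v - k \<in> C"
  then obtain v where v: "agree n v z" "v - k \<in> C" by blast
  then have "agree n (v - k) (z - k)" by simp
  with v(2) show "z - k \<in> proj n C" unfolding proj_def by blast
next
  assume "z - k \<in> proj n C"
  then obtain w where "w \<in> C" "agree n w (z - k)" unfolding proj_def by blast
  then have "agree n (w + k) z \<and> (w + k) - k \<in> C" by simp
  then show "\<exists>v. agree n v z \<and> v - k \<in> C" by blast
qed

text \<open>A proper filter below \<open>F\<close> rules out that \<open>F\<close> avoids the coset.
  As \<open>F\<close> has already decided it, only membership remains, and it is shared by
  \<open>F'\<close>.\<close>

lemma same_type_transfer:
  assumes same: "same_type \<A> \<beta> n F F'" and H: "H \<in> eqv_grps \<A> \<beta> n"
    and G: "complete_filter \<chi> G" "G \<le> F" and ev: "eventually (\<lambda>z. z - k \<in> H) G"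
  shows "eventually (\<lambda>z. z - k \<in> H) F \<and> eventually (\<lambda>z. z - k \<in> H) F'"
proof -
  have "\<not> eventually (\<lambda>z. z - k \<notin> H) F"
  proof
    assume "eventually (\<lambda>z. z - k \<notin> H) F"
    then have "eventually (\<lambda>z. z - k \<notin> H) G" by (rule filter_leD[OF G(2)])
    with ev have "eventually (\<lambda>z. False) G" by eventually_elim simp
    with complete_filter_proper[OF G(1)] show False ..
  qed
  with same H show ?thesis unfolding same_type_def by blast
qed

text \<open>
  \<open>G'\<close> lives on the points \<open>v z' + (y z - w z)\<close>: modulo the groups for which \<open>v\<close> is constant it
  behaves like \<open>y\<close>, and modulo the others it avoids every coset because \<open>v\<close> does.
\<close>

lemma same_type_extend:
  fixes \<A> :: "'o::wellorder \<Rightarrow> ('o \<Rightarrow> 'm::ab_group_add) set set"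
  assumes inf: "Cinfinite \<mu>" "Cinfinite \<chi>" and exp: "\<chi> ^c \<mu> \<le>o \<chi>" and le: "cardSuc \<mu> \<le>o \<chi>"
    and F: "complete_filter \<chi> F" and F': "complete_filter \<chi> F'"
    and same: "same_type \<A> \<beta> n F F'" and \<delta>: "\<delta> < \<beta>" "n \<le> n'"
    and \<Psi>: "|eqv_grps \<A> \<delta> n'| \<le>o \<mu>" and y: "\<And>z. agree n (y z) z"
  obtains G G' where "complete_filter \<chi> G" "complete_filter \<chi> G'" "same_type \<A> \<delta> n' G G'"
    "G \<le> filtermap y F"
    "\<And>P. eventually P F' \<Longrightarrow> eventually (\<lambda>g. \<exists>z'. P z' \<and> agree n g z') G'"
proof -
  let ?\<Psi> = "eqv_grps \<A> \<delta> n'"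
  have sub: "subgrp H" if "H \<in> ?\<Psi>" for H using that by (simp add: eqv_grps_def)
  have "\<mu> \<le>o \<chi>" by (rule ordLeq_transitive[OF cardSuc_ordLeq le]) (simp add: inf(1))
  then have \<Psi>': "|?\<Psi>| \<le>o \<chi>" by (rule ordLeq_transitive[OF \<Psi>])
  obtain F1 where F1: "F1 \<le> F" "complete_filter \<chi> F1" "\<And>H. H \<in> ?\<Psi> \<Longrightarrow> decides (filtermap y F1) H"
    using refine_decides[OF F inf exp le \<Psi> sub] by metis
  define G where "G = filtermap y F1"
  have G: "complete_filter \<chi> G" unfolding G_def by (rule complete_filter_filtermap[OF F1(2)])
  obtain J k where J: "J \<subseteq> ?\<Psi>" and k: "eventually (\<lambda>z. z - k \<in> \<Inter>J) G"
    and min: "\<And>H. H \<in> ?\<Psi> \<Longrightarrow> H \<in> J \<or> (\<forall>c. eventually (\<lambda>z. z - c \<notin> H) G)"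
    using minimal_coset[OF G \<Psi>' sub] F1(3) unfolding G_def by metis
  \<comment> \<open>\<open>k + C\<close> is the smallest coset of a group in \<open>?\<Psi>\<close>
    that contains almost all \<open>y z\<close>.\<close>
  define C where "C = \<Inter>J"
  have C: "C \<in> ?\<Psi>" unfolding C_def by (rule eqv_grps_Inter[OF J])
  have EY: "eventually (\<lambda>z. y z - k \<in> C) F1"
    using k by (simp add: C_def G_def eventually_filtermap)
  then have "eventually (\<lambda>z. z - k \<in> proj n C) F1"
    by eventually_elim (use y ex_agree_iff_proj in blast)
  with same_type_transfer[OF same eqv_grps_proj[OF C \<delta>] F1(2,1)]
  have ext: "eventually (\<lambda>z. z - k \<in> proj n C) F'" by blast
  \<comment> \<open>Almost every point for \<open>F'\<close> extends into \<open>k + C\<close>,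
    because the projection of that coset transfers. On the remaining points the default
    \<open>z\<close> keeps \<open>agree n (v z) z\<close> true.\<close>
  define v where "v z = (if z - k \<in> proj n C then SOME u. agree n u z \<and> u - k \<in> C else z)" for z
  have v: "agree n (v z) z \<and> v z - k \<in> C" if "z - k \<in> proj n C" for z
    unfolding v_def using that someI_ex[OF ex_agree_iff_proj[of n z k C, THEN iffD2]] by simp
  then have v_agree: "agree n (v z) z" for z by (cases "z - k \<in> proj n C") (auto simp: v_def)
  obtain F1' where F1': "F1' \<le> F'" "complete_filter \<chi> F1'" "\<And>H. H \<in> ?\<Psi> \<Longrightarrow> decides (filtermap v F1') H"
    using refine_decides[OF F' inf exp le \<Psi> sub] by metis
  define V where "V = filtermap v F1'"
  have V: "complete_filter \<chi> V" unfolding V_def by (rule complete_filter_filtermap[OF F1'(2)])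
  obtain J0 k0 where J0: "J0 \<subseteq> ?\<Psi>" and k0: "eventually (\<lambda>z. z - k0 \<in> \<Inter>J0) V"
    and min0: "\<And>H. H \<in> ?\<Psi> \<Longrightarrow> H \<in> J0 \<or> (\<forall>c. eventually (\<lambda>z. z - c \<notin> H) V)"
    using minimal_coset[OF V \<Psi>' sub] F1'(3) unfolding V_def by metis
  \<comment> \<open>The choices made for \<open>v\<close> may fall into cosets of further groups, so
    \<open>C0\<close> can be smaller than \<open>C\<close> and \<open>v\<close> can satisfy more
    than \<open>y\<close> does. The map \<open>w\<close> below reproduces this surplus on the side
    of \<open>F\<close> so that it can be subtracted.\<close>
  define C0 where "C0 = \<Inter>J0"
  have C0: "C0 \<in> ?\<Psi>" unfolding C0_def by (rule eqv_grps_Inter[OF J0])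
  have EV: "eventually (\<lambda>z. v z - k0 \<in> C0) F1'"
    using k0 by (simp add: C0_def V_def eventually_filtermap)
  have EV': "eventually (\<lambda>z. v z - k \<in> C) F1'"
    using filter_leD[OF F1'(1) ext] by eventually_elim (use v in blast)
  have "J \<subseteq> J0"
  proof
    fix H assume H: "H \<in> J"
    have "\<not> eventually (\<lambda>z. z - k \<notin> H) V"
    proof
      assume "eventually (\<lambda>z. z - k \<notin> H) V"
      then have "eventually (\<lambda>z. v z - k \<notin> H) F1'" by (simp add: V_def eventually_filtermap)
      with EV' have "eventually (\<lambda>z. False) F1'"
        by eventually_elim (use H in \<open>auto simp: C_def\<close>)
      with complete_filter_proper[OF F1'(2)] show False ..
    qed
    with min0[of H] H J show "H \<in> J0" by blast
  qed
  then have C0C: "C0 \<subseteq> C" unfolding C_def C0_def by blast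
  have k0k: "k0 - k \<in> C"
  proof -
    have "eventually (\<lambda>z. v z - k0 \<in> C \<and> v z - k \<in> C) F1'"
      using EV EV' by eventually_elim (use C0C in blast)
    from complete_filter_ex[OF F1'(2) this] obtain z where "v z - k0 \<in> C" "v z - k \<in> C" by blast
    then have "(v z - k) - (v z - k0) \<in> C" using subgrp_diff[OF sub[OF C]] by blast
    then show ?thesis by simp
  qed
  have "eventually (\<lambda>z. z - k0 \<in> proj n C0) F1'"
    using EV by eventually_elim (use v_agree ex_agree_iff_proj in blast)
  with same_type_transfer[OF same_type_sym[OF same] eqv_grps_proj[OF C0 \<delta>] F1'(2,1)]
  have "eventually (\<lambda>z. z - k0 \<in> proj n C0) F" by blast
  then have ext0: "eventually (\<lambda>z. z - k0 \<in> proj n C0) F1" by (rule filter_leD[OF F1(1)])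
  \<comment> \<open>Transferring the projection of \<open>k0 + C0\<close> back to \<open>F\<close>
    gives almost every \<open>z\<close> an extension into this coset; the default value serves the
    same purpose as for \<open>v\<close>.\<close>
  define w where "w z = (if z - k0 \<in> proj n C0 then SOME u. agree n u z \<and> u - k0 \<in> C0 else z)" for z
  have w: "agree n (w z) z \<and> w z - k0 \<in> C0" if "z - k0 \<in> proj n C0" for z
    unfolding w_def using that someI_ex[OF ex_agree_iff_proj[of n z k0 C0, THEN iffD2]] by simp
  then have w_agree: "agree n (w z) z" for z by (cases "z - k0 \<in> proj n C0") (auto simp: w_def)
  have EW: "eventually (\<lambda>z. w z - k0 \<in> C0) F1"
    using ext0 by eventually_elim (use w in blast)
  \<comment> \<open>Both \<open>y z\<close> and \<open>w z\<close> extend \<open>z\<close>, so their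
    difference vanishes below \<open>n\<close> and \<open>h z z'\<close> still extends
    \<open>z'\<close>.\<close>
  define h where "h z z' = v z' + (y z - w z)" for z z'
  \<comment> \<open>The point \<open>z\<close> is drawn first: for fixed \<open>z\<close> the shift
    \<open>y z - w z\<close> is constant, so if \<open>v\<close> avoids every coset of a group, so
    does the shifted map.\<close>
  define G' where "G' = filter_bind h F1 F1'"
  have "same_type \<A> \<delta> n' G G'"
    unfolding same_type_def
  proof (intro ballI allI)
    fix H c assume H: "H \<in> ?\<Psi>"
    note sH = sub[OF H]
    let ?goal = "(eventually (\<lambda>z. z - c \<in> H) G \<and> eventually (\<lambda>z. z - c \<in> H) G') \<or>
     (eventually (\<lambda>z. z - c \<notin> H) G \<and> eventually (\<lambda>z. z - c \<notin> H) G')"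
    show ?goal
    proof (cases "H \<in> J")
      case True
      \<comment> \<open>Modulo \<open>H\<close> each of \<open>y z\<close>, \<open>w z\<close> and
        \<open>v z'\<close> is congruent to \<open>k\<close>, and therefore so is
        \<open>h z z'\<close>.\<close>
      then have CH: "C \<subseteq> H" by (auto simp: C_def)
      have E1: "eventually (\<lambda>z. y z - c \<in> H \<longleftrightarrow> k - c \<in> H) F1"
        using EY
      proof eventually_elim
        case (elim z)
        then show ?case by (intro subgrp_diff_cancel[OF sH]) (use CH in auto)
      qed
      have E2: "eventually (\<lambda>z. eventually (\<lambda>z'. h z z' - c \<in> H \<longleftrightarrow> k - c \<in> H) F1') F1"
        using EY EW
      proof eventually_elim
        case (elim z)
        show ?case using EV'
        proof eventually_elim
          case (elim z')
          have "w z - k0 \<in> C" using \<open>w z - k0 \<in> C0\<close> C0C by blast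
          then have "(w z - k0) + (k0 - k) \<in> C" using subgrp_add[OF sub[OF C] _ k0k] by blast
          then have "w z - k \<in> C" by simp
          then have "(v z' - k) + ((y z - k) - (w z - k)) \<in> C"
            using elim \<open>y z - k \<in> C\<close> sub[OF C] by (blast intro: subgrp_add subgrp_diff)
          then have "h z z' - c - (k - c) \<in> H" using CH by (auto simp: h_def algebra_simps)
          then show ?case by (rule subgrp_diff_cancel[OF sH])
        qed
      qed
      show ?thesis
      proof (cases "k - c \<in> H")
        case True
        then show ?thesis using E1 E2
          by (simp add: G_def G'_def eventually_filtermap eventually_filter_bind)
      next
        case False
        then show ?thesis using E1 E2
          by (simp add: G_def G'_def eventually_filtermap eventually_filter_bind)
      qed
    next
      case False
      then have avoid: "eventually (\<lambda>z. z - c \<notin> H) G" using min[OF H] by blast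
      have "eventually (\<lambda>z. z - c \<notin> H) G'"
      \<comment> \<open>If \<open>H\<close> is in \<open>J0\<close>, then \<open>v z'\<close> and
        \<open>w z\<close> are both congruent to \<open>k0\<close> and cancel, leaving
        \<open>y z\<close>, which avoids the coset. Otherwise \<open>v\<close> avoids every coset of
        \<open>H\<close>, whatever the shift.\<close>
      proof (cases "H \<in> J0")
        case True
        then have CH: "C0 \<subseteq> H" by (auto simp: C0_def)
        have "eventually (\<lambda>z. y z - c \<notin> H) F1"
          using avoid by (simp add: G_def eventually_filtermap)
        then have "eventually (\<lambda>z. eventually (\<lambda>z'. h z z' - c \<notin> H) F1') F1"
          using EW
        proof eventually_elim
          case (elim z)
          show ?case using EV
          proof eventually_elim
            case (elim z')
            have "(v z' - k0) - (w z - k0) \<in> H"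
              using elim \<open>w z - k0 \<in> C0\<close> CH subgrp_diff[OF sH] by blast
            then have "h z z' - c - (y z - c) \<in> H" by (simp add: h_def algebra_simps)
            then show ?case using subgrp_diff_cancel[OF sH] \<open>y z - c \<notin> H\<close> by blast
          qed
        qed
        then show ?thesis by (simp add: G'_def eventually_filter_bind)
      next
        case False
        then have "eventually (\<lambda>z'. v z' - d \<notin> H) F1'" for d
          using min0[OF H] by (simp add: V_def eventually_filtermap)
        from this[of "c - (y z - w z)" for z]
        have "eventually (\<lambda>z'. h z z' - c \<notin> H) F1'" for z by (simp add: h_def algebra_simps)
        then show ?thesis by (simp add: G'_def eventually_filter_bind)
      qed
      with avoid show ?thesis by blast
    qed
  qed
  moreover have "eventually (\<lambda>g. \<exists>z'. P z' \<and> agree n g z') G'" if "eventually P F'" for P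
  proof -
    have h_agree: "agree n (h z z') z'" for z z'
      using y[of z] w_agree[of z] v_agree[of z'] by (simp add: h_def)
    have "eventually (\<lambda>z'. \<exists>z''. P z'' \<and> agree n (h z z') z'') F1'" for z
      using filter_leD[OF F1'(1) that] by eventually_elim (use h_agree in blast)
    then show ?thesis by (simp add: G'_def eventually_filter_bind)
  qed
  moreover have "G \<le> filtermap y F" unfolding G_def by (rule filtermap_mono[OF F1(1)])
  moreover have "complete_filter \<chi> G'"
    unfolding G'_def by (rule complete_filter_bind[OF F1(2) F1'(2)])
  ultimately show thesis using that G by blast
qed

text \<open>With at most \<chi> classes, one of them is positive for the filter and can be used to
  restrict it.\<close>

lemma refine_eqv_class:
  assumes F: "complete_filter \<chi> F" and classes: "|range (eqv_class \<A> \<beta> n)| \<le>o \<chi>"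
  obtains z G where "complete_filter \<chi> G" "G \<le> F" "eventually (eqv \<A> \<beta> n z) G"
proof -
  obtain c where c: "c \<in> range (eqv_class \<A> \<beta> n)" "\<not> eventually (\<lambda>x. eqv_class \<A> \<beta> n x \<noteq> c) F"
    using complete_filter_pigeonhole[OF F classes, of "eqv_class \<A> \<beta> n"] by auto
  then obtain z where z: "c = eqv_class \<A> \<beta> n z" by blast
  have "eqv_class \<A> \<beta> n x \<noteq> c \<longleftrightarrow> x \<notin> {x. eqv \<A> \<beta> n z x}" for x
    unfolding z by (subst eq_commute) (simp add: eqv_class_eq)
  with c(2) have "\<not> eventually (\<lambda>x. x \<notin> {x. eqv \<A> \<beta> n z x}) F" by simp
  then have "complete_filter \<chi> (inf F (principal {x. eqv \<A> \<beta> n z x}))"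
    by (rule complete_filter_restrict[OF F])
  moreover have "eventually (eqv \<A> \<beta> n z) (inf F (principal {x. eqv \<A> \<beta> n z x}))"
    by (simp add: eventually_inf_principal)
  ultimately show thesis using that inf_le1 by blast
qed

text \<open>Invariant sets that are not groups are reached through moves. Once each filter is
  concentrated on one class, \<open>S\<close> separates these classes, so a base set or a move does.
  A base set is an invariant group. A move is copied by \<open>same_type_extend\<close>, and the
  induction hypothesis applies at the lower rank with the class of the extension in place of
  \<open>S\<close>.\<close>

lemma same_type_eqv:
  fixes \<A> :: "'o::wellorder \<Rightarrow> ('o \<Rightarrow> 'm::ab_group_add) set set" and \<beta> :: "'g::wellorder"
  assumes inf: "Cinfinite \<mu>" "Cinfinite \<chi>" and exp: "\<chi> ^c \<mu> \<le>o \<chi>" and le: "cardSuc \<mu> \<le>o \<chi>"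
    and \<A>: "\<And>n S. S \<in> \<A> n \<Longrightarrow> subgrp S"
    and grps: "\<And>\<delta> n. \<delta> < \<gamma> \<Longrightarrow> |eqv_grps \<A> (\<delta>::'g) n| \<le>o \<mu>"
    and classes: "\<And>\<delta> n. \<delta> < \<gamma> \<Longrightarrow> |range (eqv_class \<A> (\<delta>::'g) n)| \<le>o \<chi>"
    and "\<beta> < \<gamma>" "complete_filter \<chi> F" "complete_filter \<chi> F'" "same_type \<A> \<beta> n F F'"
    and "eqv_closed \<A> \<beta> n S" "eventually (\<lambda>z. z \<in> S) F" "eventually (\<lambda>z. z \<notin> S) F'"
  shows False
  using assms(8-)
proof (induction \<beta> arbitrary: n F F' S rule: less_induct)
  case (less \<beta>)
  obtain z G where G: "complete_filter \<chi> G" "G \<le> F" "eventually (\<lambda>x. eqv \<A> \<beta> n z x) G"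
    using refine_eqv_class[OF less.prems(2) classes[OF less.prems(1)]] .
  obtain z' G' where G': "complete_filter \<chi> G'" "G' \<le> F'" "eventually (\<lambda>x. eqv \<A> \<beta> n z' x) G'"
    using refine_eqv_class[OF less.prems(3) classes[OF less.prems(1)]] .
  have same: "same_type \<A> \<beta> n G G'" by (rule same_type_mono[OF less.prems(4) G(2) G'(2)])
  \<comment> \<open>Filters and points are generalized here, so that exchanging the two sides also
    covers a failing move from \<open>z'\<close>.\<close>
  have no_forth: False
    if G: "complete_filter \<chi> G" "eventually (\<lambda>x. eqv \<A> \<beta> n z x) G"
      and G': "complete_filter \<chi> G'" "eventually (\<lambda>x. eqv \<A> \<beta> n z' x) G'"
      and same: "same_type \<A> \<beta> n G G'" and \<delta>: "\<delta> < \<beta>" "n \<le> n'"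
      and z1: "agree n z1 z" and no: "\<And>z1'. agree n z1' z' \<Longrightarrow> \<not> eqv \<A> \<delta> n' z1 z1'"
    for G G' z z' \<delta> n' z1
  proof -
    \<comment> \<open>Points equivalent to \<open>z\<close> answer the move \<open>z1\<close> by an
      extension in its class; choosing one answer for each gives the extension that is to be
      copied.\<close>
    define y where "y x = (if eqv \<A> \<beta> n z x then SOME u. agree n u x \<and> eqv \<A> \<delta> n' z1 u else x)" for x
    have y: "agree n (y x) x \<and> eqv \<A> \<delta> n' z1 (y x)" if "eqv \<A> \<beta> n z x" for x
    proof -
      have "\<exists>u. agree n u x \<and> eqv \<A> \<delta> n' z1 u" using eqv_forth[OF that \<delta> z1] by blast
      from someI_ex[OF this] that show ?thesis by (simp add: y_def)
    qed
    then have y_agree: "agree n (y x) x" for x by (cases "eqv \<A> \<beta> n z x") (auto simp: y_def)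
    have \<delta>\<gamma>: "\<delta> < \<gamma>" using \<delta>(1) less.prems(1) by simp
    obtain H H' where H: "complete_filter \<chi> H" "complete_filter \<chi> H'" "same_type \<A> \<delta> n' H H'"
      "H \<le> filtermap y G" "\<And>P. eventually P G' \<Longrightarrow> eventually (\<lambda>g. \<exists>z'. P z' \<and> agree n g z') H'"
      by (rule same_type_extend[OF inf exp le G(1) G'(1) same \<delta> grps[OF \<delta>\<gamma>] y_agree])
        (rule that)
    have "eventually (\<lambda>x. x \<in> eqv_class \<A> \<delta> n' z1) (filtermap y G)"
      using G(2) unfolding eventually_filtermap eqv_class_def
      by eventually_elim (use y in blast)
    then have 1: "eventually (\<lambda>x. x \<in> eqv_class \<A> \<delta> n' z1) H" by (rule filter_leD[OF H(4)])
    have 2: "eventually (\<lambda>x. x \<notin> eqv_class \<A> \<delta> n' z1) H'"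
      using H(5)[OF G'(2)]
    proof eventually_elim
      case (elim g)
      \<comment> \<open>Were \<open>g\<close> equivalent to \<open>z1\<close>, then moving from
        \<open>x\<close> back to \<open>z'\<close> would turn \<open>g\<close> into an extension of
        \<open>z'\<close> equivalent to \<open>z1\<close>, which does not exist.\<close>
      then obtain x where x: "eqv \<A> \<beta> n z' x" "agree n g x" by blast
      show ?case
      proof
        assume "g \<in> eqv_class \<A> \<delta> n' z1"
        then have "eqv \<A> \<delta> n' z1 g" by (simp add: eqv_class_def)
        moreover obtain u where "agree n u z'" "eqv \<A> \<delta> n' g u"
          using eqv_forth[OF eqv_sym[OF x(1)] \<delta> x(2)] .
        ultimately show False using no eqv_trans by blast
      qed
    qed
    show False by (rule less.IH[OF \<delta>(1) \<delta>\<gamma> H(1,2,3) eqv_closed_class 1 2])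
  qed
  have "z \<in> S"
  proof -
    have "eventually (\<lambda>x. eqv \<A> \<beta> n z x \<and> x \<in> S) G"
      using G(3) filter_leD[OF G(2) less.prems(6)] by eventually_elim simp
    from complete_filter_ex[OF G(1) this] obtain x where "eqv \<A> \<beta> n z x" "x \<in> S" by blast
    then show ?thesis using less.prems(5) eqv_sym unfolding eqv_closed_def by blast
  qed
  have "z' \<notin> S"
  proof -
    have "eventually (\<lambda>x. eqv \<A> \<beta> n z' x \<and> x \<notin> S) G'"
      using G'(3) filter_leD[OF G'(2) less.prems(7)] by eventually_elim simp
    from complete_filter_ex[OF G'(1) this] obtain x where "eqv \<A> \<beta> n z' x" "x \<notin> S" by blast
    then show ?thesis using less.prems(5) unfolding eqv_closed_def by blast
  qed
  with \<open>z \<in> S\<close> have "\<not> eqv \<A> \<beta> n z z'" using less.prems(5) unfolding eqv_closed_def by blast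
  then consider (base) T where "T \<in> \<A> n" "z \<in> T \<longleftrightarrow> z' \<notin> T"
    | (fwd) \<delta> n' where "\<delta> < \<beta>" "n \<le> n'" "\<not> ext_sim n (eqv \<A> \<delta> n') z z'"
    | (bwd) \<delta> n' where "\<delta> < \<beta>" "n \<le> n'" "\<not> ext_sim n (\<lambda>x y. eqv \<A> \<delta> n' y x) z' z"
    unfolding eqv_iff[of \<A> \<beta>] by blast
  then show False
  proof cases
    case base
    have ev: "eventually (\<lambda>x. x \<in> T \<longleftrightarrow> z \<in> T) G" "eventually (\<lambda>x. x \<in> T \<longleftrightarrow> z' \<in> T) G'"
      by (rule eventually_mono[OF G(3)], use eqv_base[of \<A> \<beta> n _ _ T, OF _ base(1)] in blast)
        (rule eventually_mono[OF G'(3)], use eqv_base[of \<A> \<beta> n _ _ T, OF _ base(1)] in blast)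
    \<comment> \<open>A base set is itself an invariant group, so \<open>same_type\<close> applies
      to its coset through 0.\<close>
    have "T \<in> eqv_grps \<A> \<beta> n"
      using \<A>[OF base(1)] eqv_base[of \<A> \<beta> n _ _ T, OF _ base(1)] unfolding eqv_grps_def eqv_closed_def by blast
    with same have "(eventually (\<lambda>z. z - 0 \<in> T) G \<and> eventually (\<lambda>z. z - 0 \<in> T) G') \<or>
     (eventually (\<lambda>z. z - 0 \<notin> T) G \<and> eventually (\<lambda>z. z - 0 \<notin> T) G')"
      unfolding same_type_def by blast
    then show False
    proof
      assume "eventually (\<lambda>z. z - 0 \<in> T) G \<and> eventually (\<lambda>z. z - 0 \<in> T) G'"
      then have "eventually (\<lambda>x. (x \<in> T \<longleftrightarrow> z \<in> T) \<and> x \<in> T) G" "eventually (\<lambda>x. (x \<in> T \<longleftrightarrow> z' \<in> T) \<and> x \<in> T) G'"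
        using ev by (simp_all add: eventually_conj_iff)
      then show False
        using complete_filter_ex[OF G(1)] complete_filter_ex[OF G'(1)] base(2) by blast
    next
      assume "eventually (\<lambda>z. z - 0 \<notin> T) G \<and> eventually (\<lambda>z. z - 0 \<notin> T) G'"
      then have "eventually (\<lambda>x. (x \<in> T \<longleftrightarrow> z \<in> T) \<and> x \<notin> T) G" "eventually (\<lambda>x. (x \<in> T \<longleftrightarrow> z' \<in> T) \<and> x \<notin> T) G'"
        using ev by (simp_all add: eventually_conj_iff)
      then show False
        using complete_filter_ex[OF G(1)] complete_filter_ex[OF G'(1)] base(2) by blast
    qed
  next
    case fwd
    then obtain z1 where "agree n z1 z" "\<And>z1'. agree n z1' z' \<Longrightarrow> \<not> eqv \<A> \<delta> n' z1 z1'"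
      unfolding ext_sim_def by blast
    then show False by (rule no_forth[OF G(1,3) G'(1,3) same fwd(1,2)])
  next
    case bwd
    then obtain z1 where z1: "agree n z1 z'" "\<And>z1'. agree n z1' z \<Longrightarrow> \<not> eqv \<A> \<delta> n' z1' z1"
      unfolding ext_sim_def by blast
    show False
      by (rule no_forth[OF G'(1,3) G(1,3) same_type_sym[OF same] bwd(1,2) z1(1)])
        (use z1(2) eqv_sym in blast)
  qed
qed

text \<open>On the field of \<open>cardSuc \<chi>\<close> the sets of size at most \<chi> are
  exactly the bounded ones, whence the name.\<close>

definition cobounded :: "'c rel \<Rightarrow> 'x set \<Rightarrow> 'x filter" where
  "cobounded \<chi> X = Abs_filter (\<lambda>P. |{x \<in> X. \<not> P x}| \<le>o \<chi>)"

lemma eventually_cobounded: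
  assumes "Cinfinite \<chi>"
  shows "eventually P (cobounded \<chi> X) \<longleftrightarrow> |{x \<in> X. \<not> P x}| \<le>o \<chi>"
  unfolding cobounded_def
proof (rule eventually_Abs_filter, rule is_filter.intro)
  show "|{x \<in> X. \<not> True}| \<le>o \<chi>" using assms by (simp add: card_of_empty1)
next
  fix P Q assume "|{x \<in> X. \<not> P x}| \<le>o \<chi>" "|{x \<in> X. \<not> Q x}| \<le>o \<chi>"
  then have "|{x \<in> X. \<not> P x} \<union> {x \<in> X. \<not> Q x}| \<le>o \<chi>"
    by (rule Un_Cinfinite_bound[OF _ _ assms])
  moreover have "{x \<in> X. \<not> (P x \<and> Q x)} = {x \<in> X. \<not> P x} \<union> {x \<in> X. \<not> Q x}" by blast
  ultimately show "|{x \<in> X. \<not> (P x \<and> Q x)}| \<le>o \<chi>" by simp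
next
  fix P Q assume "\<forall>x. P x \<longrightarrow> Q x" and P: "|{x \<in> X. \<not> P x}| \<le>o \<chi>"
  then have "{x \<in> X. \<not> Q x} \<subseteq> {x \<in> X. \<not> P x}" by blast
  then show "|{x \<in> X. \<not> Q x}| \<le>o \<chi>" by (rule ordLeq_transitive[OF card_of_mono1 P])
qed

lemma complete_filter_cobounded:
  assumes inf: "Cinfinite \<chi>" and X: "\<not> |X| \<le>o \<chi>"
  shows "complete_filter \<chi> (cobounded \<chi> X)"
proof (rule complete_filterI)
  show "\<not> eventually (\<lambda>x. False) (cobounded \<chi> X)" using X by (simp add: eventually_cobounded[OF inf])
next
  fix \<P> assume P: "|\<P>| \<le>o \<chi>" "\<And>P. P \<in> \<P> \<Longrightarrow> eventually P (cobounded \<chi> X)"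
  have "|\<Union>P\<in>\<P>. {x \<in> X. \<not> P x}| \<le>o \<chi>"
    by (rule UNION_Cinfinite_bound[OF P(1) _ inf]) (use P(2) in \<open>simp add: eventually_cobounded[OF inf]\<close>)
  moreover have "{x \<in> X. \<not> (\<forall>P\<in>\<P>. P x)} = (\<Union>P\<in>\<P>. {x \<in> X. \<not> P x})" by blast
  ultimately show "eventually (\<lambda>x. \<forall>P\<in>\<P>. P x) (cobounded \<chi> X)"
    by (simp add: eventually_cobounded[OF inf])
qed

section \<open>Iterated limits of sums along one filter, and the contradiction from a long
  order\<close>

lemma decides_mono: "decides F H \<Longrightarrow> F' \<le> F \<Longrightarrow> decides F' H"
  unfolding decides_def by (meson filter_leD)

text \<open>If \<open>g\<close> avoids all cosets, then translation by the fixed \<open>f x\<close>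
  does not change this. Otherwise \<open>g\<close>, being decided, is almost constant modulo
  \<open>H\<close>, and the avoidance comes from \<open>f\<close>.\<close>

lemma eventually_sum_avoids:
  assumes H: "subgrp H" and f: "decides (filtermap f F) H" and g: "decides (filtermap g F) H"
    and avoid: "(\<forall>c. eventually (\<lambda>x. f x - c \<notin> H) F) \<or> (\<forall>c. eventually (\<lambda>x. g x - c \<notin> H) F)"
  shows "eventually (\<lambda>x. eventually (\<lambda>y. f x + g y - c \<notin> H) F) F"
proof (cases "\<forall>c. eventually (\<lambda>x. g x - c \<notin> H) F")
  case True
  then have "eventually (\<lambda>y. g y - (c - f x) \<notin> H) F" for x by blast
  then have "eventually (\<lambda>y. f x + g y - c \<notin> H) F" for x by (simp add: algebra_simps)
  then show ?thesis by simp
next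
  case False
  then obtain q where "\<not> eventually (\<lambda>x. g x - q \<notin> H) F" by blast
  then have q: "eventually (\<lambda>x. g x - q \<in> H) F"
    using g by (auto simp: decides_def eventually_filtermap)
  have "eventually (\<lambda>x. f x - (c - q) \<notin> H) F" using avoid False by blast
  then show ?thesis
  proof eventually_elim
    case (elim x)
    show ?case using q
    proof eventually_elim
      case (elim y)
      then have "(f x + g y - c) - (f x - (c - q)) \<in> H" by (simp add: algebra_simps)
      with \<open>f x - (c - q) \<notin> H\<close> show ?case using subgrp_diff_cancel[OF H] by blast
    qed
  qed
qed

text \<open>Modulo \<open>H\<close> there are two cases. If \<open>u\<close> and \<open>v\<close>
  are both almost constant, then so are both sums, with the same value. Otherwise one of them avoids
  all cosets, and then so do both sums.\<close>

lemma same_type_sum: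
  fixes u v :: "'x \<Rightarrow> 'o::wellorder \<Rightarrow> 'm::ab_group_add"
  assumes u: "\<And>H. H \<in> eqv_grps \<A> \<beta> n \<Longrightarrow> decides (filtermap u F) H"
    and v: "\<And>H. H \<in> eqv_grps \<A> \<beta> n \<Longrightarrow> decides (filtermap v F) H"
  shows "same_type \<A> \<beta> n (filter_bind (\<lambda>x y. u x + v y) F F) (filter_bind (\<lambda>x y. u y + v x) F F)"
  unfolding same_type_def eventually_filter_bind
proof (intro ballI allI)
  fix H c assume H: "H \<in> eqv_grps \<A> \<beta> n"
  then have sH: "subgrp H" by (simp add: eqv_grps_def)
  let ?G = "\<lambda>P. eventually (\<lambda>x. eventually (\<lambda>y. P (u x + v y - c)) F) F"
  let ?G' = "\<lambda>P. eventually (\<lambda>x. eventually (\<lambda>y. P (u y + v x - c)) F) F"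
  show "(?G (\<lambda>g. g \<in> H) \<and> ?G' (\<lambda>g. g \<in> H)) \<or> (?G (\<lambda>g. g \<notin> H) \<and> ?G' (\<lambda>g. g \<notin> H))"
  proof (cases "(\<forall>c. eventually (\<lambda>x. u x - c \<notin> H) F) \<or> (\<forall>c. eventually (\<lambda>x. v x - c \<notin> H) F)")
    case True
    then have "?G (\<lambda>g. g \<notin> H)" by (rule eventually_sum_avoids[OF sH u[OF H] v[OF H]])
    moreover have "eventually (\<lambda>x. eventually (\<lambda>y. v x + u y - c \<notin> H) F) F"
      by (rule eventually_sum_avoids[OF sH v[OF H] u[OF H]]) (use True in blast)
    ultimately show ?thesis by (simp add: add.commute)
  next
    case False
    then obtain p q where "\<not> eventually (\<lambda>x. u x - p \<notin> H) F" "\<not> eventually (\<lambda>x. v x - q \<notin> H) F" by blast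
    then have p: "eventually (\<lambda>x. u x - p \<in> H) F" and q: "eventually (\<lambda>x. v x - q \<in> H) F"
      using u[OF H] v[OF H] by (auto simp: decides_def eventually_filtermap)
    have *: "u x + v y - c \<in> H \<longleftrightarrow> p + q - c \<in> H" if "u x - p \<in> H" "v y - q \<in> H" for x y
    proof (rule subgrp_diff_cancel[OF sH])
      show "u x + v y - c - (p + q - c) \<in> H"
        using subgrp_add[OF sH that] by (simp add: algebra_simps)
    qed
    have 1: "eventually (\<lambda>x. eventually (\<lambda>y. u x + v y - c \<in> H \<longleftrightarrow> p + q - c \<in> H) F) F"
      using p
    proof eventually_elim
      case (elim x)
      from q show ?case by eventually_elim (use elim * in blast)
    qed
    have 2: "eventually (\<lambda>x. eventually (\<lambda>y. u y + v x - c \<in> H \<longleftrightarrow> p + q - c \<in> H) F) F"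
      using q
    proof eventually_elim
      case (elim x)
      from p show ?case by eventually_elim (use elim * in blast)
    qed
    show ?thesis using 1 2 by (cases "p + q - c \<in> H") simp_all
  qed
qed

text \<open>The order is given in the split form \<open>u x + v y\<close>, so that exchanging
  \<open>x\<close> and \<open>y\<close> exchanges two iterated limits along one filter. The index
  set is the field of \<open>cardSuc \<chi>\<close>, which is too large for \<chi>, so its cobounded
  filter is proper.\<close>

lemma no_long_order:
  fixes \<A> :: "'o::wellorder \<Rightarrow> ('o \<Rightarrow> 'm::ab_group_add) set set" and \<gamma> :: "'g::wellorder"
    and u v :: "'c set \<Rightarrow> 'o \<Rightarrow> 'm" and \<chi> :: "'c rel"
  assumes inf: "Cinfinite \<mu>" "Cinfinite \<chi>" and exp: "\<chi> ^c \<mu> \<le>o \<chi>" and le: "cardSuc \<mu> \<le>o \<chi>"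
    and \<A>: "\<And>n S. S \<in> \<A> n \<Longrightarrow> subgrp S"
    and grps: "\<And>n. |\<Union>\<delta>\<in>{..<\<gamma>}. eqv_grps \<A> \<delta> n| \<le>o \<mu>"
    and classes: "\<And>\<delta> n. \<delta> \<le> \<gamma> \<Longrightarrow> |range (eqv_class \<A> \<delta> n)| \<le>o \<chi>"
    and S: "\<And>z z'. (\<And>\<delta>. \<delta> < \<gamma> \<Longrightarrow> eqv \<A> \<delta> n z z') \<Longrightarrow> z \<in> S \<Longrightarrow> z' \<in> S"
    and ord: "\<And>x y. (x, y) \<in> cardSuc \<chi> \<Longrightarrow> x \<noteq> y \<Longrightarrow> u x + v y \<in> S \<and> u y + v x \<notin> S"
  shows False
proof -
  let ?r = "cardSuc \<chi>"
  have r: "Card_order ?r" "Well_order ?r" using inf(2) by (simp_all add: cardSuc_Card_order cardSuc_Well_order)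
  have "\<not> |Field ?r| \<le>o \<chi>"
  proof
    assume "|Field ?r| \<le>o \<chi>"
    then have "?r \<le>o \<chi>"
      using ordIso_ordLeq_trans[OF ordIso_symmetric[OF card_of_Field_ordIso[OF r(1)]]] by blast
    with cardSuc_greater[of \<chi>] inf(2) not_ordLess_ordLeq show False by blast
  qed
  define F0 where "F0 = cobounded \<chi> (Field ?r)"
  have F0: "complete_filter \<chi> F0"
    unfolding F0_def by (rule complete_filter_cobounded[OF inf(2)]) fact
  have evF: "eventually (\<lambda>x. x \<in> Field ?r) F0"
    unfolding F0_def eventually_cobounded[OF inf(2)] using inf(2) by (simp add: card_of_empty1)
  \<comment> \<open>Proper initial segments of \<open>cardSuc \<chi>\<close> have size at most
    \<chi>, so almost every index comes after \<open>x\<close>.\<close>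
  have evr: "eventually (\<lambda>y. (x, y) \<in> ?r \<and> x \<noteq> y) F0" if x: "x \<in> Field ?r" for x
  proof -
    have "{y \<in> Field ?r. \<not> ((x, y) \<in> ?r \<and> x \<noteq> y)} \<subseteq> {x} \<union> underS ?r x"
    proof
      fix y assume "y \<in> {y \<in> Field ?r. \<not> ((x, y) \<in> ?r \<and> x \<noteq> y)}"
      then have y: "y \<in> Field ?r" "(x, y) \<notin> ?r \<or> x = y" by auto
      have "total_on (Field ?r) ?r" using r(2) by (simp add: well_order_on_def linear_order_on_def)
      then have "x = y \<or> (y, x) \<in> ?r" using x y unfolding total_on_def by blast
      then show "y \<in> {x} \<union> underS ?r x" by (auto simp: underS_def)
    qed
    moreover have "|{x} \<union> underS ?r x| \<le>o \<chi>"
    proof (rule Un_Cinfinite_bound[OF card_of_singleton_le_Cinfinite[OF inf(2)] _ inf(2)])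
      show "|underS ?r x| \<le>o \<chi>"
        using card_of_underS[OF r(1) x] cardSuc_ordLeq_ordLess[of \<chi> "|underS ?r x|"] inf(2)
        by (simp add: card_of_Card_order)
    qed
    ultimately show ?thesis unfolding F0_def eventually_cobounded[OF inf(2)]
      by (rule ordLeq_transitive[OF card_of_mono1])
  qed
  define \<Psi> where "\<Psi> = (\<Union>\<delta>\<in>{..<\<gamma>}. eqv_grps \<A> \<delta> n)"
  have sub: "subgrp H" if "H \<in> \<Psi>" for H using that by (auto simp: \<Psi>_def eqv_grps_def)
  have \<Psi>: "|\<Psi>| \<le>o \<mu>" unfolding \<Psi>_def by (rule grps)
  obtain F1 where F1: "F1 \<le> F0" "complete_filter \<chi> F1" "\<And>H. H \<in> \<Psi> \<Longrightarrow> decides (filtermap u F1) H"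
    using refine_decides[OF F0 inf exp le \<Psi> sub] by metis
  obtain F where F: "F \<le> F1" "complete_filter \<chi> F" "\<And>H. H \<in> \<Psi> \<Longrightarrow> decides (filtermap v F) H"
    using refine_decides[OF F1(2) inf exp le \<Psi> sub] by metis
  have FF0: "F \<le> F0" using F(1) F1(1) by (rule order_trans)
  define G where "G = filter_bind (\<lambda>x y. u x + v y) F F"
  define G' where "G' = filter_bind (\<lambda>x y. u y + v x) F F"
  have G: "complete_filter \<chi> G" "complete_filter \<chi> G'"
    unfolding G_def G'_def by (rule complete_filter_bind[OF F(2) F(2)])+
  have same: "same_type \<A> \<delta> n G G'" if "\<delta> < \<gamma>" for \<delta>
    unfolding G_def G'_def
  proof (rule same_type_sum)
    fix H assume "H \<in> eqv_grps \<A> \<delta> n"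
    then have H: "H \<in> \<Psi>" using that by (auto simp: \<Psi>_def)
    show "decides (filtermap u F) H" by (rule decides_mono[OF F1(3)[OF H] filtermap_mono[OF F(1)]])
    show "decides (filtermap v F) H" by (rule F(3)[OF H])
  qed
  have "eventually (\<lambda>x. eventually (\<lambda>y. u x + v y \<in> S \<and> u y + v x \<notin> S) F) F"
    using filter_leD[OF FF0 evF]
  proof eventually_elim
    case (elim x)
    show ?case using filter_leD[OF FF0 evr[OF elim]] by eventually_elim (use ord in blast)
  qed
  then have evS: "eventually (\<lambda>z. z \<in> S) G" "eventually (\<lambda>z. z \<notin> S) G'"
    unfolding G_def G'_def eventually_filter_bind by (simp_all add: eventually_conj_iff)
  \<comment> \<open>\<open>S\<close> is invariant under agreement at all ranks below \<gamma>
    together, not necessarily at a single one. Concentrating on classes of rank \<gamma> fixes the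
    class at every lower rank, so \<open>S\<close> forces \<open>z\<close> and \<open>z'\<close>
    apart at some one \<delta> < \<gamma>.\<close>
  obtain z X where X: "complete_filter \<chi> X" "X \<le> G" "eventually (eqv \<A> \<gamma> n z) X"
    using refine_eqv_class[OF G(1) classes[OF order_refl]] .
  obtain z' X' where X': "complete_filter \<chi> X'" "X' \<le> G'" "eventually (eqv \<A> \<gamma> n z') X'"
    using refine_eqv_class[OF G(2) classes[OF order_refl]] .
  have "\<exists>\<delta><\<gamma>. \<not> eqv \<A> \<delta> n z z'"
  proof (rule ccontr)
    assume "\<not> ?thesis"
    then have eq: "eqv \<A> \<delta> n z z'" if "\<delta> < \<gamma>" for \<delta> using that by blast
    have "eventually (\<lambda>x. eqv \<A> \<gamma> n z x \<and> x \<in> S) X"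
      using X(3) filter_leD[OF X(2) evS(1)] by eventually_elim simp
    from complete_filter_ex[OF X(1) this] obtain x where x: "eqv \<A> \<gamma> n z x" "x \<in> S" by blast
    have "eventually (\<lambda>x. eqv \<A> \<gamma> n z' x \<and> x \<notin> S) X'"
      using X'(3) filter_leD[OF X'(2) evS(2)] by eventually_elim simp
    from complete_filter_ex[OF X'(1) this] obtain x' where x': "eqv \<A> \<gamma> n z' x'" "x' \<notin> S" by blast
    have "eqv \<A> \<delta> n x x'" if "\<delta> < \<gamma>" for \<delta>
    proof -
      have "eqv \<A> \<delta> n x z" using eqv_sym[OF eqv_mono[OF x(1)]] that by simp
      moreover have "eqv \<A> \<delta> n z' x'" using eqv_mono[OF x'(1)] that by simp
      ultimately show ?thesis using eqv_trans eq[OF that] by blast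
    qed
    then show False using S[of x x'] x(2) x'(2) by blast
  qed
  then obtain \<delta> where \<delta>: "\<delta> < \<gamma>" "\<not> eqv \<A> \<delta> n z z'" by blast
  show False
  proof (rule same_type_eqv[OF inf exp le])
    show "subgrp S'" if "S' \<in> \<A> n'" for n' S' by (rule \<A>[OF that])
    show "|eqv_grps \<A> \<delta>' n'| \<le>o \<mu>" if "\<delta>' < \<gamma>" for \<delta>' n'
      by (rule ordLeq_transitive[OF card_of_mono1 grps]) (use that in auto)
    show "|range (eqv_class \<A> \<delta>' n')| \<le>o \<chi>" if "\<delta>' < \<gamma>" for \<delta>' n'
      using classes[of \<delta>'] that by simp
    show "\<delta> < \<gamma>" by fact
    show "same_type \<A> \<delta> n X X'" by (rule same_type_mono[OF same[OF \<delta>(1)] X(2) X'(2)])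
    show "eqv_closed \<A> \<delta> n (eqv_class \<A> \<delta> n z)" by (rule eqv_closed_class)
    show "eventually (\<lambda>x. x \<in> eqv_class \<A> \<delta> n z) X"
      using X(3)
    proof eventually_elim
      case (elim x)
      then show ?case using eqv_mono[OF elim] \<delta>(1) by (simp add: eqv_class_def)
    qed
    show "eventually (\<lambda>x. x \<notin> eqv_class \<A> \<delta> n z) X'"
      using X'(3)
    proof eventually_elim
      case (elim x)
      have "eqv \<A> \<delta> n x z'" using eqv_sym[OF eqv_mono[OF elim]] \<delta>(1) by simp
      then show ?case using \<delta>(2) eqv_trans[of \<A> \<delta> n z x z'] by (auto simp: eqv_class_def)
    qed
  qed (rule X(1), rule X'(1))
qed

section \<open>Counting equivalence classes\<close>

lemma card_of_image_factor:
  assumes "\<And>x y. x \<in> X \<Longrightarrow> y \<in> X \<Longrightarrow> g x = g y \<Longrightarrow> f x = f y"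
  shows "|f ` X| \<le>o |g ` X|"
proof (rule surj_imp_ordLeq)
  define h where "h c = (SOME x. x \<in> X \<and> g x = c)" for c
  have h: "h (g x) \<in> X \<and> g (h (g x)) = g x" if "x \<in> X" for x
    unfolding h_def by (rule someI[of _ x]) (simp add: that)
  show "f ` X \<subseteq> (\<lambda>c. f (h c)) ` (g ` X)"
  proof
    fix y assume "y \<in> f ` X"
    then obtain x where x: "x \<in> X" "y = f x" by blast
    then have "y = f (h (g x))" using assms[of x "h (g x)"] h[OF x(1)] by simp
    with x(1) show "y \<in> (\<lambda>c. f (h c)) ` (g ` X)" by simp
  qed
qed

lemma Cinfinite_ctwo_cexp: "Cinfinite c \<Longrightarrow> Cinfinite (ctwo ^c c)"
  by (rule Cinfinite_cexp[OF ordLeq_refl[OF Card_order_ctwo]])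

lemma ordLeq_ctwo_cexp: "Card_order c \<Longrightarrow> c \<le>o ctwo ^c c"
  by (rule ordLess_imp_ordLeq[OF ordLess_ctwo_cexp])

lemma card_of_Pow_le:
  assumes "|A| \<le>o c" "Cinfinite c"
  shows "|Pow A| \<le>o ctwo ^c c"
proof (cases "A = {}")
  case True
  then show ?thesis
    using card_of_singleton_le_Cinfinite[OF Cinfinite_ctwo_cexp[OF assms(2)]] by simp
next
  case False
  have "|Func A (UNIV :: bool set)| \<le>o ctwo ^c c"
    by (rule card_of_Func_le_cexp[OF _ assms(1) False]) (simp add: ctwo_def card_of_mono1)
  then show ?thesis by (rule ordIso_ordLeq_trans[OF card_of_Pow_Func])
qed

lemma card_of_Times_le: "|A| \<le>o c \<Longrightarrow> |B| \<le>o c \<Longrightarrow> Cinfinite c \<Longrightarrow> |A \<times> B| \<le>o c"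
  by (rule card_of_Times_ordLeq_infinite_Field) (auto simp: cinfinite_def)

text \<open>All contexts are counted at once, because moves from one context lead to arbitrary
  larger ones.\<close>

definition all_classes :: "('o::wellorder \<Rightarrow> ('o \<Rightarrow> 'm) set set) \<Rightarrow> 'g::wellorder \<Rightarrow> ('o \<times> ('o \<Rightarrow> 'm) set) set" where
  "all_classes \<A> \<beta> = (\<lambda>(n, z). (n, eqv_class \<A> \<beta> n z)) ` UNIV"

text \<open>As with Hintikka formulas, a class is determined by its context, its base sets and the
  set of lower-rank classes that its extensions reach. The last two are subsets of sets of size at
  most \<open>c\<close>.\<close>

lemma card_of_all_classes:
  fixes \<A> :: "'o::wellorder \<Rightarrow> ('o \<Rightarrow> 'm) set set" and \<beta> :: "'g::wellorder"
  assumes inf: "Cinfinite c" and o: "|UNIV :: 'o set| \<le>o c" and \<A>: "\<And>n. |\<A> n| \<le>o c"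
    and \<beta>: "|{..<\<beta>}| \<le>o c" and less: "\<And>\<delta>. \<delta> < \<beta> \<Longrightarrow> |all_classes \<A> \<delta>| \<le>o c"
  shows "|all_classes \<A> \<beta>| \<le>o ctwo ^c c"
proof -
  let ?c = "ctwo ^c c"
  note inf2 = Cinfinite_ctwo_cexp[OF inf]
  define ext where "ext n z = {(\<delta>, n', C). \<delta> < \<beta> \<and> n \<le> n' \<and> (\<exists>z1. agree n z1 z \<and> C = eqv_class \<A> \<delta> n' z1)}"
    for n z
  define base where "base n z = {S \<in> \<A> n. z \<in> S}" for n z
  define code where "code = (\<lambda>(n, z). (n, base n z, ext n z))"
  have same: "eqv \<A> \<beta> n z z'" if eq: "base n z = base n z'" "ext n z = ext n z'" for n z z'
  proof -
    have sim: "\<exists>y1. agree n y1 y \<and> eqv \<A> \<delta> n' x1 y1"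
      if "ext n x = ext n y" "\<delta> < \<beta>" "n \<le> n'" "agree n x1 x" for x y \<delta> n' x1
    proof -
      have "(\<delta>, n', eqv_class \<A> \<delta> n' x1) \<in> ext n x" using that(2-4) by (auto simp: ext_def)
      then have "(\<delta>, n', eqv_class \<A> \<delta> n' x1) \<in> ext n y" by (simp only: that(1))
      then obtain y1 where "agree n y1 y" "eqv_class \<A> \<delta> n' x1 = eqv_class \<A> \<delta> n' y1"
        by (auto simp: ext_def)
      then show ?thesis unfolding eqv_class_eq by blast
    qed
    have "\<forall>S\<in>\<A> n. z \<in> S \<longleftrightarrow> z' \<in> S" using eq(1) by (auto simp: base_def)
    moreover have "ext_sim n (eqv \<A> \<delta> n') z z'" if d: "\<delta> < \<beta>" "n \<le> n'" for \<delta> n'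
      unfolding ext_sim_def using sim[OF eq(2) d] by simp
    moreover have "ext_sim n (\<lambda>x y. eqv \<A> \<delta> n' y x) z' z" if d: "\<delta> < \<beta>" "n \<le> n'" for \<delta> n'
    proof (rule ext_sim_mono[OF _ eqv_sym])
      show "ext_sim n (eqv \<A> \<delta> n') z' z"
        unfolding ext_sim_def using sim[OF eq(2)[symmetric] d] by simp
    qed
    ultimately show ?thesis by (subst eqv_iff) simp
  qed
  have "|all_classes \<A> \<beta>| \<le>o |range code|"
    unfolding all_classes_def
  proof (rule card_of_image_factor)
    fix p q assume eq: "code p = code q"
    obtain n z n' z' where pq: "p = (n, z)" "q = (n', z')" by (cases p, cases q)
    with eq have "n = n'" "base n z = base n z'" "ext n z = ext n z'" by (auto simp: code_def)
    then show "(\<lambda>(n, z). (n, eqv_class \<A> \<beta> n z)) p = (\<lambda>(n, z). (n, eqv_class \<A> \<beta> n z)) q"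
      using same[of n z z'] pq by (simp add: eqv_class_eq)
  qed
  moreover have "|range code| \<le>o ?c"
  proof -
    let ?U = "\<Union>\<delta>\<in>{..<\<beta>}. all_classes \<A> \<delta>"
    have le: "c \<le>o ?c" using inf by (simp add: ordLeq_ctwo_cexp)
    have "|\<Union>n. Pow (\<A> n)| \<le>o ?c"
      by (rule UNION_Cinfinite_bound[OF ordLeq_transitive[OF o le] _ inf2])
        (use card_of_Pow_le[OF \<A> inf] in blast)
    moreover have "|?U| \<le>o c"
      by (rule UNION_Cinfinite_bound[OF \<beta> _ inf]) (use less in simp)
    then have "|{..<\<beta>} \<times> ?U| \<le>o c" by (rule card_of_Times_le[OF \<beta> _ inf])
    then have "|Pow ({..<\<beta>} \<times> ?U)| \<le>o ?c" by (rule card_of_Pow_le[OF _ inf])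
    ultimately have "|(UNIV :: 'o set) \<times> (\<Union>n. Pow (\<A> n)) \<times> Pow ({..<\<beta>} \<times> ?U)| \<le>o ?c"
      by (intro card_of_Times_le[OF ordLeq_transitive[OF o le] _ inf2] card_of_Times_le[OF _ _ inf2])
    moreover have sub: "range code \<subseteq> (UNIV :: 'o set) \<times> (\<Union>n. Pow (\<A> n)) \<times> Pow ({..<\<beta>} \<times> ?U)"
    proof
      fix x assume "x \<in> range code"
      then obtain n z where "x = code (n, z)" by auto
      moreover have "(n', eqv_class \<A> \<delta> n' z1) \<in> all_classes \<A> \<delta>" for n' \<delta> z1
        by (auto simp: all_classes_def)
      ultimately show "x \<in> UNIV \<times> (\<Union>n. Pow (\<A> n)) \<times> Pow ({..<\<beta>} \<times> ?U)"
        by (auto simp: code_def base_def ext_def)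
    qed
    ultimately show ?thesis by (intro ordLeq_transitive[OF card_of_mono1[OF sub]])
  qed
  ultimately show ?thesis by (rule ordLeq_transitive)
qed

lemma card_of_eqv_class_le: "|range (eqv_class \<A> \<beta> n)| \<le>o |all_classes \<A> \<beta>|"
proof (rule surj_imp_ordLeq)
  have "(n, eqv_class \<A> \<beta> n z) \<in> all_classes \<A> \<beta>" for z by (auto simp: all_classes_def)
  then show "range (eqv_class \<A> \<beta> n) \<subseteq> snd ` all_classes \<A> \<beta>" by force
qed

text \<open>An invariant group is a union of classes, which costs one exponential beyond the number
  of classes.\<close>

lemma card_of_eqv_grps:
  assumes "Cinfinite c" "|all_classes \<A> \<beta>| \<le>o c"
  shows "|eqv_grps \<A> \<beta> n| \<le>o ctwo ^c c"
proof -
  have "|eqv_grps \<A> \<beta> n| \<le>o |Pow (range (eqv_class \<A> \<beta> n))|"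
  proof (rule surj_imp_ordLeq)
    show "eqv_grps \<A> \<beta> n \<subseteq> Union ` Pow (range (eqv_class \<A> \<beta> n))"
    proof
      fix H assume "H \<in> eqv_grps \<A> \<beta> n"
      then have cl: "eqv_closed \<A> \<beta> n H" by (simp add: eqv_grps_def)
      have "H = \<Union>(eqv_class \<A> \<beta> n ` H)"
      proof
        show "H \<subseteq> \<Union>(eqv_class \<A> \<beta> n ` H)" by (auto simp: eqv_class_def eqv_refl)
        show "\<Union>(eqv_class \<A> \<beta> n ` H) \<subseteq> H" using cl by (auto simp: eqv_class_def eqv_closed_def)
      qed
      moreover have "eqv_class \<A> \<beta> n ` H \<in> Pow (range (eqv_class \<A> \<beta> n))" by blast
      ultimately show "H \<in> Union ` Pow (range (eqv_class \<A> \<beta> n))" by (rule image_eqI)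
    qed
  qed
  moreover have "|Pow (range (eqv_class \<A> \<beta> n))| \<le>o ctwo ^c c"
    by (rule card_of_Pow_le[OF ordLeq_transitive[OF card_of_eqv_class_le assms(2)] assms(1)])
  ultimately show ?thesis by (rule ordLeq_transitive)
qed

section \<open>Successors and beth numbers\<close>

definition osuc :: "'g::wellorder \<Rightarrow> 'g" where
  "osuc \<beta> = (LEAST c. \<beta> < c)"

lemma osuc_le: "\<beta> < c \<Longrightarrow> osuc \<beta> \<le> c"
  unfolding osuc_def by (rule Least_le)

text \<open>The element \<open>c\<close> witnesses that \<beta> is not the largest element of the
  type; without it the \<open>LEAST\<close> in \<open>osuc\<close> is unspecified.\<close>

lemma less_osuc: "\<beta> < c \<Longrightarrow> \<beta> < osuc \<beta>"
  unfolding osuc_def by (rule LeastI)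

lemma suc_of_osuc: "\<beta> < c \<Longrightarrow> suc_of \<beta> (osuc \<beta>)"
  by (auto simp: suc_of_def less_osuc osuc_le)

lemma osuc_less_limit:
  assumes "is_limit \<gamma>" "\<beta> < \<gamma>"
  shows "osuc \<beta> < \<gamma>"
proof -
  obtain c where "\<beta> < c" "c < \<gamma>" using assms by (auto simp: is_limit_def)
  then show ?thesis using osuc_le by (metis le_less_trans)
qed

lemma osuc_mono: "\<delta> < \<beta> \<Longrightarrow> \<beta> < c \<Longrightarrow> osuc \<delta> < osuc \<beta>"
  using osuc_le[of \<delta> \<beta>] less_osuc[of \<beta> c] by simp

lemma is_beth_mono:
  assumes b: "is_beth \<mu> \<gamma> b" and "\<beta> \<le> \<alpha>" "\<alpha> \<le> \<gamma>"
  shows "b \<beta> \<le>o b \<alpha>"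
  using assms(2,3)
proof (induction \<alpha> rule: less_induct)
  case (less \<alpha>)
  have card: "Card_order (b x)" if "x \<le> \<gamma>" for x using b that by (simp add: is_beth_def)
  show ?case
  proof (cases "\<beta> = \<alpha>")
    case True
    then show ?thesis using card less.prems by (simp add: ordLeq_refl)
  next
    case False
    then have \<beta>: "\<beta> < \<alpha>" using less.prems by simp
    show ?thesis
    proof (cases "is_limit \<alpha>")
      case True
      then show ?thesis using b \<beta> less.prems by (simp add: is_beth_def)
    next
      case False
      have "\<alpha> \<noteq> ozero" using \<beta> using not_less_Least[of \<beta> "\<lambda>_. True"] by (auto simp: ozero_def)
      then obtain \<delta> where \<delta>: "\<delta> < \<alpha>" "\<forall>c. \<not> (\<delta> < c \<and> c < \<alpha>)"
        using False unfolding is_limit_def by blast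
      then have "suc_of \<delta> \<alpha>" unfolding suc_of_def by (meson not_le)
      then have eq: "b \<alpha> =o ctwo ^c b \<delta>" using b less.prems(2) unfolding is_beth_def by blast
      have "\<beta> \<le> \<delta>" using \<beta> \<delta>(2) by (meson not_le)
      then have "b \<beta> \<le>o b \<delta>" using less.IH[of \<delta>] \<delta>(1) less.prems(2) by simp
      moreover have "b \<delta> \<le>o ctwo ^c b \<delta>"
        using card[of \<delta>] \<delta>(1) less.prems(2) by (simp add: ordLeq_ctwo_cexp)
      ultimately have "b \<beta> \<le>o ctwo ^c b \<delta>" by (rule ordLeq_transitive)
      then show ?thesis by (rule ordLeq_ordIso_trans[OF _ ordIso_symmetric[OF eq]])
    qed
  qed
qed

lemma is_beth_osuc:
  assumes b: "is_beth \<mu> \<gamma> b" and "\<beta> < \<gamma>"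
  shows "ctwo ^c b \<beta> \<le>o b (osuc \<beta>)"
proof -
  have "b (osuc \<beta>) =o ctwo ^c b \<beta>"
    using b suc_of_osuc[OF assms(2)] osuc_le[OF assms(2)] unfolding is_beth_def by blast
  then show ?thesis using ordIso_symmetric ordIso_imp_ordLeq by blast
qed

lemma is_beth_strict:
  assumes b: "is_beth \<mu> \<gamma> b" and "\<beta> < \<alpha>" "\<alpha> \<le> \<gamma>"
  shows "b \<beta> <o b \<alpha>"
proof -
  have "Card_order (b \<beta>)" using b assms(2,3) by (simp add: is_beth_def)
  then have "b \<beta> <o ctwo ^c b \<beta>" by (rule ordLess_ctwo_cexp)
  moreover have "ctwo ^c b \<beta> \<le>o b (osuc \<beta>)" using is_beth_osuc[OF b] assms(2,3) by simp
  moreover have "b (osuc \<beta>) \<le>o b \<alpha>" by (rule is_beth_mono[OF b osuc_le[OF assms(2)] assms(3)])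
  ultimately show ?thesis using ordLess_ordLeq_trans[OF ordLess_ordLeq_trans] by blast
qed

text \<open>Beth numbers increase strictly, so each \<open>b \<delta>\<close> with \<delta> <
  \<alpha> is isomorphic to a proper initial segment of \<open>b \<alpha>\<close>, and the points
  \<open>f \<delta>\<close> that cut off these segments are distinct.\<close>

lemma is_beth_card_lessThan:
  assumes b: "is_beth \<mu> \<gamma> b" and "\<alpha> \<le> \<gamma>"
  shows "|{..<\<alpha>}| \<le>o b \<alpha>"
proof -
  have card: "Card_order (b x)" if "x \<le> \<gamma>" for x using b that by (simp add: is_beth_def)
  have wo: "Well_order (b x)" if "x \<le> \<gamma>" for x using card[OF that] by (simp add: card_order_on_def)
  have "\<forall>\<delta>\<in>{..<\<alpha>}. \<exists>x\<in>Field (b \<alpha>). b \<delta> =o Restr (b \<alpha>) (underS (b \<alpha>) x)"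
  proof
    fix \<delta> assume \<delta>: "\<delta> \<in> {..<\<alpha>}"
    then have "b \<delta> <o b \<alpha>" using is_beth_strict[OF b _ assms(2)] by simp
    then show "\<exists>x\<in>Field (b \<alpha>). b \<delta> =o Restr (b \<alpha>) (underS (b \<alpha>) x)"
      using ordLess_iff_ordIso_Restr[OF wo[OF assms(2)] wo[of \<delta>]] \<delta> assms(2) by simp
  qed
  then obtain f where f: "\<And>\<delta>. \<delta> < \<alpha> \<Longrightarrow> f \<delta> \<in> Field (b \<alpha>)"
    "\<And>\<delta>. \<delta> < \<alpha> \<Longrightarrow> b \<delta> =o Restr (b \<alpha>) (underS (b \<alpha>) (f \<delta>))" by (metis lessThan_iff)
  have ne: "f \<delta> \<noteq> f \<delta>'" if "\<delta> < \<delta>'" "\<delta>' < \<alpha>" for \<delta> \<delta>'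
  proof
    assume eq: "f \<delta> = f \<delta>'"
    have "b \<delta> =o b \<delta>'"
      using ordIso_transitive[OF f(2)[of \<delta>, unfolded eq] ordIso_symmetric[OF f(2)[of \<delta>']]] that by simp
    moreover have "b \<delta> <o b \<delta>'" using is_beth_strict[OF b that(1)] that(2) assms(2) by simp
    ultimately show False using not_ordLess_ordIso by blast
  qed
  have "inj_on f {..<\<alpha>}"
  proof (rule inj_onI)
    fix x y assume "x \<in> {..<\<alpha>}" "y \<in> {..<\<alpha>}" "f x = f y"
    then show "x = y" using ne[of x y] ne[of y x] by (metis lessThan_iff neq_iff)
  qed
  then have "|{..<\<alpha>}| \<le>o |Field (b \<alpha>)|"
    using f(1) by (intro card_of_ordLeqI[of f]) auto
  then show ?thesis by (rule ordLeq_ordIso_trans[OF _ card_of_Field_ordIso[OF card[OF assms(2)]]])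
qed

text \<open>Each rank costs one exponential: for \<delta> < \<beta> three successors of \<delta> are
  at most two successors of \<beta>, and the third successor of \<beta> pays for the power set. The
  constant shift leaves room for base families of size 2^\<mu> and is absorbed by the limit
  \<gamma>.\<close>

lemma is_beth_card_classes:
  fixes \<A> :: "'o::wellorder \<Rightarrow> ('o \<Rightarrow> 'm) set set" and \<gamma> :: "'g::wellorder"
  assumes b: "is_beth \<mu> \<gamma> b" and inf: "Cinfinite \<mu>" and lim: "is_limit \<gamma>"
    and o: "|UNIV :: 'o set| \<le>o \<mu>" and \<A>: "\<And>n. |\<A> n| \<le>o ctwo ^c \<mu>"
    and "\<beta> < \<gamma>"
  shows "|all_classes \<A> \<beta>| \<le>o b (osuc (osuc (osuc \<beta>)))"
  using assms(6)
proof (induction \<beta> rule: less_induct)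
  case (less \<beta>)
  let ?s = "osuc (osuc \<beta>)"
  have s: "osuc \<beta> < \<gamma>" "?s < \<gamma>" using osuc_less_limit[OF lim] less.prems by blast+
  have card: "Card_order (b x)" if "x \<le> \<gamma>" for x using b that by (simp add: is_beth_def)
  have oz: "ozero \<le> x" for x :: 'g unfolding ozero_def by (simp add: Least_le)
  have bz: "b ozero =o \<mu>" using b by (simp add: is_beth_def)
  have ls: "\<beta> < ?s" using less_osuc[OF less.prems] less_osuc[OF s(1)] by simp
  have \<mu>s: "\<mu> \<le>o b x" if "x \<le> \<gamma>" for x
    by (rule ordIso_ordLeq_trans[OF ordIso_symmetric[OF bz] is_beth_mono[OF b oz that]])
  have infs: "Cinfinite (b x)" if "x \<le> \<gamma>" for x
    using cinfinite_mono[OF \<mu>s[OF that]] inf card[OF that] by simp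
  have "|all_classes \<A> \<beta>| \<le>o ctwo ^c b ?s"
  proof (rule card_of_all_classes)
    show "Cinfinite (b ?s)" using infs s by simp
    show "|UNIV :: 'o set| \<le>o b ?s" by (rule ordLeq_transitive[OF o \<mu>s]) (use s in simp)
    show "|\<A> n| \<le>o b ?s" for n
    proof -
      have "ctwo ^c \<mu> \<le>o ctwo ^c b \<beta>"
        by (rule cexp_mono2_Cnotzero[OF \<mu>s Card_order_ctwo Cinfinite_Cnotzero[OF inf]])
          (use less.prems in simp)
      moreover have "ctwo ^c b \<beta> \<le>o b (osuc \<beta>)" by (rule is_beth_osuc[OF b less.prems])
      moreover have "b (osuc \<beta>) \<le>o b ?s"
        by (rule is_beth_mono[OF b]) (use less_osuc[OF s(1)] s in auto)
      ultimately show ?thesis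
        using ordLeq_transitive[OF ordLeq_transitive[OF ordLeq_transitive[OF \<A>[of n]]]] by blast
    qed
    have "b \<beta> \<le>o b ?s" by (rule is_beth_mono[OF b]) (use ls s in auto)
    then show "|{..<\<beta>}| \<le>o b ?s"
      by (rule ordLeq_transitive[OF is_beth_card_lessThan[OF b less_imp_le[OF less.prems]]])
    show "|all_classes \<A> \<delta>| \<le>o b ?s" if d: "\<delta> < \<beta>" for \<delta>
    proof -
      have "|all_classes \<A> \<delta>| \<le>o b (osuc (osuc (osuc \<delta>)))" using less.IH[OF d] d less.prems by simp
      moreover have "b (osuc (osuc (osuc \<delta>))) \<le>o b ?s"
      proof (rule is_beth_mono[OF b])
        have 1: "osuc \<delta> < osuc \<beta>" by (rule osuc_mono[OF d less.prems])
        have 2: "osuc (osuc \<delta>) < osuc (osuc \<beta>)" by (rule osuc_mono[OF 1 s(1)])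
        show "osuc (osuc (osuc \<delta>)) \<le> ?s" by (rule osuc_le[OF 2])
        show "?s \<le> \<gamma>" using s by simp
      qed
      ultimately show ?thesis by (rule ordLeq_transitive)
    qed
  qed
  moreover have "ctwo ^c b ?s \<le>o b (osuc ?s)" by (rule is_beth_osuc[OF b s(2)])
  ultimately show ?case by (rule ordLeq_transitive)
qed

section \<open>Ordinal addition and satisfaction\<close>

lemma ozero_le [simp]: "ozero \<le> (a :: 'g::wellorder)"
  unfolding ozero_def by (simp add: Least_le)

lemma not_less_ozero [simp]: "\<not> (a :: 'g::wellorder) < ozero"
  by (simp add: not_less)

text \<open>What is used of a regular infinite \<theta>: it has no largest element, and no proper
  initial segment is mapped cofinally into it. Consequently the sums in \<open>oadd\<close>
  exist.\<close>

locale ord_type =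
  fixes dummy :: "'o::wellorder itself"
  assumes unbounded: "\<exists>c > (a::'o). True"
    and bounded: "\<exists>c. \<forall>i<b. (f :: 'o \<Rightarrow> 'o) i < c"
begin

lemma ozero_less_oone: "ozero < (oone::'o)"
  unfolding oone_def using unbounded[of ozero] by (auto intro: LeastI)

lemma less_oone_iff: "(a::'o) < oone \<longleftrightarrow> a = ozero"
proof
  assume "a < oone"
  then have "\<not> ozero < a" unfolding oone_def by (rule not_less_Least)
  then show "a = ozero" using ozero_le[of a] by (simp add: order_less_le)
qed (simp add: ozero_less_oone)

lemma oadd_bounds: "(a::'o) \<le> oadd a b \<and> (\<forall>b'. b' < b \<longrightarrow> oadd a b' < oadd a b)"
proof -
  obtain c where c: "\<forall>i<b. oadd a i < c" using bounded[of b "oadd a"] by blast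
  then have "a \<le> max a c \<and> (\<forall>b'. b' < b \<longrightarrow> oadd a b' < max a c)" by (auto simp: less_max_iff_disj)
  from LeastI[of "\<lambda>c. a \<le> c \<and> (\<forall>b'. b' < b \<longrightarrow> oadd a b' < c)", OF this]
  show ?thesis by (subst (1 3) oadd.simps)
qed

lemma le_oadd: "(a::'o) \<le> oadd a b"
  and oadd_less: "b' < b \<Longrightarrow> oadd (a::'o) b' < oadd a b"
  using oadd_bounds by blast+

lemma oadd_le: "(a::'o) \<le> c \<Longrightarrow> (\<And>b'. b' < b \<Longrightarrow> oadd a b' < c) \<Longrightarrow> oadd a b \<le> c"
  by (subst oadd.simps) (auto intro: Least_le)

lemma oadd_less_iff: "oadd (a::'o) b < oadd a c \<longleftrightarrow> b < c"
  using oadd_less[of b c a] oadd_less[of c b a] by (cases b c rule: linorder_cases) auto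

lemma oadd_eq_iff: "oadd (a::'o) b = oadd a c \<longleftrightarrow> b = c"
  using oadd_less[of b c a] oadd_less[of c b a] by (cases b c rule: linorder_cases) auto

lemma oadd_cases:
  assumes "i < oadd (a::'o) b"
  obtains "i < a" | j where "j < b" "i = oadd a j"
proof (cases "i < a")
  case False
  \<comment> \<open>Ordinal subtraction: minimality of \<open>j\<close> gives the reverse inequality
    \<open>oadd a j \<le> i\<close> by \<open>oadd_le\<close>.\<close>
  define j where "j = (LEAST j. i \<le> oadd a j)"
  have j: "i \<le> oadd a j" "j \<le> b"
    unfolding j_def using assms LeastI[of "\<lambda>j. i \<le> oadd a j" b] Least_le[of "\<lambda>j. i \<le> oadd a j" b] by auto
  have "oadd a j \<le> i"
  proof (rule oadd_le)
    show "oadd a j' < i" if "j' < j" for j'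
      using not_less_Least[of j' "\<lambda>j. i \<le> oadd a j"] that unfolding j_def by simp
  qed (use False in simp)
  then have "i = oadd a j" using j(1) by simp
  moreover have "j < b" using j(2) assms \<open>i = oadd a j\<close> by (auto simp: order_less_le)
  ultimately show thesis using that by blast
qed (use that in blast)

lemma cat_left: "i < (\<epsilon>::'o) \<Longrightarrow> cat \<epsilon> a \<zeta> b i = a i"
  using le_oadd[of \<epsilon> \<zeta>] by (auto simp: cat_def)

lemma cat_right: "j < (\<zeta>::'o) \<Longrightarrow> cat \<epsilon> a \<zeta> b (oadd \<epsilon> j) = b j"
  using le_oadd[of \<epsilon> j] by (auto simp: cat_def oadd_less_iff oadd_eq_iff)

lemma cat_cong: "agree (n::'o) a a' \<Longrightarrow> cat n a \<zeta> b = cat n a' \<zeta> b"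
  by (auto simp: cat_def restrict_def fun_eq_iff)

lemma cat_extensional: "cat \<epsilon> a \<zeta> b \<in> extensional {..<oadd (\<epsilon>::'o) \<zeta>}"
  by (simp add: cat_def)

lemma agree_catI:
  assumes "agree (\<epsilon>::'o) z a" "\<And>j. j < \<zeta> \<Longrightarrow> z (oadd \<epsilon> j) = b j"
  shows "agree (oadd \<epsilon> \<zeta>) z (cat \<epsilon> a \<zeta> b)"
proof (intro allI impI)
  fix i assume "i < oadd \<epsilon> \<zeta>"
  then show "z i = cat \<epsilon> a \<zeta> b i"
    by (cases rule: oadd_cases) (use assms in \<open>auto simp: cat_left cat_right\<close>)
qed

section \<open>Satisfaction in a context and its invariance under back-and-forth equivalence\<close>

lemma eval_agree:
  assumes "wf_trm \<tau> (n::'o) t" "agree n a a'"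
  shows "eval \<tau> M a t = eval \<tau> M a' t"
  using assms(1)
proof (induction t)
  case (Fun f ts)
  then have "eval \<tau> M a (ts i) = eval \<tau> M a' (ts i)" if "i < farity \<tau> f" for i using that by auto
  moreover from this have "(\<lambda>i\<in>{..<farity \<tau> f}. the (eval \<tau> M a (ts i))) =
      (\<lambda>i\<in>{..<farity \<tau> f}. the (eval \<tau> M a' (ts i)))"
    by (intro restrict_ext) auto
  moreover have "(\<forall>i<farity \<tau> f. eval \<tau> M a (ts i) \<noteq> None) \<longleftrightarrow> (\<forall>i<farity \<tau> f. eval \<tau> M a' (ts i) \<noteq> None)"
    using calculation(1) by simp
  ultimately show ?case by (simp only: eval.simps)
qed (use assms(2) in auto)

lemma sat_agree:
  assumes "wf_fm \<tau> \<phi> (n::'o)" "agree n a a'"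
  shows "sat \<tau> M \<phi> n a \<longleftrightarrow> sat \<tau> M \<phi> n a'"
  using assms
proof (induction \<phi> arbitrary: n a a')
  case (Eq s t)
  then show ?case using eval_agree[of \<tau> n _ a a' M] by auto
next
  case (Rel P ts)
  then have "eval \<tau> M a (ts i) = eval \<tau> M a' (ts i)" if "i < rarity \<tau> P" for i
    using that eval_agree[of \<tau> n _ a a' M] by auto
  moreover from this have "(\<lambda>i\<in>{..<rarity \<tau> P}. the (eval \<tau> M a (ts i))) =
      (\<lambda>i\<in>{..<rarity \<tau> P}. the (eval \<tau> M a' (ts i)))"
    by (intro restrict_ext) auto
  ultimately show ?case by simp
next
  case (Conj I \<Phi>)
  then have "sat \<tau> M (\<Phi> i) n a \<longleftrightarrow> sat \<tau> M (\<Phi> i) n a'" if "i \<in> I" for i using that by auto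
  then show ?case by simp
next
  case (Disj I \<Phi>)
  then have "sat \<tau> M (\<Phi> i) n a \<longleftrightarrow> sat \<tau> M (\<Phi> i) n a'" if "i \<in> I" for i using that by auto
  then show ?case by simp
next
  case (Ex \<zeta> \<phi>)
  then show ?case using cat_cong[of n a a'] by simp
next
  case (All \<zeta> \<phi>)
  then show ?case using cat_cong[of n a a'] by simp
next
  case (Neg \<phi>)
  then show ?case by auto
qed

text \<open>The semantics of quantifiers appends an extensional block, whereas the comparison of
  filters extends total assignments; this translates between the two. The Boolean \<open>c\<close>
  lets one proof serve \<open>Ex\<close> (with True) and \<open>All\<close> (with False).\<close>

lemma sat_ex_seqs:
  assumes "wf_fm \<tau> \<phi> (oadd (n::'o) \<zeta>)"
  shows "(\<exists>b\<in>seqs \<zeta> UNIV. sat \<tau> M \<phi> (oadd n \<zeta>) (cat n a \<zeta> b) = c) \<longleftrightarrow>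
    (\<exists>a1. agree n a1 a \<and> sat \<tau> M \<phi> (oadd n \<zeta>) a1 = c)"
proof
  assume "\<exists>b\<in>seqs \<zeta> UNIV. sat \<tau> M \<phi> (oadd n \<zeta>) (cat n a \<zeta> b) = c"
  then obtain b where "sat \<tau> M \<phi> (oadd n \<zeta>) (cat n a \<zeta> b) = c" by blast
  moreover have "agree n (cat n a \<zeta> b) a" by (simp add: cat_left)
  ultimately show "\<exists>a1. agree n a1 a \<and> sat \<tau> M \<phi> (oadd n \<zeta>) a1 = c" by blast
next
  assume "\<exists>a1. agree n a1 a \<and> sat \<tau> M \<phi> (oadd n \<zeta>) a1 = c"
  then obtain a1 where a1: "agree n a1 a" "sat \<tau> M \<phi> (oadd n \<zeta>) a1 = c" by blast
  define b where "b = (\<lambda>j\<in>{..<\<zeta>}. a1 (oadd n j))"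
  have "agree (oadd n \<zeta>) a1 (cat n a \<zeta> b)"
    by (rule agree_catI[OF a1(1)]) (simp add: b_def)
  from sat_agree[OF assms this] a1(2) have "sat \<tau> M \<phi> (oadd n \<zeta>) (cat n a \<zeta> b) = c"
    by simp
  moreover have "b \<in> seqs \<zeta> UNIV" by (simp add: b_def)
  ultimately show "\<exists>b\<in>seqs \<zeta> UNIV. sat \<tau> M \<phi> (oadd n \<zeta>) (cat n a \<zeta> b) = c" by blast
qed

lemma sat_Ex:
  assumes "wf_fm \<tau> \<phi> (oadd (n::'o) \<zeta>)"
  shows "sat \<tau> M (Ex \<zeta> \<phi>) n a \<longleftrightarrow> (\<exists>a1. agree n a1 a \<and> sat \<tau> M \<phi> (oadd n \<zeta>) a1)"
  using sat_ex_seqs[OF assms, of M a True] by simp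

lemma sat_All:
  assumes "wf_fm \<tau> \<phi> (oadd (n::'o) \<zeta>)"
  shows "sat \<tau> M (All \<zeta> \<phi>) n a \<longleftrightarrow> (\<forall>a1. agree n a1 a \<longrightarrow> sat \<tau> M \<phi> (oadd n \<zeta>) a1)"
  using sat_ex_seqs[OF assms, of M a False] by auto

text \<open>The base family for \<open>eqv\<close>. The \<open>itself\<close> argument fixes the
  index type of the formulas, which is not visible in the resulting sets.\<close>

definition atomic_sets :: "('f, 'p, 'o, 'i) fm itself \<Rightarrow> ('f, 'p, 'o) vocab \<Rightarrow> ('f, 'p, 'o, 'm::ab_group_add) struct \<Rightarrow>
    'o \<Rightarrow> ('o \<Rightarrow> 'm) set set" where
  "atomic_sets _ \<tau> M n = (\<lambda>\<phi>. {z. sat \<tau> M \<phi> n z}) ` (atomic_fms \<tau> n :: ('f, 'p, 'o, 'i) fm set)"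

text \<open>A quantifier uses up one move, whose block of length \<zeta> leads from context
  \<open>n\<close> to \<open>oadd n \<zeta>\<close>. Conjunctions and disjunctions of any size cost
  no rank.\<close>

lemma eqv_sat:
  fixes \<phi> :: "('f, 'p, 'o, 'i) fm"
  assumes "wf_fm \<tau> \<phi> n" "qd_le \<phi> \<beta>"
    "eqv (atomic_sets TYPE(('f, 'p, 'o, 'i) fm) \<tau> M) \<beta> n z z'"
  shows "sat \<tau> M \<phi> n z \<longleftrightarrow> sat \<tau> M \<phi> n z'"
  using assms
proof (induction \<phi> arbitrary: n \<beta> z z')
  case (Eq s t)
  then have "Eq s t \<in> (atomic_fms \<tau> n :: ('f, 'p, 'o, 'i) fm set)" by (auto simp: atomic_fms_def)
  then have "{z. sat \<tau> M (Eq s t :: ('f, 'p, 'o, 'i) fm) n z} \<in> atomic_sets TYPE(('f, 'p, 'o, 'i) fm) \<tau> M n"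
    unfolding atomic_sets_def by (rule imageI)
  from eqv_base[OF Eq.prems(3) this] show ?case unfolding mem_Collect_eq .
next
  case (Rel P ts)
  then have "Rel P ts \<in> (atomic_fms \<tau> n :: ('f, 'p, 'o, 'i) fm set)" by (auto simp: atomic_fms_def)
  then have "{z. sat \<tau> M (Rel P ts :: ('f, 'p, 'o, 'i) fm) n z} \<in> atomic_sets TYPE(('f, 'p, 'o, 'i) fm) \<tau> M n"
    unfolding atomic_sets_def by (rule imageI)
  from eqv_base[OF Rel.prems(3) this] show ?case unfolding mem_Collect_eq .
next
  case (Neg \<phi>)
  from Neg.IH[OF _ _ Neg.prems(3)] Neg.prems(1,2) show ?case by simp
next
  case (Conj I \<Phi>)
  have "sat \<tau> M (\<Phi> i) n z \<longleftrightarrow> sat \<tau> M (\<Phi> i) n z'" if "i \<in> I" for i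
    by (rule Conj.IH[OF _ _ _ Conj.prems(3)]) (use Conj.prems(1,2) that in auto)
  then show ?case by simp
next
  case (Disj I \<Phi>)
  have "sat \<tau> M (\<Phi> i) n z \<longleftrightarrow> sat \<tau> M (\<Phi> i) n z'" if "i \<in> I" for i
    by (rule Disj.IH[OF _ _ _ Disj.prems(3)]) (use Disj.prems(1,2) that in auto)
  then show ?case by simp
next
  case (Ex \<zeta> \<phi>)
  from Ex.prems(2) obtain \<delta> where \<delta>: "\<delta> < \<beta>" "qd_le \<phi> \<delta>" by auto
  have wf: "wf_fm \<tau> \<phi> (oadd n \<zeta>)" using Ex.prems(1) by simp
  \<comment> \<open>Proved for arbitrary equivalent points, so that \<open>eqv_sym\<close> supplies
    the converse direction.\<close>
  have half: "\<exists>a1. agree n a1 y \<and> sat \<tau> M \<phi> (oadd n \<zeta>) a1"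
    if xy: "eqv (atomic_sets TYPE(('f, 'p, 'o, 'i) fm) \<tau> M) \<beta> n x y" and x1: "agree n x1 x" "sat \<tau> M \<phi> (oadd n \<zeta>) x1"
    for x y x1
  proof -
    obtain y1 where "agree n y1 y" "eqv (atomic_sets TYPE(('f, 'p, 'o, 'i) fm) \<tau> M) \<delta> (oadd n \<zeta>) x1 y1"
      using eqv_forth[OF xy \<delta>(1) le_oadd x1(1)] .
    then show ?thesis using Ex.IH[OF wf \<delta>(2)] x1(2) by blast
  qed
  show ?case unfolding sat_Ex[OF wf]
    using half[OF Ex.prems(3)] half[OF eqv_sym[OF Ex.prems(3)]] by blast
next
  case (All \<zeta> \<phi>)
  from All.prems(2) obtain \<delta> where \<delta>: "\<delta> < \<beta>" "qd_le \<phi> \<delta>" by auto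
  have wf: "wf_fm \<tau> \<phi> (oadd n \<zeta>)" using All.prems(1) by simp
  have half: "\<exists>a1. agree n a1 y \<and> \<not> sat \<tau> M \<phi> (oadd n \<zeta>) a1"
    if xy: "eqv (atomic_sets TYPE(('f, 'p, 'o, 'i) fm) \<tau> M) \<beta> n x y" and x1: "agree n x1 x" "\<not> sat \<tau> M \<phi> (oadd n \<zeta>) x1"
    for x y x1
  proof -
    obtain y1 where "agree n y1 y" "eqv (atomic_sets TYPE(('f, 'p, 'o, 'i) fm) \<tau> M) \<delta> (oadd n \<zeta>) x1 y1"
      using eqv_forth[OF xy \<delta>(1) le_oadd x1(1)] .
    then show ?thesis using All.IH[OF wf \<delta>(2)] x1(2) by blast
  qed
  show ?case unfolding sat_All[OF wf]
    using half[OF All.prems(3)] half[OF eqv_sym[OF All.prems(3)]] by blast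
qed

end

section \<open>Additive structures\<close>

lemma group_add_group: "group (add_group :: 'm::ab_group_add monoid)"
proof (rule groupI)
  show "\<exists>y\<in>carrier add_group. y \<otimes>\<^bsub>add_group\<^esub> x = \<one>\<^bsub>add_group\<^esub>" for x :: 'm
    by (rule bexI[of _ "- x"]) (simp_all add: add_group_def)
qed (simp_all add: add_group_def add.assoc)

lemma inv_add_group: "inv\<^bsub>add_group\<^esub> x = - (x :: 'm::ab_group_add)"
  by (rule group.inv_equality[OF group_add_group]) (simp_all add: add_group_def)

lemma carrier_add_group: "carrier add_group = UNIV"
  by (simp add: add_group_def)

lemma group_group_power: "group (group_power n)"
  unfolding group_power_def by (simp add: group_add_group)

lemma group_power_simps:
  "carrier (group_power n) = seqs n (UNIV :: 'm::ab_group_add set)"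
  "x \<otimes>\<^bsub>group_power n\<^esub> y = (\<lambda>i\<in>{..<n}. x i + y i)"
  "\<one>\<^bsub>group_power n\<^esub> = zero_seq n"
  by (simp_all add: group_power_def add_group_def zero_seq_def)

lemma inv_group_power: "x \<in> seqs n UNIV \<Longrightarrow> inv\<^bsub>group_power n\<^esub> x = (\<lambda>i\<in>{..<n}. - x i)"
  unfolding group_power_def
  by (subst inv_product_group) (simp_all add: group_add_group inv_add_group carrier_add_group)

lemma subgroup_group_power_iff:
  "subgroup H (group_power n) \<longleftrightarrow>
     H \<subseteq> seqs n UNIV \<and> zero_seq n \<in> H \<and> (\<forall>x\<in>H. \<forall>y\<in>H. seq_diff n x y \<in> H)"
proof
  assume H: "subgroup H (group_power n)"
  have sub: "H \<subseteq> seqs n UNIV" using subgroup.subset[OF H] by (simp add: group_power_simps)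
  moreover have "zero_seq n \<in> H" using subgroup.one_closed[OF H] by (simp add: group_power_simps)
  moreover have "seq_diff n x y \<in> H" if "x \<in> H" "y \<in> H" for x y
  proof -
    have "x \<otimes>\<^bsub>group_power n\<^esub> inv\<^bsub>group_power n\<^esub> y \<in> H"
      using that by (intro subgroup.m_closed[OF H] subgroup.m_inv_closed[OF H])
    also have "x \<otimes>\<^bsub>group_power n\<^esub> inv\<^bsub>group_power n\<^esub> y = seq_diff n x y"
      using that sub by (subst inv_group_power) (auto simp: group_power_simps seq_diff_def fun_eq_iff)
    finally show ?thesis .
  qed
  ultimately show "H \<subseteq> seqs n UNIV \<and> zero_seq n \<in> H \<and> (\<forall>x\<in>H. \<forall>y\<in>H. seq_diff n x y \<in> H)" by blast
next
  assume "H \<subseteq> seqs n UNIV \<and> zero_seq n \<in> H \<and> (\<forall>x\<in>H. \<forall>y\<in>H. seq_diff n x y \<in> H)"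
  then have sub: "H \<subseteq> seqs n UNIV" and zero: "zero_seq n \<in> H"
    and diff: "\<And>x y. x \<in> H \<Longrightarrow> y \<in> H \<Longrightarrow> seq_diff n x y \<in> H" by auto
  have minus: "(\<lambda>i\<in>{..<n}. - x i) \<in> H" if "x \<in> H" for x
  proof -
    have "seq_diff n (zero_seq n) x = (\<lambda>i\<in>{..<n}. - x i)"
      by (auto simp: seq_diff_def zero_seq_def fun_eq_iff)
    then show ?thesis using diff[OF zero that] by simp
  qed
  show "subgroup H (group_power n)"
  proof (rule group.subgroupI[OF group_group_power])
    show "H \<subseteq> carrier (group_power n)" using sub by (simp add: group_power_simps)
    show "H \<noteq> {}" using zero by blast
    show "inv\<^bsub>group_power n\<^esub> x \<in> H" if "x \<in> H" for x
      using minus[OF that] sub that by (simp add: inv_group_power subset_iff)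
    show "x \<otimes>\<^bsub>group_power n\<^esub> y \<in> H" if "x \<in> H" "y \<in> H" for x y
    proof -
      have "seq_diff n x (\<lambda>i\<in>{..<n}. - y i) = x \<otimes>\<^bsub>group_power n\<^esub> y"
        by (auto simp: seq_diff_def group_power_simps fun_eq_iff)
      then show ?thesis using diff[OF that(1) minus[OF that(2)]] by simp
    qed
  qed
qed

context ord_type
begin

lemma cat_singl_inject:
  assumes "s \<in> seqs (n::'o) UNIV" "s' \<in> seqs n UNIV" "agree (oadd n oone) (cat n s oone (singl v)) x"
    "agree n x s'" "x (oadd n ozero) = v'"
  shows "s = s'" "v = v'"
proof -
  have "s i = s' i" if "i < n" for i
    using assms(3,4) that cat_left[OF that, of s oone "singl v"] le_oadd[of n oone] by (metis order_less_le_trans)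
  then show "s = s'" by (intro PiE_ext[OF assms(1,2)]) simp
  have "oadd n ozero < oadd n oone" by (simp add: oadd_less_iff ozero_less_oone)
  then have "cat n s oone (singl v) (oadd n ozero) = v'" using assms(3,5) by simp
  then show "v = v'" by (simp add: cat_right ozero_less_oone singl_def)
qed

text \<open>A partial function whose graph is a subgroup is a homomorphism defined on a subgroup;
  the value sits in the graph at the coordinate \<open>oadd n ozero\<close> after the
  arguments.\<close>

lemma fint_zero_diff:
  fixes M :: "('f, 'p, 'o, 'm::ab_group_add) struct"
  assumes M: "M \<in> additive_structures \<tau>" and f: "f \<in> Funs \<tau>"
  shows "fint M f (zero_seq (farity \<tau> f)) = Some 0"
    and "\<And>s s' v v'. s \<in> seqs (farity \<tau> f) UNIV \<Longrightarrow> s' \<in> seqs (farity \<tau> f) UNIV \<Longrightarrow>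
      fint M f s = Some v \<Longrightarrow> fint M f s' = Some v' \<Longrightarrow>
      fint M f (seq_diff (farity \<tau> f) s s') = Some (v - v')"
proof -
  let ?n = "farity \<tau> f"
  have "subgroup (fgraph \<tau> M f) (group_power (oadd ?n oone))"
    using assms by (simp add: additive_structures_def)
  then have zero: "zero_seq (oadd ?n oone) \<in> fgraph \<tau> M f"
    and diff: "\<And>x y. x \<in> fgraph \<tau> M f \<Longrightarrow> y \<in> fgraph \<tau> M f \<Longrightarrow> seq_diff (oadd ?n oone) x y \<in> fgraph \<tau> M f"
    unfolding subgroup_group_power_iff by auto
  have lt: "i < oadd ?n oone" if "i < ?n" for i using that le_oadd[of ?n oone] by simp
  have lt0: "oadd ?n ozero < oadd ?n oone" by (simp add: oadd_less_iff ozero_less_oone)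
  have val: "fint M f s' = Some v'"
    if X: "X \<in> fgraph \<tau> M f" and s': "s' \<in> seqs ?n UNIV" "agree ?n X s'" "X (oadd ?n ozero) = v'" for X s' v'
  proof -
    obtain s v where s: "X = cat ?n s oone (singl v)" "s \<in> seqs ?n UNIV" "fint M f s = Some v"
      using X by (auto simp: fgraph_def)
    from cat_singl_inject[OF s(2) s'(1) _ s'(2,3)] s(1) have "s = s'" "v = v'" by auto
    with s(3) show ?thesis by simp
  qed
  show "fint M f (zero_seq ?n) = Some 0"
    by (rule val[OF zero]) (simp_all add: zero_seq_def lt lt0)
  show "fint M f (seq_diff ?n s s') = Some (v - v')"
    if s: "s \<in> seqs ?n UNIV" "s' \<in> seqs ?n UNIV" "fint M f s = Some v" "fint M f s' = Some v'" for s s' v v'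
  proof -
    have "cat ?n s oone (singl v) \<in> fgraph \<tau> M f" "cat ?n s' oone (singl v') \<in> fgraph \<tau> M f"
      unfolding fgraph_def using s by blast+
    note X = diff[OF this]
    show ?thesis
      by (rule val[OF X]) (simp_all add: seq_diff_def lt lt0 cat_left cat_right ozero_less_oone singl_def)
  qed
qed

lemma eval_zero:
  assumes M: "M \<in> additive_structures \<tau>" and "wf_trm \<tau> (n::'o) t"
  shows "eval \<tau> M 0 t = Some 0"
  using assms(2)
proof (induction t)
  case (Fun f ts)
  have ev: "eval \<tau> M 0 (ts i) = Some 0" if "i < farity \<tau> f" for i
    by (rule Fun.IH[OF rangeI]) (use Fun.prems that in simp)
  then have "(\<lambda>i\<in>{..<farity \<tau> f}. the (eval \<tau> M 0 (ts i))) = zero_seq (farity \<tau> f)"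
    unfolding zero_seq_def by (intro restrict_ext) simp
  moreover have "\<forall>i<farity \<tau> f. eval \<tau> M 0 (ts i) \<noteq> None" using ev by simp
  moreover have "fint M f (zero_seq (farity \<tau> f)) = Some 0"
    by (rule fint_zero_diff(1)[OF M]) (use Fun.prems in simp)
  ultimately show ?case by (simp only: eval.simps not_False_eq_True simp_thms if_True if_P)
qed auto

text \<open>Terms built from partial homomorphisms are again partial homomorphisms: definedness at
  two points passes to their difference.\<close>

lemma eval_diff:
  assumes M: "M \<in> additive_structures \<tau>" and "wf_trm \<tau> (n::'o) t"
    and "eval \<tau> M z t = Some v" "eval \<tau> M z' t = Some v'"
  shows "eval \<tau> M (z - z') t = Some (v - v')"
  using assms(2-)
proof (induction t arbitrary: v v')
  case (Plus s t)
  then obtain x y x' y' where "eval \<tau> M z s = Some x" "eval \<tau> M z t = Some y" "v = x + y"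
    "eval \<tau> M z' s = Some x'" "eval \<tau> M z' t = Some y'" "v' = x' + y'"
    by (auto split: option.splits)
  then show ?case using Plus.IH Plus.prems(1) by simp
next
  case (Minus s t)
  then obtain x y x' y' where "eval \<tau> M z s = Some x" "eval \<tau> M z t = Some y" "v = x - y"
    "eval \<tau> M z' s = Some x'" "eval \<tau> M z' t = Some y'" "v' = x' - y'"
    by (auto split: option.splits)
  then show ?case using Minus.IH Minus.prems(1) by simp
next
  case (Fun f ts)
  let ?n = "farity \<tau> f"
  define s where "s z = (\<lambda>i\<in>{..<?n}. the (eval \<tau> M z (ts i)))" for z
  have f: "f \<in> Funs \<tau>" using Fun.prems(1) by simp
  have def: "\<forall>i<?n. eval \<tau> M z (ts i) \<noteq> None" "\<forall>i<?n. eval \<tau> M z' (ts i) \<noteq> None"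
    and v: "fint M f (s z) = Some v" "fint M f (s z') = Some v'"
    using Fun.prems(2,3) by (auto simp: s_def split: if_splits)
  have ev: "eval \<tau> M (z - z') (ts i) = Some (s z i - s z' i)" if "i < ?n" for i
  proof (rule Fun.IH)
    show "wf_trm \<tau> n (ts i)" using Fun.prems(1) that by simp
    show "eval \<tau> M z (ts i) = Some (s z i)" "eval \<tau> M z' (ts i) = Some (s z' i)"
      using def that by (auto simp: s_def)
  qed simp
  have "eval \<tau> M (z - z') (Fun f ts) = fint M f (s (z - z'))" using ev by (simp add: s_def)
  also have "s (z - z') = seq_diff ?n (s z) (s z')"
    unfolding s_def[of "z - z'"] seq_diff_def using ev by (intro restrict_ext) simp
  also have "fint M f \<dots> = Some (v - v')"
    by (rule fint_zero_diff(2)[OF M f _ _ v]) (simp_all add: s_def)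
  finally show ?case .
qed auto

lemma subgrp_atomic:
  assumes M: "M \<in> additive_structures \<tau>" and \<phi>: "\<phi> \<in> atomic_fms \<tau> (n::'o)"
  shows "subgrp {z. sat \<tau> M \<phi> n z}"
proof -
  consider (eq) s t where "\<phi> = Eq s t" "wf_trm \<tau> n s" "wf_trm \<tau> n t"
    | (rel) P ts where "\<phi> = Rel P ts" "P \<in> Rels \<tau>" "\<And>i. i < rarity \<tau> P \<Longrightarrow> wf_trm \<tau> n (ts i)"
    using \<phi> by (auto simp: atomic_fms_def)
  then show ?thesis
  proof cases
    case eq
    have "sat \<tau> M \<phi> n (x - y)" if xy: "sat \<tau> M \<phi> n x" "sat \<tau> M \<phi> n y" for x y
    proof -
      obtain v w where "eval \<tau> M x s = Some v" "eval \<tau> M x t = Some v"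
        "eval \<tau> M y s = Some w" "eval \<tau> M y t = Some w" using xy by (auto simp: eq(1))
      then have "eval \<tau> M (x - y) s = Some (v - w)" "eval \<tau> M (x - y) t = Some (v - w)"
        using eval_diff[OF M] eq(2,3) by blast+
      then show ?thesis by (simp add: eq(1))
    qed
    moreover have "sat \<tau> M \<phi> n 0" using eval_zero[OF M] eq by simp
    ultimately show ?thesis by (simp add: subgrp_def)
  next
    case rel
    let ?n = "rarity \<tau> P"
    define s where "s z = (\<lambda>i\<in>{..<?n}. the (eval \<tau> M z (ts i)))" for z
    have sat: "sat \<tau> M \<phi> n z \<longleftrightarrow> (\<forall>i<?n. eval \<tau> M z (ts i) \<noteq> None) \<and> s z \<in> rint M P" for z
      by (simp add: rel(1) s_def)
    have "subgroup (rint M P) (group_power ?n)"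
      using M rel(2) by (simp add: additive_structures_def)
    then have zero: "zero_seq ?n \<in> rint M P"
      and diff: "\<And>x y. x \<in> rint M P \<Longrightarrow> y \<in> rint M P \<Longrightarrow> seq_diff ?n x y \<in> rint M P"
      unfolding subgroup_group_power_iff by auto
    have "sat \<tau> M \<phi> n (x - y)" if xy: "sat \<tau> M \<phi> n x" "sat \<tau> M \<phi> n y" for x y
    proof -
      have ev: "eval \<tau> M (x - y) (ts i) = Some (s x i - s y i)" if "i < ?n" for i
      proof (rule eval_diff[OF M rel(3)[OF that]])
        show "eval \<tau> M x (ts i) = Some (s x i)" "eval \<tau> M y (ts i) = Some (s y i)"
          using xy that by (auto simp: sat s_def)
      qed
      have "s (x - y) = seq_diff ?n (s x) (s y)"
        unfolding s_def[of "x - y"] seq_diff_def using ev by (intro restrict_ext) simp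
      then show ?thesis using ev diff xy by (simp add: sat)
    qed
    moreover have "sat \<tau> M \<phi> n 0"
    proof -
      have ev: "eval \<tau> M 0 (ts i) = Some 0" if "i < ?n" for i by (rule eval_zero[OF M rel(3)[OF that]])
      then have "s 0 = zero_seq ?n" unfolding s_def zero_seq_def by (intro restrict_ext) simp
      then show ?thesis using ev zero by (simp add: sat)
    qed
    ultimately show ?thesis by (simp add: subgrp_def)
  qed
qed

lemma pe_wf:
  assumes "\<And>\<epsilon>. B \<epsilon> \<subseteq> atomic_fms \<tau> (\<epsilon>::'o)" "pe B \<alpha> n \<phi>"
  shows "wf_fm \<tau> \<phi> n"
  using assms(2)
proof induction
  case (pe_zero \<phi> \<epsilon>)
  then have "\<phi> \<in> atomic_fms \<tau> \<epsilon>" using assms(1) by blast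
  then show ?case by (auto simp: atomic_fms_def)
qed auto

text \<open>Conjunctions become intersections and existential quantifiers become projections, and
  both preserve subgroups.\<close>

lemma subgrp_pe:
  assumes M: "M \<in> additive_structures \<tau>" and B: "\<And>\<epsilon>. B \<epsilon> \<subseteq> atomic_fms \<tau> (\<epsilon>::'o)" and "pe B \<alpha> n \<phi>"
  shows "subgrp {z. sat \<tau> M \<phi> n z}"
  using assms(3)
proof induction
  case (pe_zero \<phi> \<epsilon>)
  then show ?case using subgrp_atomic[OF M] B by blast
next
  case (pe_suc_ex \<beta> \<alpha> I \<epsilon> \<zeta> \<Phi>)
  let ?m = "oadd \<epsilon> \<zeta>"
  have wf: "wf_fm \<tau> (Conj I \<Phi>) ?m" using pe_wf[OF B pe_suc_ex(2)] by simp
  have H: "subgrp {z. sat \<tau> M (Conj I \<Phi>) ?m z}"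
    using pe_suc_ex.IH by (auto simp: subgrp_def)
  show ?case
    unfolding subgrp_def mem_Collect_eq sat_Ex[OF wf]
  proof (intro conjI ballI)
    show "\<exists>a1. agree \<epsilon> a1 0 \<and> sat \<tau> M (Conj I \<Phi>) ?m a1"
      using subgrp_zero[OF H] by blast
    fix x y assume "x \<in> {z. \<exists>a1. agree \<epsilon> a1 z \<and> sat \<tau> M (Conj I \<Phi>) ?m a1}"
      "y \<in> {z. \<exists>a1. agree \<epsilon> a1 z \<and> sat \<tau> M (Conj I \<Phi>) ?m a1}"
    then obtain x1 y1 where "agree \<epsilon> x1 x" "sat \<tau> M (Conj I \<Phi>) ?m x1"
      "agree \<epsilon> y1 y" "sat \<tau> M (Conj I \<Phi>) ?m y1" by blast
    then have "agree \<epsilon> (x1 - y1) (x - y)" "sat \<tau> M (Conj I \<Phi>) ?m (x1 - y1)"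
      using subgrp_diff[OF H, of x1 y1] by simp_all
    then show "\<exists>a1. agree \<epsilon> a1 (x - y) \<and> sat \<tau> M (Conj I \<Phi>) ?m a1" by blast
  qed
qed

end

section \<open>Modules and the number of atomic formulas\<close>

context ord_type
begin

lemma cat_eqI:
  assumes "z \<in> extensional {..<oadd (\<epsilon>::'o) \<zeta>}" "agree \<epsilon> z a" "\<And>j. j < \<zeta> \<Longrightarrow> z (oadd \<epsilon> j) = b j"
  shows "z = cat \<epsilon> a \<zeta> b"
  using agree_catI[OF assms(2,3)] assms(1) cat_extensional[of \<epsilon> a \<zeta> b]
  by (auto intro!: extensionalityI[of z "{..<oadd \<epsilon> \<zeta>}"])

lemma seqs_oone: "s \<in> seqs (oone::'o) A \<Longrightarrow> s = singl (s ozero)"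
  by (auto simp: singl_def fun_eq_iff PiE_def extensional_def less_oone_iff restrict_def)

text \<open>Additivity of scalar multiplication makes its graph a subgroup. Together with
  \<open>linear_fms_atomic\<close> this reduces modules to additive structures.\<close>

lemma left_modules_additive:
  fixes R :: "('f, 'b) ring_scheme"
  assumes "M \<in> left_modules R"
  shows "M \<in> (additive_structures (ring_vocab R) :: ('f, 'p, 'o, 'm::ab_group_add) struct set)"
proof -
  have act: "fint M a (singl x) = Some (act M a x)" "act M a (x + y) = act M a x + act M a y"
    if "a \<in> carrier R" for a x y
    using assms that by (auto simp: left_modules_def act_def)
  have "subgroup (fgraph (ring_vocab R) M a) (group_power (oadd oone oone))" if a: "a \<in> carrier R" for a
  proof -
    define g where "g x = cat (oone::'o) (singl x) oone (singl (act M a x))" for x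
    have g: "g x \<in> fgraph (ring_vocab R) M a" for x
      unfolding fgraph_def g_def using act(1)[OF a, of x]
      by (auto simp: ring_vocab_def singl_def intro!: exI[of _ "singl x"])
    have g': "\<exists>x. X = g x" if X: "X \<in> fgraph (ring_vocab R) M a" for X
    proof -
      obtain s v where s: "X = cat oone s oone (singl v)" "s \<in> seqs oone UNIV" "fint M a s = Some v"
        using X by (auto simp: fgraph_def ring_vocab_def)
      then have "s = singl (s ozero)" by (intro seqs_oone)
      then have "v = act M a (s ozero)" using act(1)[OF a, of "s ozero"] s(3) by simp
      then show ?thesis using s(1) \<open>s = singl (s ozero)\<close> unfolding g_def by metis
    qed
    have zero: "act M a 0 = 0" using act(2)[OF a, of 0 0] by simp
    have minus: "act M a (x - y) = act M a x - act M a y" for x y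
      using act(2)[OF a, of "x - y" y] by simp
    have gz: "zero_seq (oadd oone oone) = g 0" unfolding g_def
      by (rule cat_eqI)
        (auto simp: zero_seq_def singl_def zero less_oone_iff le_oadd oadd_less_iff intro: order_less_le_trans[OF ozero_less_oone])
    have gd: "seq_diff (oadd oone oone) (g x) (g y) = g (x - y)" for x y unfolding g_def
    proof (rule cat_eqI)
      show "agree (oone :: 'o) (seq_diff (oadd oone oone) (cat oone (singl x) oone (singl (act M a x)))
          (cat oone (singl y) oone (singl (act M a y)))) (singl (x - y))"
      proof (intro allI impI)
        fix i :: 'o assume i: "i < oone"
        then have "i < oadd oone oone" using le_oadd[of oone oone] by simp
        with i show "seq_diff (oadd oone oone) (cat oone (singl x) oone (singl (act M a x)))
          (cat oone (singl y) oone (singl (act M a y))) i = singl (x - y) i"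
          by (simp add: seq_diff_def cat_left) (simp add: singl_def)
      qed
    qed (auto simp: seq_diff_def oadd_less_iff cat_right singl_def minus)
    show ?thesis
      unfolding subgroup_group_power_iff
    proof (intro conjI ballI)
      show "fgraph (ring_vocab R) M a \<subseteq> seqs (oadd oone oone) UNIV"
      proof
        fix X assume "X \<in> fgraph (ring_vocab R) M a"
        then obtain x where "X = g x" using g' by blast
        then show "X \<in> seqs (oadd oone oone) UNIV"
          using cat_extensional[of oone] by (simp add: g_def PiE_def)
      qed
      show "zero_seq (oadd oone oone) \<in> fgraph (ring_vocab R) M a" using g gz by simp
      fix X Y assume "X \<in> fgraph (ring_vocab R) M a" "Y \<in> fgraph (ring_vocab R) M a"
      then obtain x y where "X = g x" "Y = g y" using g' by blast
      then show "seq_diff (oadd oone oone) X Y \<in> fgraph (ring_vocab R) M a" using gd g by simp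
    qed
  qed
  then show ?thesis by (simp add: additive_structures_def ring_vocab_def)
qed

lemma linear_fms_atomic:
  "linear_fms R (\<epsilon>::'o) \<subseteq> atomic_fms (ring_vocab R) \<epsilon>"
proof
  fix \<phi> assume "\<phi> \<in> linear_fms R \<epsilon>"
  then obtain a where a: "\<phi> = Eq (lin_trm R \<epsilon> a) Zero" "a \<in> seqs \<epsilon> (carrier R)"
    "finite {\<zeta>. \<zeta> < \<epsilon> \<and> a \<zeta> \<noteq> \<zero>\<^bsub>R\<^esub>}" by (auto simp: linear_fms_def)
  have wf: "wf_trm (ring_vocab R) \<epsilon> (foldr (\<lambda>\<zeta> t. Plus (Fun (a \<zeta>) (singl (Var \<zeta>))) t) xs Zero)"
    if "set xs \<subseteq> {..<\<epsilon>}" for xs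
    using that a(2) by (induction xs) (auto simp: ring_vocab_def singl_def less_oone_iff)
  have "wf_trm (ring_vocab R) \<epsilon> (lin_trm R \<epsilon> a)"
    unfolding lin_trm_def by (rule wf) (use a(3) in auto)
  then show "\<phi> \<in> atomic_fms (ring_vocab R) \<epsilon>" by (auto simp: a(1) atomic_fms_def)
qed

end

section \<open>Counting atomic formulas through their syntax trees\<close>

text \<open>
  A term is coded by the labels of its syntax tree at the ends of finite paths: \<open>Inl i\<close> leads to the
  \<open>i\<close>-th argument of a function symbol, \<open>Inr b\<close> to an operand of \<open>+\<close> or \<open>-\<close>.  As \<open>symb\<close> has no tag for
  equality, \<open>fcode\<close> codes \<open>s = t\<close> like \<open>s + t\<close>.
\<close>

primrec tcode :: "('f, 'p, 'o::wellorder) vocab \<Rightarrow> ('f, 'o) trm \<Rightarrow> ('o + bool) list \<Rightarrow> ('o + ('f, 'p) symb) option" where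
  "tcode \<tau> (Var i) = (\<lambda>p. if p = [] then Some (Inl i) else None)"
| "tcode \<tau> Zero = (\<lambda>p. if p = [] then Some (Inr ZeroSym) else None)"
| "tcode \<tau> (Plus s t) = (\<lambda>p. case p of [] \<Rightarrow> Some (Inr PlusSym)
     | x # q \<Rightarrow> (case x of Inl i \<Rightarrow> None | Inr b \<Rightarrow> if b then tcode \<tau> s q else tcode \<tau> t q))"
| "tcode \<tau> (Minus s t) = (\<lambda>p. case p of [] \<Rightarrow> Some (Inr MinusSym)
     | x # q \<Rightarrow> (case x of Inl i \<Rightarrow> None | Inr b \<Rightarrow> if b then tcode \<tau> s q else tcode \<tau> t q))"
| "tcode \<tau> (Fun f ts) = (\<lambda>p. case p of [] \<Rightarrow> Some (Inr (FunSym f))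
     | x # q \<Rightarrow> (case x of Inl i \<Rightarrow> if i < farity \<tau> f then tcode \<tau> (ts i) q else None | Inr b \<Rightarrow> None))"

definition fcode :: "('f, 'p, 'o::wellorder) vocab \<Rightarrow> ('f, 'p, 'o, 'i) fm \<Rightarrow> ('o + bool) list \<Rightarrow> ('o + ('f, 'p) symb) option" where
  "fcode \<tau> \<phi> = (case \<phi> of
     Eq s t \<Rightarrow> tcode \<tau> (Plus s t)
   | Rel P ts \<Rightarrow> (\<lambda>p. case p of [] \<Rightarrow> Some (Inr (RelSym P))
     | x # q \<Rightarrow> (case x of Inl i \<Rightarrow> if i < rarity \<tau> P then tcode \<tau> (ts i) q else None | Inr b \<Rightarrow> None))
   | _ \<Rightarrow> (\<lambda>p. None))"

lemma tcode_inj: "wf_trm \<tau> n t \<Longrightarrow> wf_trm \<tau> n t' \<Longrightarrow> tcode \<tau> t = tcode \<tau> t' \<Longrightarrow> t = t'"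
proof (induction t arbitrary: t')
  case (Var i)
  from fun_cong[OF Var.prems(3), of "[]"] show ?case by (cases t') auto
next
  case Zero
  from fun_cong[OF Zero.prems(3), of "[]"] show ?case by (cases t') auto
next
  case (Plus s t)
  from fun_cong[OF Plus.prems(3), of "[]"] obtain s' t'' where t': "t' = Plus s' t''" by (cases t') auto
  have "tcode \<tau> s = tcode \<tau> s'" "tcode \<tau> t = tcode \<tau> t''"
    using fun_cong[OF Plus.prems(3), of "Inr True # q" for q] fun_cong[OF Plus.prems(3), of "Inr False # q" for q]
    by (auto simp: t')
  then show ?case using Plus.IH Plus.prems(1,2) by (simp add: t')
next
  case (Minus s t)
  from fun_cong[OF Minus.prems(3), of "[]"] obtain s' t'' where t': "t' = Minus s' t''" by (cases t') auto
  have "tcode \<tau> s = tcode \<tau> s'" "tcode \<tau> t = tcode \<tau> t''"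
    using fun_cong[OF Minus.prems(3), of "Inr True # q" for q] fun_cong[OF Minus.prems(3), of "Inr False # q" for q]
    by (auto simp: t')
  then show ?case using Minus.IH Minus.prems(1,2) by (simp add: t')
next
  case (Fun f ts)
  from fun_cong[OF Fun.prems(3), of "[]"] obtain ts' where t': "t' = Fun f ts'" by (cases t') auto
  have "ts i = ts' i" for i
  proof (cases "i < farity \<tau> f")
    case True
    have "tcode \<tau> (ts i) = tcode \<tau> (ts' i)"
      using fun_cong[OF Fun.prems(3), of "Inl i # q" for q] True by (auto simp: t')
    then show ?thesis by (intro Fun.IH[OF rangeI]) (use Fun.prems(1,2) True in \<open>auto simp: t'\<close>)
  next
    \<comment> \<open>Beyond the arity both argument functions are undefined by extensionality,
      since the code does not see these arguments.\<close>
    case False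
    then show ?thesis using Fun.prems(1,2) by (auto simp: t' extensional_def)
  qed
  then show ?case by (simp add: t' fun_eq_iff)
qed

lemma fcode_inj: "inj_on (fcode \<tau>) (atomic_fms \<tau> n :: ('f, 'p, 'o::wellorder, 'i) fm set)"
proof (rule inj_onI)
  fix \<phi> \<psi> :: "('f, 'p, 'o, 'i) fm" assume "\<phi> \<in> atomic_fms \<tau> n" "\<psi> \<in> atomic_fms \<tau> n" and eq: "fcode \<tau> \<phi> = fcode \<tau> \<psi>"
  then consider s t s' t' where "\<phi> = Eq s t" "\<psi> = Eq s' t'" "wf_trm \<tau> n (Plus s t)" "wf_trm \<tau> n (Plus s' t')"
    | s t P ts where "(\<phi> = Eq s t \<and> \<psi> = Rel P ts) \<or> (\<psi> = Eq s t \<and> \<phi> = Rel P ts)"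
    | P ts P' ts' where "\<phi> = Rel P ts" "\<psi> = Rel P' ts'" "wf_fm \<tau> \<phi> n" "wf_fm \<tau> \<psi> n"
    unfolding atomic_fms_def by auto
  then show "\<phi> = \<psi>"
  proof cases
    case 1
    then show ?thesis using tcode_inj[OF 1(3,4)] eq by (simp add: fcode_def)
  next
    case 2
    then show ?thesis using fun_cong[OF eq, of "[]"] by (auto simp: fcode_def)
  next
    case 3
    have P: "P' = P" using fun_cong[OF eq, of "[]"] by (simp add: fcode_def 3(1,2))
    have "ts i = ts' i" for i
    proof (cases "i < rarity \<tau> P")
      case True
      have "tcode \<tau> (ts i) = tcode \<tau> (ts' i)"
        using fun_cong[OF eq, of "Inl i # q" for q] True by (auto simp: fcode_def 3(1,2) P)
      then show ?thesis by (intro tcode_inj) (use 3 True in \<open>auto simp: P\<close>)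
    next
      case False
      then show ?thesis using 3 by (auto simp: extensional_def P)
    qed
    then show ?thesis by (simp add: 3(1,2) P fun_eq_iff)
  qed
qed

lemma tcode_range:
  "wf_trm \<tau> n t \<Longrightarrow> tcode \<tau> t p \<in> insert None (Some ` (Inl ` UNIV \<union> Inr ` symbols \<tau>))"
proof (induction t arbitrary: p)
  case (Fun f ts)
  have "tcode \<tau> (ts i) q \<in> insert None (Some ` (Inl ` UNIV \<union> Inr ` symbols \<tau>))" if "i < farity \<tau> f" for i q
    by (rule Fun.IH[OF rangeI]) (use Fun.prems that in simp)
  then show ?case using Fun.prems by (auto simp: symbols_def split: list.split sum.split)
qed (auto simp: symbols_def split: list.split sum.split)

lemma fcode_range:
  assumes "\<phi> \<in> atomic_fms \<tau> n"
  shows "fcode \<tau> \<phi> \<in> Func UNIV (insert None (Some ` (Inl ` UNIV \<union> Inr ` symbols \<tau>)))"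
proof -
  have "fcode \<tau> \<phi> p \<in> insert None (Some ` (Inl ` UNIV \<union> Inr ` symbols \<tau>))" for p
    using assms unfolding atomic_fms_def
  proof
    assume "\<phi> \<in> {Eq s t |s t. wf_fm \<tau> (Eq s t) n}"
    then obtain s t where "\<phi> = Eq s t" "wf_trm \<tau> n (Plus s t)" by auto
    then show ?thesis using tcode_range[of \<tau> n "Plus s t" p] by (simp add: fcode_def)
  next
    assume "\<phi> \<in> {Rel P ts |P ts. wf_fm \<tau> (Rel P ts) n}"
    then obtain P ts where P: "\<phi> = Rel P ts" "P \<in> Rels \<tau>" "\<And>i. i < rarity \<tau> P \<Longrightarrow> wf_trm \<tau> n (ts i)" by auto
    then show ?thesis using tcode_range[OF P(3)]
      by (auto simp: fcode_def symbols_def split: list.split sum.split)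
  qed
  then show ?thesis by (auto simp: Func_def)
qed

lemma card_of_lists_le:
  assumes "|UNIV :: 'a set| \<le>o c" "Cinfinite c"
  shows "|UNIV :: 'a list set| \<le>o c"
proof -
  have "|{xs :: 'a list. length xs = n}| \<le>o c" for n
  proof (induction n)
    case 0
    have "{xs :: 'a list. length xs = 0} = {[]}" by auto
    then show ?case using card_of_singleton_le_Cinfinite[OF assms(2)] by simp
  next
    case (Suc n)
    have "{xs :: 'a list. length xs = Suc n} \<subseteq> (\<lambda>(x, xs). x # xs) ` (UNIV \<times> {xs. length xs = n})"
      by (auto simp: length_Suc_conv image_iff)
    then show ?case
      by (rule ordLeq_transitive[OF surj_imp_ordLeq card_of_Times_le[OF assms(1) Suc assms(2)]])
  qed
  moreover have "|UNIV :: nat set| \<le>o c"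
    by (rule ordIso_ordLeq_trans[OF card_of_nat natLeq_ordLeq_cinfinite[OF assms(2)]])
  ultimately have "|\<Union>n. {xs :: 'a list. length xs = n}| \<le>o c"
    by (intro UNION_Cinfinite_bound[OF _ _ assms(2)]) auto
  moreover have "(\<Union>n. {xs :: 'a list. length xs = n}) = UNIV" by auto
  ultimately show ?thesis by simp
qed

text \<open>All functions from finite paths to labels are counted, whence 2^\<mu>; with infinite
  arities terms need not be finite objects. The additional exponential is absorbed by the limit
  \<gamma>.\<close>

lemma card_of_atomic_fms:
  fixes \<tau> :: "('f, 'p, 'o::wellorder) vocab"
  assumes inf: "Cinfinite \<mu>" and o: "|UNIV :: 'o set| \<le>o \<mu>" and \<tau>: "|symbols \<tau>| \<le>o \<mu>"
  shows "|atomic_fms \<tau> n :: ('f, 'p, 'o, 'i) fm set| \<le>o ctwo ^c \<mu>"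
proof -
  let ?L = "insert None (Some ` (Inl ` UNIV \<union> Inr ` symbols \<tau>)) :: ('o + ('f, 'p) symb) option set"
  have "|Inl ` (UNIV :: 'o set) \<union> Inr ` symbols \<tau>| \<le>o \<mu>"
    by (rule Un_Cinfinite_bound[OF ordLeq_transitive[OF card_of_image o] ordLeq_transitive[OF card_of_image \<tau>] inf])
  then have "|Some ` (Inl ` (UNIV :: 'o set) \<union> Inr ` symbols \<tau>)| \<le>o \<mu>"
    by (rule ordLeq_transitive[OF card_of_image])
  then have "|?L| \<le>o \<mu>"
    by (subst insert_is_Un) (rule Un_Cinfinite_bound[OF card_of_singleton_le_Cinfinite[OF inf] _ inf])
  then have L: "|?L| \<le>o ctwo ^c \<mu>"
    by (rule ordLeq_transitive[OF _ ordLeq_ctwo_cexp]) (simp add: inf)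
  have "|UNIV :: bool set| \<le>o \<mu>"
    using ctwo_ordLeq_Cinfinite[OF inf] by (simp add: ctwo_def)
  then have "|(UNIV :: 'o set) <+> (UNIV :: bool set)| \<le>o \<mu>"
    by (intro card_of_Plus_ordLeq_infinite_Field[OF _ o]) (use inf in \<open>auto simp: cinfinite_def\<close>)
  then have "|UNIV :: ('o + bool) set| \<le>o \<mu>" by simp
  then have "|UNIV :: ('o + bool) list set| \<le>o \<mu>" by (rule card_of_lists_le[OF _ inf])
  moreover have "(ctwo ^c \<mu>) ^c \<mu> \<le>o ctwo ^c \<mu>"
    by (rule ordIso_imp_ordLeq[OF cexp_cprod_ordLeq[OF Card_order_ctwo inf Cinfinite_Cnotzero[OF inf]]])
      (simp add: ordLeq_refl inf)
  ultimately have "|Func (UNIV :: ('o + bool) list set) ?L| \<le>o ctwo ^c \<mu>"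
    by (intro card_of_Func_le[OF L _ Cinfinite_ctwo_cexp[OF inf]])
  moreover have "|atomic_fms \<tau> n :: ('f, 'p, 'o, 'i) fm set| \<le>o |Func (UNIV :: ('o + bool) list set) ?L|"
    using fcode_inj[of \<tau> n] fcode_range[of _ \<tau> n] by (intro card_of_ordLeqI[of "fcode \<tau>"])
  ultimately show ?thesis using ordLeq_transitive by blast
qed

section \<open>Types\<close>

text \<open>A map from a proper initial segment with no strict upper bound would have a cofinal
  image. By regularity this image would have size \<theta>, more than the segment has.\<close>

lemma ord_type_regularCard:
  fixes \<theta> :: "'o::wellorder rel"
  assumes \<theta>: "\<theta> = {(x, y). x \<le> y}" and card: "Card_order \<theta>" and inf: "cinfinite \<theta>" and reg: "regularCard \<theta>"
  shows "ord_type TYPE('o)"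
proof
  have F: "Field \<theta> = UNIV" by (auto simp: \<theta> Field_def)
  have nf: "\<not> finite (Field \<theta>)" using inf by (simp add: cinfinite_def)
  have lim: "\<exists>c>a. True" for a :: 'o
  proof -
    obtain b where "a \<noteq> b" "(a, b) \<in> \<theta>" using infinite_Card_order_limit[OF card nf, of a] F by auto
    then have "a < b" by (simp add: \<theta>)
    then show ?thesis by blast
  qed
  show "\<exists>c>a. True" for a :: 'o by (rule lim)
  show "\<exists>c. \<forall>i<b. f i < c" for b and f :: "'o \<Rightarrow> 'o"
  proof (rule ccontr)
    assume no: "\<not> ?thesis"
    have "cofinal (f ` {..<b}) \<theta>"
      unfolding cofinal_def
    proof
      fix a :: 'o
      obtain c where c: "a < c" using lim by blast
      from no obtain i where i: "i < b" "\<not> f i < c" by blast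
      then have "a < f i" using c by simp
      then have "a \<noteq> f i \<and> (a, f i) \<in> \<theta>" by (simp add: \<theta> order_less_le)
      then show "\<exists>y\<in>f ` {..<b}. a \<noteq> y \<and> (a, y) \<in> \<theta>" using i(1) by blast
    qed
    then have eq: "|f ` {..<b}| =o \<theta>" using reg F by (auto simp: regularCard_def)
    have "underS \<theta> b = {..<b}" by (auto simp: underS_def \<theta>)
    then have "|{..<b}| <o \<theta>" using card_of_underS[OF card, of b] F by simp
    then have "|f ` {..<b}| <o \<theta>" by (rule ordLeq_ordLess_trans[OF card_of_image])
    with eq show False using not_ordLess_ordIso by blast
  qed
qed

context ord_type
begin

text \<open>There is one constant sequence for each length.\<close>

lemma card_of_UNIV_le_seqs_lt:
  assumes "x \<in> A"
  shows "|UNIV :: 'o set| \<le>o |seqs_lt A :: ('o \<times> ('o \<Rightarrow> 'a)) set|"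
proof (rule card_of_ordLeqI[of "\<lambda>\<epsilon>. (\<epsilon>, \<lambda>i\<in>{..<\<epsilon>}. x)"])
  show "inj_on (\<lambda>\<epsilon>::'o. (\<epsilon>, \<lambda>i\<in>{..<\<epsilon>}. x)) UNIV" by (auto intro: injI)
qed (use assms in \<open>auto simp: seqs_lt_def\<close>)

lemma infinite_UNIV: "infinite (UNIV :: 'o set)"
proof
  assume fin: "finite (UNIV :: 'o set)"
  obtain c :: 'o where "Max UNIV < c" using unbounded[of "Max UNIV"] by blast
  then show False using Max_ge[OF fin, of c] by simp
qed

lemma Cinfinite_seqs_lt:
  assumes "x \<in> A"
  shows "Cinfinite |seqs_lt A :: ('o \<times> ('o \<Rightarrow> 'a)) set|"
  using card_of_ordLeq_infinite[OF card_of_UNIV_le_seqs_lt[OF assms] infinite_UNIV]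
  by (simp add: cinfinite_def Field_card_of card_of_card_order_on)

lemma card_of_le_seqs_lt: "|A| \<le>o |seqs_lt A :: ('o \<times> ('o \<Rightarrow> 'a)) set|"
proof (rule card_of_ordLeqI[of "\<lambda>x. (oone, singl x)"])
  show "inj_on (\<lambda>x. (oone :: 'o, singl x :: 'o \<Rightarrow> 'a)) A"
  proof (rule inj_onI)
    fix x y :: 'a assume "(oone :: 'o, singl x :: 'o \<Rightarrow> 'a) = (oone, singl y)"
    from arg_cong[OF this, of "\<lambda>p. snd p ozero"] show "x = y" by (simp add: singl_def ozero_less_oone)
  qed
qed (auto simp: seqs_lt_def singl_def)

text \<open>The difference \<open>x - y\<close> of two solutions lies in the group, hence so does
  \<open>z - w\<close>. It is applied to pairs of sequences that share one part, which then cancels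
  in the difference.\<close>

lemma sat_coset:
  assumes H: "subgrp {z. sat \<tau> M \<phi> n z}" and wf: "wf_fm \<tau> \<phi> (n::'o)"
    and xy: "sat \<tau> M \<phi> n x" "sat \<tau> M \<phi> n y" and ag: "agree n (z - w) (x - y)"
  shows "sat \<tau> M \<phi> n z \<longleftrightarrow> sat \<tau> M \<phi> n w"
proof -
  have "sat \<tau> M \<phi> n (x - y)" using subgrp_diff[OF H, of x y] xy by simp
  then have "z - w \<in> {z. sat \<tau> M \<phi> n z}"
    unfolding mem_Collect_eq by (subst sat_agree[OF wf ag])
  from subgrp_diff_cancel[OF H this] show ?thesis by simp
qed

lemma agreeI:
  assumes "\<And>i. i < \<epsilon> \<Longrightarrow> z i = w i" "\<And>j. j < \<zeta> \<Longrightarrow> z (oadd \<epsilon> j) = w (oadd \<epsilon> j)"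
  shows "agree (oadd (\<epsilon>::'o) \<zeta>) z w"
proof (intro allI impI)
  fix i assume "i < oadd \<epsilon> \<zeta>"
  then show "z i = w i" by (cases rule: oadd_cases) (use assms in auto)
qed

lemma pe_no_order:
  assumes H: "subgrp {z. sat \<tau> M \<phi> (oadd \<epsilon> \<zeta>) z}" and wf: "wf_fm \<tau> \<phi> (oadd (\<epsilon>::'o) \<zeta>)"
    and \<kappa>: "Card_order \<kappa>" "|{..<4::nat}| \<le>o \<kappa>"
  shows "\<not> ordered_by \<tau> M \<phi> \<epsilon> \<zeta> \<kappa> a b"
proof
  assume ord: "ordered_by \<tau> M \<phi> \<epsilon> \<zeta> \<kappa> a b"
  have wo: "Well_order \<kappa>" using \<kappa>(1) by (simp add: card_order_on_def)
  have least: "\<exists>m. m \<in> X \<and> (\<forall>x\<in>X. (m, x) \<in> \<kappa>)" if "X \<subseteq> Field \<kappa>" "X \<noteq> {}" for X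
  proof -
    interpret wo_rel \<kappa> by standard (rule wo)
    show ?thesis using minim_in[OF that] minim_least[OF that(1)] by blast
  qed
  have ne: "Field \<kappa> - X \<noteq> {}" if "finite X" "card X < 4" for X
  proof
    assume "Field \<kappa> - X = {}"
    then have "Field \<kappa> \<subseteq> X" by blast
    moreover have "|{..<4::nat}| \<le>o |Field \<kappa>|"
      using card_of_mono2[OF \<kappa>(2)] by (simp add: Field_card_of)
    then obtain f where "inj_on f {..<4::nat}" "f ` {..<4} \<subseteq> Field \<kappa>"
      unfolding card_of_ordLeq[symmetric] by blast
    ultimately have "card {..<4::nat} \<le> card X" using that(1) by (intro card_inj_on_le[of f]) auto
    with that(2) show False by simp
  qed
  \<comment> \<open>The elements \<open>p\<close>, \<open>q\<close>, \<open>r\<close>,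
    \<open>s\<close> stand for the indices 0, 1, 2, 3; four indices are exactly what the identity in
    the overview involves.\<close>
  obtain p where p: "p \<in> Field \<kappa>" "\<And>x. x \<in> Field \<kappa> \<Longrightarrow> (p, x) \<in> \<kappa>"
    using least[of "Field \<kappa>"] ne[of "{}"] by auto
  obtain q where q: "q \<in> Field \<kappa> - {p}" "\<And>x. x \<in> Field \<kappa> - {p} \<Longrightarrow> (q, x) \<in> \<kappa>"
    using least[of "Field \<kappa> - {p}"] ne[of "{p}"] by auto
  have "card {p, q} < 4" by (simp add: card_insert_if)
  then obtain r where r: "r \<in> Field \<kappa> - {p, q}" "\<And>x. x \<in> Field \<kappa> - {p, q} \<Longrightarrow> (r, x) \<in> \<kappa>"
    using least[of "Field \<kappa> - {p, q}"] ne[of "{p, q}"] by auto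
  have "card {p, q, r} < 4" by (simp add: card_insert_if)
  then obtain s where s: "s \<in> Field \<kappa> - {p, q, r}" using ne[of "{p, q, r}"] by auto
  let ?n = "oadd \<epsilon> \<zeta>"
  let ?c = "\<lambda>x y. cat \<epsilon> (a x) \<zeta> (b y)"
  have "(p, q) \<in> \<kappa>" "(p, s) \<in> \<kappa>" "(r, s) \<in> \<kappa>" "(q, r) \<in> \<kappa>" using p q r s by auto
  then have sat: "sat \<tau> M \<phi> ?n (?c p q)" "sat \<tau> M \<phi> ?n (?c p s)" "sat \<tau> M \<phi> ?n (?c r s)"
    and nsat: "\<not> sat \<tau> M \<phi> ?n (?c r q)"
    using ord q(1) r(1) s unfolding ordered_by_def by auto
  \<comment> \<open>Both differences equal \<open>a r - a p\<close> on the first block and 0 on the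
    second.\<close>
  have "agree ?n (?c r q - ?c p q) (?c r s - ?c p s)"
    by (rule agreeI) (simp_all add: cat_left cat_right)
  from sat_coset[OF H wf sat(3,2) this] sat(1) nsat show False by simp
qed

lemma zero_seq_cat: "zero_seq (oadd (\<epsilon>::'o) \<xi>) = cat \<epsilon> (zero_seq \<epsilon>) \<xi> (zero_seq \<xi>)"
proof (rule cat_eqI)
  show "agree \<epsilon> (zero_seq (oadd \<epsilon> \<xi>)) (zero_seq \<epsilon>)"
    using le_oadd[of \<epsilon> \<xi>] by (auto simp: zero_seq_def)
qed (auto simp: zero_seq_def oadd_less_iff)

text \<open>The difference of the two arguments of \<phi> is \<open>a - a'\<close> followed by
  zeros, whatever \<open>b\<close> and \<open>c\<close> are. So one common instance forces agreement
  on all instances of \<phi>.\<close>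

lemma sat_formal_coset:
  assumes H: "subgrp {z. sat \<tau> M \<phi> (oadd \<epsilon> \<xi>) z}" and wf: "wf_fm \<tau> \<phi> (oadd (\<epsilon>::'o) \<xi>)"
    and "sat_formal \<tau> M \<epsilon> a (\<xi>, \<phi>, b0, c0)" "sat_formal \<tau> M \<epsilon> a' (\<xi>, \<phi>, b0, c0)"
  shows "sat_formal \<tau> M \<epsilon> a (\<xi>, \<phi>, b, c) \<longleftrightarrow> sat_formal \<tau> M \<epsilon> a' (\<xi>, \<phi>, b, c)"
  unfolding sat_formal.simps
proof (rule sat_coset[OF H wf])
  let ?n = "oadd \<epsilon> \<xi>"
  let ?d = "\<lambda>a b c. seq_diff ?n (cat \<epsilon> a \<xi> b) c"
  show "sat \<tau> M \<phi> ?n (?d a b0 c0)" "sat \<tau> M \<phi> ?n (?d a' b0 c0)" using assms(3,4) by simp_all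
  show "agree ?n (?d a b c - ?d a' b c) (?d a b0 c0 - ?d a' b0 c0)"
  proof (rule agreeI)
    fix i assume i: "i < \<epsilon>"
    then have "i < ?n" using le_oadd[of \<epsilon> \<xi>] by simp
    with i show "(?d a b c - ?d a' b c) i = (?d a b0 c0 - ?d a' b0 c0) i"
      by (simp add: seq_diff_def cat_left)
  qed (simp add: seq_diff_def cat_right oadd_less_iff)
qed

text \<open>By \<open>sat_formal_coset\<close> a type is determined by one of its instances for each
  formula of \<Lambda>, or by the information that there is none. Thus types are coded by functions
  on \<Lambda> that choose parameters.\<close>

lemma card_of_Stp:
  fixes M :: "('f, 'p, 'o, 'm::ab_group_add) struct" and \<Lambda> :: "('o \<times> ('f, 'p, 'o, 'i) fm) set"
  assumes H: "\<And>n \<phi>. (n, \<phi>) \<in> \<Lambda> \<Longrightarrow> subgrp {z. sat \<tau> M \<phi> n z} \<and> wf_fm \<tau> \<phi> n"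
  shows "|Stp \<tau> B \<gamma> \<Lambda> \<epsilon> A M| \<le>o |seqs_lt A :: ('o \<times> ('o \<Rightarrow> 'm)) set| ^c |\<Lambda>|"
proof (cases "A = {}")
  case True
  \<comment> \<open>Over the empty set the only sequence is the empty one, so the bound to be met is
    1. Either \<epsilon> is 0 and there is one realization, or there are no parameters
    \<open>c\<close> and every type is empty.\<close>
  have "Stp \<tau> B \<gamma> \<Lambda> \<epsilon> A M \<subseteq> {tp \<tau> B \<gamma> \<Lambda> \<epsilon> (\<lambda>_. undefined) A M}"
  proof
    fix p assume "p \<in> Stp \<tau> B \<gamma> \<Lambda> \<epsilon> A M"
    then obtain a where a: "a \<in> seqs \<epsilon> UNIV" "p = tp \<tau> B \<gamma> \<Lambda> \<epsilon> a A M" by (auto simp: Stp_def)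
    show "p \<in> {tp \<tau> B \<gamma> \<Lambda> \<epsilon> (\<lambda>_. undefined) A M}"
    proof (cases "\<epsilon> = ozero")
      case True
      then have "{..<\<epsilon>} = {}" by auto
      then have "a = (\<lambda>_. undefined)" using a(1) by simp
      then show ?thesis using a(2) by simp
    next
      case False
      then have "ozero < \<epsilon>" using ozero_le[of \<epsilon>] by (simp add: order_less_le)
      then have "ozero < oadd \<epsilon> \<xi>" for \<xi> by (rule order_less_le_trans[OF _ le_oadd])
      then have "seqs (oadd \<epsilon> \<xi>) A = {}" for \<xi> using True by (auto simp: PiE_eq_empty_iff)
      then show ?thesis using a(2) by (simp add: tp_def)
    qed
  qed
  then have "|Stp \<tau> B \<gamma> \<Lambda> \<epsilon> A M| \<le>o |{tp \<tau> B \<gamma> \<Lambda> \<epsilon> (\<lambda>_. undefined) A M}|" by (rule card_of_mono1)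
  moreover have "(ozero, \<lambda>_. undefined) \<in> (seqs_lt A :: ('o \<times> ('o \<Rightarrow> 'm)) set)"
    by (auto simp: seqs_lt_def)
  then have "Func \<Lambda> (seqs_lt A :: ('o \<times> ('o \<Rightarrow> 'm)) set) \<noteq> {}" by (intro Func_non_emp) blast
  then have "|{tp \<tau> B \<gamma> \<Lambda> \<epsilon> (\<lambda>_. undefined) A M}| \<le>o |Func \<Lambda> (seqs_lt A :: ('o \<times> ('o \<Rightarrow> 'm)) set)|"
    by (rule card_of_singl_ordLeq)
  ultimately show ?thesis unfolding cexp_def Field_card_of by (rule ordLeq_transitive)
next
  case False
  let ?X = "seqs_lt A :: ('o \<times> ('o \<Rightarrow> 'm)) set"
  let ?T = "insert None (Some ` (?X \<times> ?X))"
  from False obtain x where "x \<in> A" by blast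
  then have X: "Cinfinite |?X|" by (rule Cinfinite_seqs_lt)
  have "|?X \<times> ?X| \<le>o |?X|" by (rule card_of_Times_le[OF _ _ X]) (simp_all add: card_of_mono1)
  then have "|Some ` (?X \<times> ?X)| \<le>o |?X|" by (rule ordLeq_transitive[OF card_of_image])
  then have T: "|?T| \<le>o |?X|"
    by (subst insert_is_Un) (rule Un_Cinfinite_bound[OF card_of_singleton_le_Cinfinite[OF X] _ X])
  \<comment> \<open>A member of \<Lambda> carries only the total length
    \<open>oadd \<epsilon> \<xi>\<close>; the length \<xi> of \<open>b\<close> is recovered by left
    cancellation.\<close>
  define Q where "Q p l q \<longleftrightarrow> (case q of ((\<xi>, b), (n, c)) \<Rightarrow> (\<xi>, snd l, b, c) \<in> p \<and> oadd \<epsilon> \<xi> = n \<and> n = fst l)"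
    for p :: "('f, 'p, 'o, 'i, 'm) formal set" and l q
  define g where "g p l = (if l \<in> \<Lambda> then if \<exists>q. Q p l q then Some (SOME q. Q p l q) else None else undefined)" for p l
  have Q: "q \<in> ?X \<times> ?X" if "Q p l q" "p \<in> Stp \<tau> B \<gamma> \<Lambda> \<epsilon> A M" for p l q
    using that by (auto simp: Q_def Stp_def tp_def seqs_lt_def)
  have g: "g p \<in> Func \<Lambda> ?T" if "p \<in> Stp \<tau> B \<gamma> \<Lambda> \<epsilon> A M" for p
    using that Q[OF someI_ex[of "Q p l" for l]] by (auto simp: Func_def g_def)
  have half: "x \<in> p'" if p: "p \<in> Stp \<tau> B \<gamma> \<Lambda> \<epsilon> A M" "p' \<in> Stp \<tau> B \<gamma> \<Lambda> \<epsilon> A M" "g p = g p'" and x: "x \<in> p" for p p' x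
  proof -
    obtain \<xi> \<phi> b c where x': "x = (\<xi>, \<phi>, b, c)" by (cases x)
    obtain a a' where a: "p = tp \<tau> B \<gamma> \<Lambda> \<epsilon> a A M" "p' = tp \<tau> B \<gamma> \<Lambda> \<epsilon> a' A M" using p(1,2) by (auto simp: Stp_def)
    let ?l = "(oadd \<epsilon> \<xi>, \<phi>)"
    have l: "?l \<in> \<Lambda>" using x by (simp add: x' a(1) tp_def)
    have "Q p ?l ((\<xi>, b), (oadd \<epsilon> \<xi>, c))" using x by (simp add: Q_def x')
    then have ex: "\<exists>q. Q p ?l q" by blast
    then have gp: "g p ?l = Some (SOME q. Q p ?l q)" using l by (simp add: g_def)
    then have "g p' ?l \<noteq> None" using p(3) by simp
    then have ex': "\<exists>q. Q p' ?l q" using l by (auto simp: g_def split: if_splits)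
    then have gp': "g p' ?l = Some (SOME q. Q p' ?l q)" using l by (simp add: g_def)
    define q where "q = (SOME q. Q p ?l q)"
    have "q = (SOME q. Q p' ?l q)" using gp gp' p(3) by (simp add: q_def)
    then have q: "Q p ?l q" "Q p' ?l q" using someI_ex[OF ex] someI_ex[OF ex'] by (simp_all add: q_def)
    obtain \<xi>0 b0 n0 c0 where q0: "q = ((\<xi>0, b0), (n0, c0))" by (metis surj_pair)
    have 1: "(\<xi>0, \<phi>, b0, c0) \<in> p" "oadd \<epsilon> \<xi>0 = n0 \<and> n0 = oadd \<epsilon> \<xi>" and 2: "(\<xi>0, \<phi>, b0, c0) \<in> p'"
      using q unfolding Q_def q0 prod.case fst_conv snd_conv by blast+
    have \<xi>0: "\<xi>0 = \<xi>"
      using trans[OF conjunct1[OF 1(2)] conjunct2[OF 1(2)]] by (simp only: oadd_eq_iff)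
    have s: "sat_formal \<tau> M \<epsilon> a (\<xi>, \<phi>, b0, c0)" "sat_formal \<tau> M \<epsilon> a' (\<xi>, \<phi>, b0, c0)"
      using 1(1) 2 unfolding \<xi>0 a tp_def mem_Collect_eq prod.case by blast+
    have eq: "sat_formal \<tau> M \<epsilon> a (\<xi>, \<phi>, b, c) \<longleftrightarrow> sat_formal \<tau> M \<epsilon> a' (\<xi>, \<phi>, b, c)"
      by (rule sat_formal_coset[OF conjunct1[OF H[OF l]] conjunct2[OF H[OF l]] s])
    show ?thesis using x unfolding x' a tp_def mem_Collect_eq prod.case eq .
  qed
  have "inj_on g (Stp \<tau> B \<gamma> \<Lambda> \<epsilon> A M)"
  proof (rule inj_onI)
    fix p p' assume p: "p \<in> Stp \<tau> B \<gamma> \<Lambda> \<epsilon> A M" "p' \<in> Stp \<tau> B \<gamma> \<Lambda> \<epsilon> A M" "g p = g p'"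
    show "p = p'"
    proof
      show "p \<subseteq> p'" by (rule subsetI, rule half[OF p])
      show "p' \<subseteq> p" by (rule subsetI, rule half[OF p(2,1) p(3)[symmetric]])
    qed
  qed
  then have le: "|Stp \<tau> B \<gamma> \<Lambda> \<epsilon> A M| \<le>o |Func \<Lambda> ?T|"
    using g by (intro card_of_ordLeqI[of g])
  have "|Func \<Lambda> ?T| \<le>o |?X| ^c |\<Lambda>|"
  proof (cases "\<Lambda> = {}")
    case True
    then show ?thesis by (simp add: cexp_def Field_card_of Func_empty card_of_singl_ordLeq)
  next
    case False
    then show ?thesis by (intro card_of_Func_le_cexp[OF T]) (simp_all add: card_of_mono1)
  qed
  with le show ?thesis by (rule ordLeq_transitive)
qed

text \<open>The shift can be taken to be 0: the solutions of the given instance form a coset, and by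
  \<open>sat_formal_coset\<close> they agree on all other instances of \<phi>.\<close>

lemma type_isolated:
  fixes M :: "('f, 'p, 'o, 'm::ab_group_add) struct"
  assumes H: "subgrp {z. sat \<tau> M \<phi> (oadd \<epsilon> \<xi>) z}" and wf: "wf_fm \<tau> \<phi> (oadd (\<epsilon>::'o) \<xi>)"
    and p: "p \<in> Stp \<tau> B \<gamma> \<Lambda> \<epsilon> A M"
    and ne: "p \<inter> {(\<xi>, \<phi>, b, zero_seq (oadd \<epsilon> \<xi>)) | b. b \<in> seqs \<xi> A} \<noteq> {}"
  shows "\<exists>a\<in>seqs \<epsilon> A. \<exists>b\<in>seqs \<xi> A. (\<xi>, \<phi>, b, cat \<epsilon> a \<xi> (zero_seq \<xi>)) \<in> p \<and>
    entails \<tau> M \<epsilon> (\<xi>, \<phi>, b, cat \<epsilon> a \<xi> (zero_seq \<xi>)) (restr_pm p \<epsilon> A \<xi> \<phi>)"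
proof -
  obtain a where a: "p = tp \<tau> B \<gamma> \<Lambda> \<epsilon> a A M" using p by (auto simp: Stp_def)
  obtain b0 where b0: "b0 \<in> seqs \<xi> A" "(\<xi>, \<phi>, b0, zero_seq (oadd \<epsilon> \<xi>)) \<in> p" using ne by blast
  then have z: "zero_seq (oadd \<epsilon> \<xi>) \<in> seqs (oadd \<epsilon> \<xi>) A"
    and s: "sat_formal \<tau> M \<epsilon> a (\<xi>, \<phi>, b0, zero_seq (oadd \<epsilon> \<xi>))"
    and \<phi>: "\<phi> \<in> Lam_pe B \<gamma> (oadd \<epsilon> \<xi>)" "(oadd \<epsilon> \<xi>, \<phi>) \<in> \<Lambda>" by (auto simp: a tp_def)
  \<comment> \<open>In the formal formula for \<phi>(x, b) the zero sequence counts as a parameter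
    sequence from \<open>A\<close>, so the shift by zeros is admissible.\<close>
  have "0 \<in> A" if "i < \<epsilon>" for i
  proof -
    have i: "i < oadd \<epsilon> \<xi>" using that le_oadd[of \<epsilon> \<xi>] by simp
    then have "zero_seq (oadd \<epsilon> \<xi>) i \<in> A" using z by (auto simp: PiE_def)
    with i show ?thesis by (simp add: zero_seq_def)
  qed
  then have z': "zero_seq \<epsilon> \<in> seqs \<epsilon> A" by (auto simp: zero_seq_def)
  have "entails \<tau> M \<epsilon> (\<xi>, \<phi>, b0, zero_seq (oadd \<epsilon> \<xi>)) (restr_pm p \<epsilon> A \<xi> \<phi>)"
    unfolding entails_def
  proof (intro ballI impI)
    fix a' sc assume a': "sat_formal \<tau> M \<epsilon> a' (\<xi>, \<phi>, b0, zero_seq (oadd \<epsilon> \<xi>))" and "sc \<in> restr_pm p \<epsilon> A \<xi> \<phi>"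
    then obtain b c where sc: "sc = ((\<xi>, \<phi>, b, c) \<in> p, (\<xi>, \<phi>, b, c))" "b \<in> seqs \<xi> A" "c \<in> seqs (oadd \<epsilon> \<xi>) A"
      by (auto simp: restr_pm_def)
    have "(\<xi>, \<phi>, b, c) \<in> p \<longleftrightarrow> sat_formal \<tau> M \<epsilon> a (\<xi>, \<phi>, b, c)"
      using \<phi> sc(2,3) by (simp add: a tp_def)
    also have "\<dots> \<longleftrightarrow> sat_formal \<tau> M \<epsilon> a' (\<xi>, \<phi>, b, c)" by (rule sat_formal_coset[OF H wf s a'])
    finally show "case sc of (s, \<chi>) \<Rightarrow> sat_formal \<tau> M \<epsilon> a' \<chi> = s" by (simp add: sc(1))
  qed
  then show ?thesis using b0 z' unfolding zero_seq_cat by blast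
qed

end

section \<open>Order property\<close>

lemma ozero_less_limit: "is_limit \<gamma> \<Longrightarrow> ozero < \<gamma>"
  using ozero_le[of \<gamma>] by (auto simp: is_limit_def order_less_le)

text \<open>The ordinal 1 + \<delta> is at most \<delta> + 1. Hence depth below 1 + \<gamma> means
  depth bounded by some rank below the limit \<gamma>.\<close>

lemma oadd_oone_le_osuc:
  assumes lim: "is_limit \<gamma>" and "\<delta> < \<gamma>"
  shows "oadd oone \<delta> \<le> osuc \<delta>"
  using assms(2)
proof (induction \<delta> rule: less_induct)
  case (less \<delta>)
  note lt = less_osuc[OF less.prems]
  have "oone \<le> osuc \<delta>"
    unfolding oone_def by (rule Least_le) (rule le_less_trans[OF ozero_le lt])
  moreover have "oadd oone \<beta> < osuc \<delta>" if "\<beta> < \<delta>" for \<beta>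
  proof -
    have "oadd oone \<beta> \<le> osuc \<beta>" using less.IH[OF that] that less.prems by simp
    also have "\<dots> \<le> \<delta>" by (rule osuc_le[OF that])
    finally show ?thesis using lt by simp
  qed
  ultimately show ?case by (subst oadd.simps) (auto intro: Least_le)
qed

context ord_type
begin

text \<open>The depths of the members of an infinite combination may be cofinal in \<gamma>.
  Agreement is therefore required at all ranks below \<gamma>, while each member uses just one of
  them.\<close>

lemma eqv_bool_comb:
  fixes \<phi> :: "('f, 'p, 'o, 'i) fm" and \<gamma> :: "'g::wellorder"
  assumes lim: "is_limit \<gamma>" and "\<phi> \<in> bool_comb (L_inf \<tau> \<gamma> n)"
    and eqv: "\<And>\<delta>. \<delta> < \<gamma> \<Longrightarrow> eqv (atomic_sets TYPE(('f, 'p, 'o, 'i) fm) \<tau> M) \<delta> n z z'"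
  shows "sat \<tau> M \<phi> n z \<longleftrightarrow> sat \<tau> M \<phi> n z'"
  using assms(2)
proof induction
  case (base \<phi>)
  then have wf: "wf_fm \<tau> \<phi> n"
    and "qd_le \<phi> (ozero :: 'g) \<or> (\<exists>\<delta><\<gamma>. qd_le \<phi> (oadd oone \<delta>))" by (auto simp: L_inf_def)
  then obtain \<beta> :: 'g where \<beta>: "\<beta> < \<gamma>" "qd_le \<phi> \<beta>"
  proof (elim disjE exE conjE)
    fix \<delta> :: 'g assume "\<delta> < \<gamma>" "qd_le \<phi> (oadd oone \<delta>)"
    then show thesis
      using that le_less_trans[OF oadd_oone_le_osuc[OF lim] osuc_less_limit[OF lim]] by blast
  qed (use that ozero_less_limit[OF lim] in blast)
  show ?case by (rule eqv_sat[OF wf \<beta>(2) eqv[OF \<beta>(1)]])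
qed auto

lemma bool_comb_wf: "\<phi> \<in> bool_comb (L_inf \<tau> \<gamma> n) \<Longrightarrow> wf_fm \<tau> \<phi> n"
  by (induction rule: bool_comb.induct) (auto simp: L_inf_def)

lemma bool_comb_no_order:
  fixes \<tau> :: "('f, 'p, 'o) vocab" and N :: "('f, 'p, 'o, 'm::ab_group_add) struct"
    and \<phi> :: "('f, 'p, 'o, 'i) fm" and \<gamma> :: "'g::wellorder" and bth :: "'g \<Rightarrow> 'k rel" and \<kappa> :: "'k rel"
  assumes N: "N \<in> additive_structures \<tau>" and lim: "is_limit \<gamma>"
    and \<phi>: "\<phi> \<in> bool_comb (L_inf \<tau> \<gamma> (oadd \<epsilon> \<zeta>))"
    and bth: "is_beth |seqs_lt (symbols \<tau>) :: ('o \<times> ('o \<Rightarrow> ('f, 'p) symb)) set| \<gamma> bth"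
    and le: "cardSuc (ctwo ^c bth \<gamma>) \<le>o \<kappa>"
  shows "\<not> ordered_by \<tau> N \<phi> \<epsilon> \<zeta> \<kappa> a b"
proof
  assume ord: "ordered_by \<tau> N \<phi> \<epsilon> \<zeta> \<kappa> a b"
  let ?base = "|seqs_lt (symbols \<tau>) :: ('o \<times> ('o \<Rightarrow> ('f, 'p) symb)) set|"
  \<comment> \<open>\<open>?\<mu>\<close> bounds the invariant groups of all ranks below \<gamma>.
    Its power \<open>?\<chi>\<close> bounds the classes up to rank \<gamma> inclusive and satisfies
    the exponent condition needed for refining filters.\<close>
  let ?\<mu> = "bth \<gamma>" and ?\<chi> = "ctwo ^c bth \<gamma>" and ?n = "oadd \<epsilon> \<zeta>"
  let ?A = "atomic_sets TYPE(('f, 'p, 'o, 'i) fm) \<tau> N"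
  have zs: "ZeroSym \<in> symbols \<tau>" by (simp add: symbols_def)
  have inf0: "Cinfinite ?base" by (rule Cinfinite_seqs_lt[OF zs])
  have o: "|UNIV :: 'o set| \<le>o ?base" by (rule card_of_UNIV_le_seqs_lt[OF zs])
  have card: "Card_order (bth x)" if "x \<le> \<gamma>" for x using bth that by (simp add: is_beth_def)
  have bz: "bth ozero =o ?base" using bth by (simp add: is_beth_def)
  have \<mu>0: "?base \<le>o bth x" if "x \<le> \<gamma>" for x
    by (rule ordIso_ordLeq_trans[OF ordIso_symmetric[OF bz] is_beth_mono[OF bth ozero_le that]])
  have infb: "Cinfinite (bth x)" if "x \<le> \<gamma>" for x
    using cinfinite_mono[OF \<mu>0[OF that]] inf0 card[OF that] by simp
  have inf: "Cinfinite ?\<mu>" by (rule infb) simp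
  have inf\<chi>: "Cinfinite ?\<chi>" by (rule Cinfinite_ctwo_cexp[OF inf])
  have \<mu>\<chi>: "?\<mu> \<le>o ?\<chi>" by (rule ordLeq_ctwo_cexp) (simp add: inf)
  have exp: "?\<chi> ^c ?\<mu> \<le>o ?\<chi>"
    by (rule ordIso_imp_ordLeq[OF cexp_cprod_ordLeq[OF Card_order_ctwo inf Cinfinite_Cnotzero[OF inf]]])
      (simp add: ordLeq_refl inf)
  have suc: "cardSuc ?\<mu> \<le>o ?\<chi>"
    by (rule cardSuc_least) (use inf inf\<chi> ordLess_ctwo_cexp in auto)
  have A0: "|?A n| \<le>o ctwo ^c ?base" for n
    unfolding atomic_sets_def
    by (rule ordLeq_transitive[OF card_of_image card_of_atomic_fms[OF inf0 o card_of_le_seqs_lt]])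
  have A: "|?A n| \<le>o ?\<mu>" for n
  proof -
    have "ctwo ^c ?base \<le>o ctwo ^c bth ozero"
      by (rule cexp_mono2_Cnotzero[OF \<mu>0[OF ozero_le] Card_order_ctwo Cinfinite_Cnotzero[OF inf0]])
    moreover have "ctwo ^c bth ozero \<le>o bth (osuc ozero)"
      by (rule is_beth_osuc[OF bth ozero_less_limit[OF lim]])
    moreover have "bth (osuc ozero) \<le>o ?\<mu>"
      by (rule is_beth_mono[OF bth osuc_le[OF ozero_less_limit[OF lim]]]) simp
    ultimately show ?thesis
      using ordLeq_transitive[OF ordLeq_transitive[OF ordLeq_transitive[OF A0[of n]]]] by blast
  qed
  \<comment> \<open>The successors produced by the counting of classes stay below the limit
    \<gamma>.\<close>
  have lt3: "osuc (osuc (osuc \<delta>)) < \<gamma>" if "\<delta> < \<gamma>" for \<delta>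
    by (intro osuc_less_limit[OF lim] that)
  have classes0: "|all_classes ?A \<delta>| \<le>o bth (osuc (osuc (osuc \<delta>)))" if "\<delta> < \<gamma>" for \<delta>
    by (rule is_beth_card_classes[OF bth inf0 lim o A0 that])
  have classes\<mu>: "|all_classes ?A \<delta>| \<le>o ?\<mu>" if "\<delta> < \<gamma>" for \<delta>
    by (rule ordLeq_transitive[OF classes0[OF that] is_beth_mono[OF bth]]) (use lt3[OF that] in simp_all)
  have grps: "|\<Union>\<delta>\<in>{..<\<gamma>}. eqv_grps ?A \<delta> n| \<le>o ?\<mu>" for n
  proof (rule UNION_Cinfinite_bound[OF is_beth_card_lessThan[OF bth order_refl] _ inf], rule ballI)
    fix \<delta> assume "\<delta> \<in> {..<\<gamma>}"
    then have \<delta>: "\<delta> < \<gamma>" by simp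
    let ?s = "osuc (osuc (osuc \<delta>))"
    have "|eqv_grps ?A \<delta> n| \<le>o ctwo ^c bth ?s"
      by (rule card_of_eqv_grps[OF infb classes0[OF \<delta>]]) (use lt3[OF \<delta>] in simp)
    moreover have "ctwo ^c bth ?s \<le>o bth (osuc ?s)" by (rule is_beth_osuc[OF bth lt3[OF \<delta>]])
    moreover have "bth (osuc ?s) \<le>o ?\<mu>"
      by (rule is_beth_mono[OF bth osuc_le[OF lt3[OF \<delta>]]]) simp
    ultimately show "|eqv_grps ?A \<delta> n| \<le>o ?\<mu>"
      using ordLeq_transitive[OF ordLeq_transitive] by blast
  qed
  have classes: "|range (eqv_class ?A \<delta> n)| \<le>o ?\<chi>" if "\<delta> \<le> \<gamma>" for \<delta> n
  proof (rule ordLeq_transitive[OF card_of_eqv_class_le], cases "\<delta> = \<gamma>")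
    case True
    show "|all_classes ?A \<delta>| \<le>o ?\<chi>"
      unfolding True
      by (rule card_of_all_classes[OF inf ordLeq_transitive[OF o \<mu>0[OF order_refl]] A
            is_beth_card_lessThan[OF bth order_refl] classes\<mu>])
  next
    case False
    with that have "\<delta> < \<gamma>" by simp
    then show "|all_classes ?A \<delta>| \<le>o ?\<chi>" by (rule ordLeq_transitive[OF classes\<mu> \<mu>\<chi>])
  qed
  \<comment> \<open>Only an initial part of the order is used: the sequences are pulled back along
    an embedding of the successor of \<open>?\<chi>\<close> into \<kappa>.\<close>
  obtain f where f: "embed (cardSuc ?\<chi>) \<kappa> f" using le by (auto simp: ordLeq_def)
  have wo: "Well_order (cardSuc ?\<chi>)" using inf\<chi> by (simp add: cardSuc_Well_order)
  have f_mono: "(f x, f y) \<in> \<kappa>" if "(x, y) \<in> cardSuc ?\<chi>" for x y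
    using embed_compat[OF f] that by (auto simp: compat_def)
  have f_inj: "inj_on f (Field (cardSuc ?\<chi>))" by (rule embed_inj_on[OF wo f])
  \<comment> \<open>The two blocks are padded by zeros, so that \<open>u x + v y\<close> is the
    concatenation of \<open>a (f x)\<close> and \<open>b (f y)\<close> on the context. In
    \<open>v\<close> the concatenation serves only to shift \<open>b\<close> beyond
    \<epsilon>.\<close>
  define u where "u x = (\<lambda>i. if i < \<epsilon> then a (f x) i else 0)" for x
  define v where "v x = (\<lambda>i. if i < \<epsilon> then 0 else cat \<epsilon> (a (f x)) \<zeta> (b (f x)) i)" for x
  have uv: "sat \<tau> N \<phi> ?n (u x + v y) \<longleftrightarrow> sat \<tau> N \<phi> ?n (cat \<epsilon> (a (f x)) \<zeta> (b (f y)))" for x y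
  proof -
    have ag: "agree ?n (u x + v y) (cat \<epsilon> (a (f x)) \<zeta> (b (f y)))"
    proof (rule agreeI)
      fix j assume "j < \<zeta>"
      then show "(u x + v y) (oadd \<epsilon> j) = cat \<epsilon> (a (f x)) \<zeta> (b (f y)) (oadd \<epsilon> j)"
        by (simp add: u_def v_def cat_right leD[OF le_oadd])
    qed (simp add: u_def v_def cat_left)
    show ?thesis by (rule sat_agree[OF bool_comb_wf[OF \<phi>] ag])
  qed
  show False
  proof (rule no_long_order[OF inf inf\<chi> exp suc _ grps classes])
    show "subgrp S" if "S \<in> ?A n" for n S
      using that subgrp_atomic[OF N] unfolding atomic_sets_def by blast
    show "z' \<in> {z. sat \<tau> N \<phi> ?n z}"
      if "\<And>\<delta>. \<delta> < \<gamma> \<Longrightarrow> eqv ?A \<delta> ?n z z'" "z \<in> {z. sat \<tau> N \<phi> ?n z}" for z z'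
      using eqv_bool_comb[OF lim \<phi> that(1)] that(2) by simp
    show "u x + v y \<in> {z. sat \<tau> N \<phi> ?n z} \<and> u y + v x \<notin> {z. sat \<tau> N \<phi> ?n z}"
      if "(x, y) \<in> cardSuc ?\<chi>" "x \<noteq> y" for x y
    proof -
      have "f x \<noteq> f y"
        using f_inj that by (auto simp: inj_on_def Field_def)
      then show ?thesis
        unfolding mem_Collect_eq uv using ord f_mono[OF that(1)] by (simp add: ordered_by_def)
    qed
  qed
qed

end

theorem theorem3p3:
  fixes \<theta> :: "'o::wellorder rel"
    and \<tau> :: "('f, 'p, 'o) vocab"
    and K :: "('f, 'p, 'o, 'm::ab_group_add) struct set"
    and B :: "'o \<Rightarrow> ('f, 'p, 'o, 'i) fm set"
    and \<gamma> :: "'g::wellorder"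
    and \<Lambda> :: "('o \<times> ('f, 'p, 'o, 'i) fm) set"
    and M :: "('f, 'p, 'o, 'm) struct"
    and A :: "'m set"
  assumes "\<theta> = {(x, y). x \<le> y}" and "Card_order \<theta>" and "cinfinite \<theta>" and "regularCard \<theta>"
    and "(\<exists>R :: 'f ring. ring R \<and> \<tau> = ring_vocab R \<and> K = left_modules R \<and> B = linear_fms R) \<or>
         (K = additive_structures \<tau> \<and> B = atomic_fms \<tau>)"
    and "is_limit \<gamma>"
    and "\<Lambda> \<subseteq> Lam_pe_all B \<gamma>"
    and "M \<in> K"
  shows
    "(\<forall>\<epsilon>. |Stp \<tau> B \<gamma> \<Lambda> \<epsilon> A M| \<le>o |seqs_lt A :: ('o \<times> ('o \<Rightarrow> 'm)) set| ^c |\<Lambda>| )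
     \<and>
     (\<forall>(\<kappa> :: 'k rel) \<epsilon> \<zeta>. Card_order \<kappa> \<and> |{..<4::nat}| \<le>o \<kappa> \<longrightarrow>
        \<not> (\<exists>a b. \<exists>\<phi>\<in>Lam_pe B \<gamma> (oadd \<epsilon> \<zeta>). ordered_by \<tau> M \<phi> \<epsilon> \<zeta> \<kappa> a b))
     \<and>
     (\<forall>(\<kappa> :: 'k rel) (bth :: 'g \<Rightarrow> 'k rel) \<epsilon> \<zeta>.
        \<forall>\<phi>\<in>bool_comb (L_inf \<tau> \<gamma> (oadd \<epsilon> \<zeta>) :: ('f, 'p, 'o, 'i) fm set).
        Card_order \<kappa> \<and> is_beth |seqs_lt (symbols \<tau>) :: ('o \<times> ('o \<Rightarrow> ('f, 'p) symb)) set| \<gamma> bth \<longrightarrow>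
        (cardSuc (ctwo ^c (ctwo ^c bth \<gamma>)) \<le>o \<kappa> \<longrightarrow> \<not> (\<exists>N\<in>K. \<exists>a b. ordered_by \<tau> N \<phi> \<epsilon> \<zeta> \<kappa> a b)) \<and>
        (cardSuc (ctwo ^c bth \<gamma>) \<le>o \<kappa> \<longrightarrow> \<not> (\<exists>N\<in>K. \<exists>a b. ordered_by \<tau> N \<phi> \<epsilon> \<zeta> \<kappa> a b)))
     \<and>
     (\<forall>\<epsilon> \<xi>. \<forall>p\<in>Stp \<tau> B \<gamma> \<Lambda> \<epsilon> A M. \<forall>\<phi>\<in>Lam_pe B \<gamma> (oadd \<epsilon> \<xi>).
        p \<inter> {(\<xi>, \<phi>, b, zero_seq (oadd \<epsilon> \<xi>)) | b. b \<in> seqs \<xi> A} \<noteq> {} \<longrightarrow>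
        (\<exists>a\<in>seqs \<epsilon> A. \<exists>b\<in>seqs \<xi> A.
           (\<xi>, \<phi>, b, cat \<epsilon> a \<xi> (zero_seq \<xi>)) \<in> p \<and>
           entails \<tau> M \<epsilon> (\<xi>, \<phi>, b, cat \<epsilon> a \<xi> (zero_seq \<xi>)) (restr_pm p \<epsilon> A \<xi> \<phi>)))"
proof -
  interpret ord_type "TYPE('o)" by (rule ord_type_regularCard[OF assms(1-4)])
  \<comment> \<open>Modules are additive structures and linear equations are atomic formulas, so
    both alternatives for \<open>K\<close> and \<open>B\<close> are treated at once.\<close>
  have K: "N \<in> additive_structures \<tau>" if "N \<in> K" for N
    using assms(5) that left_modules_additive by auto
  have B: "B n \<subseteq> atomic_fms \<tau> n" for n
    using assms(5) linear_fms_atomic by auto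
  have pe: "subgrp {z. sat \<tau> M \<phi> n z} \<and> wf_fm \<tau> \<phi> n" if "\<phi> \<in> Lam_pe B \<gamma> n" for n \<phi>
    using that subgrp_pe[OF K[OF assms(8)] B, of \<gamma> n \<phi>] pe_wf[OF B, of \<gamma> n \<phi>] by (simp add: Lam_pe_def)
  have part1: "|Stp \<tau> B \<gamma> \<Lambda> \<epsilon> A M| \<le>o |seqs_lt A :: ('o \<times> ('o \<Rightarrow> 'm)) set| ^c |\<Lambda>|" for \<epsilon>
    by (rule card_of_Stp) (use pe assms(7) in \<open>auto simp: Lam_pe_all_def\<close>)
  have part2: "\<not> ordered_by \<tau> M \<phi> \<epsilon> \<zeta> \<kappa> a b"
    if "Card_order \<kappa>" "|{..<4::nat}| \<le>o \<kappa>" "\<phi> \<in> Lam_pe B \<gamma> (oadd \<epsilon> \<zeta>)" for \<kappa> :: "'k rel" and \<epsilon> \<zeta> \<phi> a b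
    using pe_no_order[OF _ _ that(1,2)] pe[OF that(3)] by blast
  have part3: "\<not> ordered_by \<tau> N \<phi> \<epsilon> \<zeta> \<kappa> a b"
    if "\<phi> \<in> bool_comb (L_inf \<tau> \<gamma> (oadd \<epsilon> \<zeta>))" "cardSuc (ctwo ^c bth \<gamma>) \<le>o \<kappa>" "N \<in> K"
      "is_beth |seqs_lt (symbols \<tau>) :: ('o \<times> ('o \<Rightarrow> ('f, 'p) symb)) set| \<gamma> bth"
    for \<kappa> :: "'k rel" and bth :: "'g \<Rightarrow> 'k rel" and \<epsilon> \<zeta> N a b and \<phi> :: "('f, 'p, 'o, 'i) fm"
    by (rule bool_comb_no_order[OF K[OF that(3)] assms(6) that(1,4,2)])
  \<comment> \<open>The weaker bound in (3) is reduced to the sharper one.\<close>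
  have suc_le: "cardSuc (ctwo ^c c) \<le>o \<kappa>" if "cardSuc (ctwo ^c (ctwo ^c c)) \<le>o \<kappa>" for c \<kappa> :: "'k rel"
  proof -
    have "cardSuc (ctwo ^c c) \<le>o cardSuc (ctwo ^c (ctwo ^c c))"
      by (subst cardSuc_mono_ordLeq) (simp_all add: Card_order_cexp ordLeq_ctwo_cexp)
    then show ?thesis using that by (rule ordLeq_transitive)
  qed
  have part4: "\<exists>a\<in>seqs \<epsilon> A. \<exists>b\<in>seqs \<xi> A. (\<xi>, \<phi>, b, cat \<epsilon> a \<xi> (zero_seq \<xi>)) \<in> p \<and>
      entails \<tau> M \<epsilon> (\<xi>, \<phi>, b, cat \<epsilon> a \<xi> (zero_seq \<xi>)) (restr_pm p \<epsilon> A \<xi> \<phi>)"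
    if "p \<in> Stp \<tau> B \<gamma> \<Lambda> \<epsilon> A M" "\<phi> \<in> Lam_pe B \<gamma> (oadd \<epsilon> \<xi>)"
      "p \<inter> {(\<xi>, \<phi>, b, zero_seq (oadd \<epsilon> \<xi>)) | b. b \<in> seqs \<xi> A} \<noteq> {}" for \<epsilon> \<xi> p \<phi>
    by (rule type_isolated[OF conjunct1[OF pe[OF that(2)]] conjunct2[OF pe[OF that(2)]] that(1,3)])
  show ?thesis
  proof (intro conjI allI impI ballI notI)
    show "|Stp \<tau> B \<gamma> \<Lambda> \<epsilon> A M| \<le>o |seqs_lt A :: ('o \<times> ('o \<Rightarrow> 'm)) set| ^c |\<Lambda>|" for \<epsilon> by (rule part1)
  next
    fix \<kappa> :: "'k rel" and \<epsilon> \<zeta>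
    assume "Card_order \<kappa> \<and> |{..<4::nat}| \<le>o \<kappa>" "\<exists>a b. \<exists>\<phi>\<in>Lam_pe B \<gamma> (oadd \<epsilon> \<zeta>). ordered_by \<tau> M \<phi> \<epsilon> \<zeta> \<kappa> a b"
    then show False using part2 by blast
  next
    fix \<kappa> :: "'k rel" and bth :: "'g \<Rightarrow> 'k rel" and \<epsilon> \<zeta> and \<phi> :: "('f, 'p, 'o, 'i) fm"
    assume "\<phi> \<in> bool_comb (L_inf \<tau> \<gamma> (oadd \<epsilon> \<zeta>))"
      "Card_order \<kappa> \<and> is_beth |seqs_lt (symbols \<tau>) :: ('o \<times> ('o \<Rightarrow> ('f, 'p) symb)) set| \<gamma> bth"
      "cardSuc (ctwo ^c (ctwo ^c bth \<gamma>)) \<le>o \<kappa>" "\<exists>N\<in>K. \<exists>a b. ordered_by \<tau> N \<phi> \<epsilon> \<zeta> \<kappa> a b"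
    then show False using part3 suc_le by blast
  next
    fix \<kappa> :: "'k rel" and bth :: "'g \<Rightarrow> 'k rel" and \<epsilon> \<zeta> and \<phi> :: "('f, 'p, 'o, 'i) fm"
    assume "\<phi> \<in> bool_comb (L_inf \<tau> \<gamma> (oadd \<epsilon> \<zeta>))"
      "Card_order \<kappa> \<and> is_beth |seqs_lt (symbols \<tau>) :: ('o \<times> ('o \<Rightarrow> ('f, 'p) symb)) set| \<gamma> bth"
      "cardSuc (ctwo ^c bth \<gamma>) \<le>o \<kappa>" "\<exists>N\<in>K. \<exists>a b. ordered_by \<tau> N \<phi> \<epsilon> \<zeta> \<kappa> a b"
    then show False using part3 by blast
  next
    fix \<epsilon> \<xi> p \<phi>
    assume "p \<in> Stp \<tau> B \<gamma> \<Lambda> \<epsilon> A M" "\<phi> \<in> Lam_pe B \<gamma> (oadd \<epsilon> \<xi>)"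
      "p \<inter> {(\<xi>, \<phi>, b, zero_seq (oadd \<epsilon> \<xi>)) | b. b \<in> seqs \<xi> A} \<noteq> {}"
    then show "\<exists>a\<in>seqs \<epsilon> A. \<exists>b\<in>seqs \<xi> A. (\<xi>, \<phi>, b, cat \<epsilon> a \<xi> (zero_seq \<xi>)) \<in> p \<and>
      entails \<tau> M \<epsilon> (\<xi>, \<phi>, b, cat \<epsilon> a \<xi> (zero_seq \<xi>)) (restr_pm p \<epsilon> A \<xi> \<phi>)" by (rule part4)
  qed
qed

end
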